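(* For a fixed context-free grammar $G$, all-pairs CFL reachability on an edge-labeled directed acyclic graph $H$ can be solved in time $\mathcal{O}(|H|^{\omega})$, where $|H|$ is the number of vertices of $H$ and $\omega$ is the matrix multiplication exponent.
   Context: Given a context-free grammar $G=(N,\Sigma,P,S)$ and a directed graph whose edges are labeled with symbols of $\Sigma$, a path from $u$ to $v$ is an $S$-path if the concatenation of its labels lies in $\mathcal{L}(G)$. All-pairs CFL reachability asks to determine, for every ordered pair of vertices $(u,v)$, whether there is an $S$-path from $u$ to $v$. $\omega$ is the infimum of $c$ such that two $n\times n$ matrices can be multiplied in $\mathcal{O}(n^c)$ time. *)

theory Defs
  imports
    "HOL-Library.Landau_Symbols"
    "HOL-Library.Countable_Set"
    "Jordan_Normal_Form.Matrix"
begin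

section \<open>Context-free grammars\<close>

datatype ('n, 't) sym = Nt 'n | Tm 't

record ('n, 't) cfg =
  nonterminals :: "'n set"
  terminals :: "'t set"
  productions :: "('n \<times> ('n, 't) sym list) set"
  start :: 'n

definition wf_cfg :: "('n, 't) cfg \<Rightarrow> bool" where
  "wf_cfg G \<longleftrightarrow>
     finite (nonterminals G) \<and> finite (terminals G) \<and> finite (productions G) \<and>
     start G \<in> nonterminals G \<and>
     (\<forall>(A, \<alpha>) \<in> productions G.
        A \<in> nonterminals G \<and> set \<alpha> \<subseteq> Nt ` nonterminals G \<union> Tm ` terminals G)"

inductive derive_step :: "('n, 't) cfg \<Rightarrow> ('n, 't) sym list \<Rightarrow> ('n, 't) sym list \<Rightarrow> bool"
  for G where
  "(A, \<alpha>) \<in> productions G \<Longrightarrow> derive_step G (\<beta> @ [Nt A] @ \<gamma>) (\<beta> @ \<alpha> @ \<gamma>)"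

definition lang :: "('n, 't) cfg \<Rightarrow> 't list set" where
  "lang G = {w. (derive_step G)\<^sup>*\<^sup>* [Nt (start G)] (map Tm w)}"

section \<open>Edge-labeled graphs\<close>

text \<open>
  A graph with \<open>n\<close> vertices has vertex set \<open>{..<n}\<close>; a triple \<open>(u, a, v)\<close> is an edge from \<open>u\<close>
  to \<open>v\<close> with label \<open>a\<close>, so parallel edges with different labels are allowed. The vertex
  numbering is arbitrary: for an acyclic graph it need not be a topological order.
\<close>

definition labeled_graph :: "'t set \<Rightarrow> nat \<Rightarrow> (nat \<times> 't \<times> nat) set \<Rightarrow> bool" where
  "labeled_graph \<Sigma> n E \<longleftrightarrow> E \<subseteq> {..<n} \<times> \<Sigma> \<times> {..<n}"

definition labeled_dag :: "'t set \<Rightarrow> nat \<Rightarrow> (nat \<times> 't \<times> nat) set \<Rightarrow> bool" where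
  "labeled_dag \<Sigma> n E \<longleftrightarrow> labeled_graph \<Sigma> n E \<and> acyclic {(u, v). \<exists>a. (u, a, v) \<in> E}"

inductive labeled_path :: "('v \<times> 't \<times> 'v) set \<Rightarrow> 'v \<Rightarrow> 't list \<Rightarrow> 'v \<Rightarrow> bool"
  for E where
  "labeled_path E u [] u"
| "(u, a, v) \<in> E \<Longrightarrow> labeled_path E v w x \<Longrightarrow> labeled_path E u (a # w) x"

definition S_path :: "('n, 't) cfg \<Rightarrow> ('v \<times> 't \<times> 'v) set \<Rightarrow> 'v \<Rightarrow> 'v \<Rightarrow> bool" where
  "S_path G E u v \<longleftrightarrow> (\<exists>w \<in> lang G. labeled_path E u w v)"

section \<open>The machine model\<close>

text \<open>
  Running times refer to a word RAM, presented as a language of while programs over integer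
  scalars and integer arrays with indirect addressing. A program mentions only finitely many
  scalars and arrays and does not depend on the input. A store is a pair of the scalars and the
  arrays; arrays are indexed by all integers.
\<close>

datatype aexp =
    Const int
  | Var nat
  | Arr nat aexp
  | Plus aexp aexp
  | Minus aexp aexp
  | Times aexp aexp
  | Div aexp aexp

datatype bexp = Less aexp aexp | Not bexp | And bexp bexp

datatype com =
    Skip
  | Assign nat aexp
  | Store nat aexp aexp
  | Seq com com
  | If bexp com com
  | While bexp com

type_synonym store = "(nat \<Rightarrow> int) \<times> (nat \<Rightarrow> int \<Rightarrow> int)"

fun aval :: "aexp \<Rightarrow> store \<Rightarrow> int" where
  "aval (Const i) s = i"
| "aval (Var x) s = fst s x"
| "aval (Arr a e) s = snd s a (aval e s)"
| "aval (Plus e1 e2) s = aval e1 s + aval e2 s"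
| "aval (Minus e1 e2) s = aval e1 s - aval e2 s"
| "aval (Times e1 e2) s = aval e1 s * aval e2 s"
| "aval (Div e1 e2) s = aval e1 s div aval e2 s"

fun bval :: "bexp \<Rightarrow> store \<Rightarrow> bool" where
  "bval (Less e1 e2) s \<longleftrightarrow> aval e1 s < aval e2 s"
| "bval (Not b) s \<longleftrightarrow> \<not> bval b s"
| "bval (And b1 b2) s \<longleftrightarrow> bval b1 s \<and> bval b2 s"

text \<open>
  Every value occurring in the evaluation of an expression, array indices included, must fit
  into a word, that is, have absolute value at most \<open>W\<close>. Without such a bound, unit-cost
  arithmetic could process a whole matrix row packed into a single number.
\<close>

fun afits :: "int \<Rightarrow> aexp \<Rightarrow> store \<Rightarrow> bool" where
  "afits W (Const i) s \<longleftrightarrow> \<bar>i\<bar> \<le> W"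
| "afits W (Var x) s \<longleftrightarrow> \<bar>fst s x\<bar> \<le> W"
| "afits W (Arr a e) s \<longleftrightarrow> afits W e s \<and> \<bar>aval (Arr a e) s\<bar> \<le> W"
| "afits W (Plus e1 e2) s \<longleftrightarrow> afits W e1 s \<and> afits W e2 s \<and> \<bar>aval (Plus e1 e2) s\<bar> \<le> W"
| "afits W (Minus e1 e2) s \<longleftrightarrow> afits W e1 s \<and> afits W e2 s \<and> \<bar>aval (Minus e1 e2) s\<bar> \<le> W"
| "afits W (Times e1 e2) s \<longleftrightarrow> afits W e1 s \<and> afits W e2 s \<and> \<bar>aval (Times e1 e2) s\<bar> \<le> W"
| "afits W (Div e1 e2) s \<longleftrightarrow> afits W e1 s \<and> afits W e2 s \<and> \<bar>aval (Div e1 e2) s\<bar> \<le> W"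

fun bfits :: "int \<Rightarrow> bexp \<Rightarrow> store \<Rightarrow> bool" where
  "bfits W (Less e1 e2) s \<longleftrightarrow> afits W e1 s \<and> afits W e2 s"
| "bfits W (Not b) s \<longleftrightarrow> bfits W b s"
| "bfits W (And b1 b2) s \<longleftrightarrow> bfits W b1 s \<and> bfits W b2 s"

text \<open>
  \<open>exec W c s t s'\<close>: with words bounded by \<open>W\<close>, the program \<open>c\<close> started in \<open>s\<close> terminates in
  \<open>s'\<close> after \<open>t\<close> steps. A run that overflows a word has no final store. Each assignment and each
  test counts as one step; the expressions of a program have constant size, so counting their
  individual operations would change running times by at most a constant factor.
\<close>

inductive exec :: "int \<Rightarrow> com \<Rightarrow> store \<Rightarrow> nat \<Rightarrow> store \<Rightarrow> bool" for W where
  Skip: "exec W Skip s 1 s"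
| Assign: "afits W e s \<Longrightarrow>
    exec W (Assign x e) s 1 ((fst s)(x := aval e s), snd s)"
| Store: "afits W i s \<Longrightarrow> afits W e s \<Longrightarrow>
    exec W (Store a i e) s 1 (fst s, (snd s)(a := (snd s a)(aval i s := aval e s)))"
| Seq: "exec W c1 s t1 s1 \<Longrightarrow> exec W c2 s1 t2 s2 \<Longrightarrow> exec W (Seq c1 c2) s (t1 + t2) s2"
| IfTrue: "bfits W b s \<Longrightarrow> bval b s \<Longrightarrow> exec W c1 s t s' \<Longrightarrow>
    exec W (If b c1 c2) s (1 + t) s'"
| IfFalse: "bfits W b s \<Longrightarrow> \<not> bval b s \<Longrightarrow> exec W c2 s t s' \<Longrightarrow>
    exec W (If b c1 c2) s (1 + t) s'"
| WhileFalse: "bfits W b s \<Longrightarrow> \<not> bval b s \<Longrightarrow> exec W (While b c) s 1 s"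
| WhileTrue: "bfits W b s \<Longrightarrow> bval b s \<Longrightarrow> exec W c s t1 s1 \<Longrightarrow>
    exec W (While b c) s1 t2 s2 \<Longrightarrow> exec W (While b c) s (1 + t1 + t2) s2"

section \<open>The matrix multiplication exponent\<close>

text \<open>
  In all inputs and outputs, an \<open>n \<times> n\<close> table occupies the cells \<open>0, \<dots>, n\<^sup>2 - 1\<close> of an array in
  row-major order, scalar \<open>0\<close> holds \<open>n\<close>, and everything else is initially zero. Array \<open>0\<close> is
  reserved for the output.
\<close>

definition table_array :: "nat \<Rightarrow> (nat \<Rightarrow> nat \<Rightarrow> int) \<Rightarrow> int \<Rightarrow> int" where
  "table_array n f i =
     (if 0 \<le> i \<and> i < int (n * n) then f (nat i div n) (nat i mod n) else 0)"

definition size_scalar :: "nat \<Rightarrow> nat \<Rightarrow> int" where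
  "size_scalar n = (\<lambda>_. 0)(0 := int n)"

definition output_table :: "nat \<Rightarrow> store \<Rightarrow> nat \<Rightarrow> nat \<Rightarrow> int" where
  "output_table n s i j = snd s 0 (int (i * n + j))"

definition matmul_input :: "nat \<Rightarrow> int mat \<Rightarrow> int mat \<Rightarrow> store" where
  "matmul_input n A B =
     (size_scalar n,
      (\<lambda>_ _. 0)(1 := table_array n (\<lambda>i j. A $$ (i, j)), 2 := table_array n (\<lambda>i j. B $$ (i, j))))"

text \<open>
  \<open>M\<close> bounds the entries of the factors. The word bound \<open>(n + M + 2) ^ k\<close> amounts to words of
  \<open>O(log (n + M))\<close> bits.
\<close>

definition multiplies_matrices_within :: "com \<Rightarrow> (nat \<Rightarrow> real) \<Rightarrow> bool" where
  "multiplies_matrices_within p T \<longleftrightarrow>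
     (\<exists>k. \<forall>n M. \<forall>A \<in> carrier_mat n n. \<forall>B \<in> carrier_mat n n.
        (\<forall>i<n. \<forall>j<n. \<bar>A $$ (i, j)\<bar> \<le> int M \<and> \<bar>B $$ (i, j)\<bar> \<le> int M) \<longrightarrow>
        (\<exists>t s. exec (int ((n + M + 2) ^ k)) p (matmul_input n A B) t s \<and>
           real t \<le> T n \<and>
           (\<forall>i<n. \<forall>j<n. output_table n s i j = (A * B) $$ (i, j))))"

definition matmul_exponents :: "real set" where
  "matmul_exponents =
     {c. \<exists>p T. multiplies_matrices_within p T \<and> T \<in> O(\<lambda>n. real n powr c)}"

definition matmul_exponent :: real ("\<omega>") where
  "\<omega> = Inf matmul_exponents"

section \<open>All-pairs CFL reachability on acyclic graphs\<close>

text \<open>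
  The labels are numbered \<open>0, \<dots>, card \<Sigma> - 1\<close> by \<open>to_nat_on \<Sigma>\<close>, and array \<open>l + 1\<close> holds the
  adjacency matrix of the edges with label number \<open>l\<close>.
\<close>

definition graph_input :: "'t set \<Rightarrow> nat \<Rightarrow> (nat \<times> 't \<times> nat) set \<Rightarrow> store" where
  "graph_input \<Sigma> n E =
     (size_scalar n,
      \<lambda>r. if r = 0 then (\<lambda>_. 0)
          else table_array n (\<lambda>u v. of_bool (\<exists>a \<in> \<Sigma>. to_nat_on \<Sigma> a + 1 = r \<and> (u, a, v) \<in> E)))"

definition solves_dag_cfl_reachability_within ::
    "('n, 't) cfg \<Rightarrow> com \<Rightarrow> (nat \<Rightarrow> real) \<Rightarrow> bool" where
  "solves_dag_cfl_reachability_within G p T \<longleftrightarrow>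
     (\<exists>k. \<forall>n E. labeled_dag (terminals G) n E \<longrightarrow>
        (\<exists>t s. exec (int ((n + 2) ^ k)) p (graph_input (terminals G) n E) t s \<and>
           real t \<le> T n \<and>
           (\<forall>u<n. \<forall>v<n. output_table n s u v = of_bool (S_path G E u v))))"

definition dag_cfl_reachability_in_time_O :: "('n, 't) cfg \<Rightarrow> (nat \<Rightarrow> real) \<Rightarrow> bool" where
  "dag_cfl_reachability_in_time_O G f \<longleftrightarrow>
     (\<exists>p T. solves_dag_cfl_reachability_within G p T \<and> T \<in> O(f))"

end

theory Submission
  imports Defs
begin

text \<open>
  Since the grammar is fixed, nullable symbols and unit steps can be eliminated beforehand, which
  leaves finitely many rules \<open>(i, j, k)\<close> on suffixes of right-hand sides, so that, in a topological order of the vertices, every nonempty path of type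
  \<open>i\<close> is a single edge or splits strictly inside into paths of types \<open>j\<close> and \<open>k\<close>. Valiant's
  recursion for the resulting strictly upper triangular system is unrolled: the cells \<open>(u, v)\<close> are
  visited in Z-order, and when the first cell of an aligned block of size \<open>2\<^sup>s\<close> in block row \<open>r\<close> and
  block column \<open>c\<close> is reached, the products through the block rows \<open>r + 1\<close> and \<open>c - 1\<close> are added to
  it. All blocks involved are then complete, and every split point \<open>w\<close> of \<open>(u, v)\<close> is covered, at the
  largest scale that separates \<open>u\<close>, \<open>w\<close> and \<open>v\<close>. There are \<open>O((N / 2\<^sup>s)\<^sup>2)\<close> blocks of size \<open>2\<^sup>s\<close>, so
  for an exponent \<open>c > 2\<close> the costs \<open>O((2\<^sup>s)\<^sup>c)\<close> of the products form a geometric series with sum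
  \<open>O(N\<^sup>c)\<close>.
\<close>

text \<open>The multiplication program is a black box that expects zeroed memory and leaves unknown
  garbage behind. Clearing its whole address range would cost time governed by the word size instead
  of the running time, so each call gets its own stretch of untouched cells; a polynomial address
  space is enough for all calls. The machine has no procedures, hence no recursion: the bits of one
  counter yield the current cell, and its divisibility by powers of 4 tells which blocks begin
  there. Correctness separates into soundness and coverage. Every table entry ever written lies in
  the true relation, so products that are added twice, or from operands still incomplete, do no
  harm; it only remains to see that each split point is used once at a moment when both of its
  operands are complete. The bound needs an exponent above 2: at exponent 2 all scales would cost
  the same and a logarithm would appear, as it does in the \<open>N * N * log N\<close> steps spent
  on reading off bits. As \<open>\<omega>\<close> is an infimum that need not be attained, the
  result speaks about every exponent above it, and about \<open>\<omega>\<close> itself if it is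
  attained and exceeds 2.\<close>

declare split_paired_All [simp del] split_paired_Ex [simp del]

section \<open>A total-correctness calculus with running times\<close>

definition bounded :: "int \<Rightarrow> store \<Rightarrow> bool" where
  "bounded B s \<longleftrightarrow> (\<forall>x. \<bar>fst s x\<bar> \<le> B) \<and> (\<forall>a i. \<bar>snd s a i\<bar> \<le> B)"

text \<open>Only the values that get stored are compared with \<open>B\<close>. Intermediate values
  and addresses are left unchecked here, because the size of the expressions bounds them
  polynomially in \<open>B\<close>; see \<open>run_exec\<close>.\<close>

inductive run :: "int \<Rightarrow> com \<Rightarrow> store \<Rightarrow> nat \<Rightarrow> store \<Rightarrow> bool" for B where
  Skip: "bounded B s \<Longrightarrow> run B Skip s 1 s"
| Assign: "bounded B s \<Longrightarrow> \<bar>aval e s\<bar> \<le> B \<Longrightarrow>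
    run B (Assign x e) s 1 ((fst s)(x := aval e s), snd s)"
| Store: "bounded B s \<Longrightarrow> \<bar>aval e s\<bar> \<le> B \<Longrightarrow>
    run B (Store a i e) s 1 (fst s, (snd s)(a := (snd s a)(aval i s := aval e s)))"
| Seq: "run B c1 s t1 s1 \<Longrightarrow> run B c2 s1 t2 s2 \<Longrightarrow> run B (Seq c1 c2) s (t1 + t2) s2"
| IfTrue: "bounded B s \<Longrightarrow> bval b s \<Longrightarrow> run B c1 s t s' \<Longrightarrow> run B (If b c1 c2) s (1 + t) s'"
| IfFalse: "bounded B s \<Longrightarrow> \<not> bval b s \<Longrightarrow> run B c2 s t s' \<Longrightarrow> run B (If b c1 c2) s (1 + t) s'"
| WhileFalse: "bounded B s \<Longrightarrow> \<not> bval b s \<Longrightarrow> run B (While b c) s 1 s"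
| WhileTrue: "bounded B s \<Longrightarrow> bval b s \<Longrightarrow> run B c s t1 s1 \<Longrightarrow>
    run B (While b c) s1 t2 s2 \<Longrightarrow> run B (While b c) s (1 + t1 + t2) s2"

lemma run_bounded: "run B c s t s' \<Longrightarrow> bounded B s'"
  by (induction rule: run.induct) (auto simp: bounded_def)

section \<open>From bounded stores to bounded words\<close>

lemma afits_mono: "afits W e s \<Longrightarrow> W \<le> W' \<Longrightarrow> afits W' e s"
  by (induction e) auto

lemma bfits_mono: "bfits W b s \<Longrightarrow> W \<le> W' \<Longrightarrow> bfits W' b s"
  by (induction b) (auto intro: afits_mono)

lemma exec_mono: "exec W c s t s' \<Longrightarrow> W \<le> W' \<Longrightarrow> exec W' c s t s'"
  by (induction rule: exec.induct) (blast intro: exec.intros afits_mono bfits_mono)+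

lemma afits_aval: "afits W e s \<Longrightarrow> \<bar>aval e s\<bar> \<le> W"
  by (cases e) auto

text \<open>The exponent depends on the expression alone, neither on the store nor on
  \<open>B\<close>. The base \<open>B + 2\<close> is at least 2, so a doubling costs one more power
  and every constant lies below some power.\<close>

definition afits_power :: "nat \<Rightarrow> aexp \<Rightarrow> bool" where
  "afits_power k e \<longleftrightarrow> (\<forall>B\<ge>0. \<forall>s. bounded B s \<longrightarrow> afits ((B + 2) ^ k) e s)"

definition bfits_power :: "nat \<Rightarrow> bexp \<Rightarrow> bool" where
  "bfits_power k b \<longleftrightarrow> (\<forall>B\<ge>0. \<forall>s. bounded B s \<longrightarrow> bfits ((B + 2) ^ k) b s)"

fun cfits_power :: "nat \<Rightarrow> com \<Rightarrow> bool" where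
  "cfits_power k Skip \<longleftrightarrow> True"
| "cfits_power k (Assign x e) \<longleftrightarrow> afits_power k e"
| "cfits_power k (Store a i e) \<longleftrightarrow> afits_power k i \<and> afits_power k e"
| "cfits_power k (Seq c1 c2) \<longleftrightarrow> cfits_power k c1 \<and> cfits_power k c2"
| "cfits_power k (If b c1 c2) \<longleftrightarrow> bfits_power k b \<and> cfits_power k c1 \<and> cfits_power k c2"
| "cfits_power k (While b c) \<longleftrightarrow> bfits_power k b \<and> cfits_power k c"

lemma afits_powerD: "afits_power k e \<Longrightarrow> bounded B s \<Longrightarrow> 0 \<le> B \<Longrightarrow> afits ((B + 2) ^ k) e s"
  by (simp add: afits_power_def)

lemma bfits_powerD: "bfits_power k b \<Longrightarrow> bounded B s \<Longrightarrow> 0 \<le> B \<Longrightarrow> bfits ((B + 2) ^ k) b s"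
  by (simp add: bfits_power_def)

lemma afits_power_mono: "afits_power k e \<Longrightarrow> k \<le> k' \<Longrightarrow> afits_power k' e"
  by (force simp: afits_power_def intro: afits_mono power_increasing)

lemma bfits_power_mono: "bfits_power k e \<Longrightarrow> k \<le> k' \<Longrightarrow> bfits_power k' e"
  by (force simp: bfits_power_def intro: bfits_mono power_increasing)

lemma cfits_power_mono: "cfits_power k c \<Longrightarrow> k \<le> k' \<Longrightarrow> cfits_power k' c"
  by (induction c) (auto intro: afits_power_mono bfits_power_mono)

lemma abs_div_le: "\<bar>(x::int) div y\<bar> \<le> \<bar>x\<bar>"
proof (cases "y = 0")
  case False
  have *: "\<bar>x div y\<bar> \<le> \<bar>x\<bar>" if "y > 0" for x y :: int
  proof (cases "x \<ge> 0")
    case True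
    then show ?thesis using that zdiv_mono2[of x 1 y] by (simp add: pos_imp_zdiv_nonneg_iff)
  next
    case False
    have "x \<le> x div y"
      by (smt (verit) False that div_by_1 zdiv_mono2_neg)
    moreover have "x div y < 0" using False that div_neg_pos_less0 by force
    ultimately show ?thesis by linarith
  qed
  show ?thesis
    using *[of y x] *[of "-y" "-x"] False by (cases "y > 0") auto
qed auto

lemma afits_power_ex: "\<exists>k. afits_power k e"
proof (induction e)
  case (Const i)
  have "\<bar>i\<bar> \<le> (B + 2) ^ nat \<bar>i\<bar>" if "B \<ge> 0" for B :: int
  proof -
    have "int (nat \<bar>i\<bar>) \<le> int (2 ^ nat \<bar>i\<bar>)" using less_exp[of "nat \<bar>i\<bar>"] by linarith
    also have "\<dots> \<le> (B + 2) ^ nat \<bar>i\<bar>" using that by (simp add: power_mono)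
    finally show ?thesis by simp
  qed
  then show ?case by (auto simp: afits_power_def intro!: exI[of _ "nat \<bar>i\<bar>"])
next
  case (Var x)
  show ?case
    by (rule exI[of _ 1]) (auto simp: afits_power_def bounded_def intro: add_increasing2)
next
  case (Arr a e)
  then obtain k where k: "afits_power k e" by blast
  have "afits_power (max k 1) e" using k by (rule afits_power_mono) simp
  moreover have "\<bar>snd s a z\<bar> \<le> (B + 2) ^ max k 1" if "bounded B s" "B \<ge> 0" for B s z
  proof -
    have "\<bar>snd s a z\<bar> \<le> (B + 2) ^ 1" using that by (auto simp: bounded_def intro: add_increasing2)
    also have "\<dots> \<le> (B + 2) ^ max k 1" using that by (intro power_increasing) auto
    finally show ?thesis .
  qed
  ultimately show ?case by (auto simp: afits_power_def intro!: exI[of _ "max k 1"])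
next
  case (Plus e1 e2)
  then obtain k1 k2 where k: "afits_power k1 e1" "afits_power k2 e2" by blast
  define m where "m = max k1 k2"
  have m: "afits_power m e1" "afits_power m e2"
    using k by (auto simp: m_def intro: afits_power_mono)
  have "afits ((B + 2) ^ Suc m) (Plus e1 e2) s" if "bounded B s" "B \<ge> 0" for B s
  proof -
    have f: "afits ((B + 2) ^ m) e1 s" "afits ((B + 2) ^ m) e2 s"
      using m that by (auto intro: afits_powerD)
    have "2 * (B + 2) ^ m \<le> (B + 2) ^ Suc m" using that by simp
    moreover have "(B + 2) ^ m \<ge> 0" using that by simp
    ultimately show ?thesis using f[THEN afits_aval] f[THEN afits_mono, of "(B + 2) ^ Suc m"]
      by (simp del: power_Suc)
  qed
  then show ?case by (auto simp: afits_power_def simp del: power_Suc intro!: exI[of _ "Suc m"])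
next
  case (Minus e1 e2)
  then obtain k1 k2 where k: "afits_power k1 e1" "afits_power k2 e2" by blast
  define m where "m = max k1 k2"
  have m: "afits_power m e1" "afits_power m e2"
    using k by (auto simp: m_def intro: afits_power_mono)
  have "afits ((B + 2) ^ Suc m) (Minus e1 e2) s" if "bounded B s" "B \<ge> 0" for B s
  proof -
    have f: "afits ((B + 2) ^ m) e1 s" "afits ((B + 2) ^ m) e2 s"
      using m that by (auto intro: afits_powerD)
    have "2 * (B + 2) ^ m \<le> (B + 2) ^ Suc m" using that by simp
    moreover have "(B + 2) ^ m \<ge> 0" using that by simp
    ultimately show ?thesis using f[THEN afits_aval] f[THEN afits_mono, of "(B + 2) ^ Suc m"]
      by (simp del: power_Suc)
  qed
  then show ?case by (auto simp: afits_power_def simp del: power_Suc intro!: exI[of _ "Suc m"])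
next
  case (Times e1 e2)
  then obtain k1 k2 where k: "afits_power k1 e1" "afits_power k2 e2" by blast
  have "afits ((B + 2) ^ (k1 + k2)) (Times e1 e2) s" if "bounded B s" "B \<ge> 0" for B s
  proof -
    have f: "afits ((B + 2) ^ k1) e1 s" "afits ((B + 2) ^ k2) e2 s"
      using k that by (auto intro: afits_powerD)
    have "\<bar>aval e1 s\<bar> * \<bar>aval e2 s\<bar> \<le> (B + 2) ^ k1 * (B + 2) ^ k2"
      by (intro mult_mono f[THEN afits_aval]) (use that in auto)
    moreover have "afits_power (k1 + k2) e1" "afits_power (k1 + k2) e2"
      using k by (auto intro: afits_power_mono)
    ultimately show ?thesis
      using that by (simp add: abs_mult power_add[symmetric] afits_powerD)
  qed
  then show ?case by (auto simp: afits_power_def intro!: exI[of _ "k1 + k2"])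
next
  case (Div e1 e2)
  then obtain k1 k2 where k: "afits_power k1 e1" "afits_power k2 e2" by blast
  define m where "m = max k1 k2"
  have m: "afits_power m e1" "afits_power m e2"
    using k by (auto simp: m_def intro: afits_power_mono)
  have "afits ((B + 2) ^ m) (Div e1 e2) s" if "bounded B s" "B \<ge> 0" for B s
  proof -
    have f: "afits ((B + 2) ^ m) e1 s" "afits ((B + 2) ^ m) e2 s"
      using m that by (auto intro: afits_powerD)
    then show ?thesis using order_trans[OF abs_div_le afits_aval] by simp
  qed
  then show ?case by (auto simp: afits_power_def intro!: exI[of _ m])
qed

lemma bfits_power_ex: "\<exists>k. bfits_power k b"
proof (induction b)
  case (Less e1 e2)
  obtain k1 k2 where k: "afits_power k1 e1" "afits_power k2 e2"
    using afits_power_ex by blast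
  have "afits_power (max k1 k2) e1" "afits_power (max k1 k2) e2"
    using k by (auto intro: afits_power_mono)
  then show ?case by (auto simp: afits_power_def bfits_power_def intro!: exI[of _ "max k1 k2"])
next
  case (Not b)
  then show ?case by (auto simp: bfits_power_def)
next
  case (And b1 b2)
  then obtain k1 k2 where k: "bfits_power k1 b1" "bfits_power k2 b2" by blast
  have "bfits_power (max k1 k2) b1" "bfits_power (max k1 k2) b2"
    using k by (auto intro: bfits_power_mono)
  then show ?case by (auto simp: bfits_power_def intro!: exI[of _ "max k1 k2"])
qed

lemma cfits_power_ex: "\<exists>k. cfits_power k c"
proof (induction c)
  case (Store a i e)
  obtain k1 k2 where k: "afits_power k1 i" "afits_power k2 e"
    using afits_power_ex by blast
  have "afits_power (max k1 k2) i" "afits_power (max k1 k2) e"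
    using k by (auto intro: afits_power_mono)
  then show ?case by auto
next
  case (Seq c1 c2)
  then obtain k1 k2 where k: "cfits_power k1 c1" "cfits_power k2 c2" by blast
  have "cfits_power (max k1 k2) c1" "cfits_power (max k1 k2) c2"
    using k by (auto intro: cfits_power_mono)
  then show ?case by auto
next
  case (If b c1 c2)
  then obtain k1 k2 where k: "cfits_power k1 c1" "cfits_power k2 c2" by blast
  obtain k3 where "bfits_power k3 b" using bfits_power_ex by blast
  then have "cfits_power (max k3 (max k1 k2)) c1" "cfits_power (max k3 (max k1 k2)) c2"
    "bfits_power (max k3 (max k1 k2)) b"
    using k by (auto intro: cfits_power_mono bfits_power_mono)
  then show ?case by (meson cfits_power.simps)
next
  case (While b c)
  then obtain k1 where k: "cfits_power k1 c" by blast
  obtain k3 where "bfits_power k3 b" using bfits_power_ex by blast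
  then have "cfits_power (max k3 k1) c" "bfits_power (max k3 k1) b"
    using k by (auto intro: cfits_power_mono bfits_power_mono)
  then show ?case by (meson cfits_power.simps)
qed (auto simp: afits_power_ex)

text \<open>The way back to the given semantics, with the same number of steps: a program has
  finitely many expressions, so one exponent serves them all. Until this lemma is applied, only
  \<open>B\<close> has to be tracked.\<close>

lemma run_exec: "run B c s t s' \<Longrightarrow> 0 \<le> B \<Longrightarrow> cfits_power k c \<Longrightarrow> exec ((B + 2) ^ k) c s t s'"
  by (induction rule: run.induct)
    (simp_all only: cfits_power.simps, (blast intro: exec.intros afits_powerD bfits_powerD)+)

section \<open>Frames and proof rules for timed total correctness\<close>

fun wvars :: "com \<Rightarrow> nat set" where
  "wvars Skip = {}"
| "wvars (Assign x e) = {x}"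
| "wvars (Store a i e) = {}"
| "wvars (Seq c1 c2) = wvars c1 \<union> wvars c2"
| "wvars (If b c1 c2) = wvars c1 \<union> wvars c2"
| "wvars (While b c) = wvars c"

fun warrs :: "com \<Rightarrow> nat set" where
  "warrs Skip = {}"
| "warrs (Assign x e) = {}"
| "warrs (Store a i e) = {a}"
| "warrs (Seq c1 c2) = warrs c1 \<union> warrs c2"
| "warrs (If b c1 c2) = warrs c1 \<union> warrs c2"
| "warrs (While b c) = warrs c"

lemma run_frame_var: "run B c s t s' \<Longrightarrow> x \<notin> wvars c \<Longrightarrow> fst s' x = fst s x"
  by (induction rule: run.induct) auto

lemma run_frame_arr: "run B c s t s' \<Longrightarrow> a \<notin> warrs c \<Longrightarrow> snd s' a = snd s a"
  by (induction rule: run.induct) auto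

definition runs :: "int \<Rightarrow> com \<Rightarrow> store \<Rightarrow> nat \<Rightarrow> (store \<Rightarrow> bool) \<Rightarrow> bool" where
  "runs B c s T Q \<longleftrightarrow> (\<exists>t s'. run B c s t s' \<and> t \<le> T \<and> Q s')"

text \<open>The postcondition may be weakened with the help of the frame: scalars and arrays that
  the program never assigns keep their values. Specifications can therefore be silent about
  them.\<close>

lemma runs_weaken:
  assumes "runs B c s T Q" "T \<le> T'"
    and "\<And>s'. bounded B s' \<Longrightarrow> (\<And>x. x \<notin> wvars c \<Longrightarrow> fst s' x = fst s x) \<Longrightarrow>
          (\<And>a. a \<notin> warrs c \<Longrightarrow> snd s' a = snd s a) \<Longrightarrow> Q s' \<Longrightarrow> Q' s'"
  shows "runs B c s T' Q'"
  using assms unfolding runs_def by (meson order_trans run_bounded run_frame_var run_frame_arr)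

lemma runs_Skip: "bounded B s \<Longrightarrow> Q s \<Longrightarrow> runs B Skip s 1 Q"
  unfolding runs_def by (blast intro: run.Skip)

lemma runs_Assign:
  "bounded B s \<Longrightarrow> \<bar>aval e s\<bar> \<le> B \<Longrightarrow>
   (bounded B ((fst s)(x := aval e s), snd s) \<Longrightarrow> Q ((fst s)(x := aval e s), snd s)) \<Longrightarrow>
   runs B (Assign x e) s 1 Q"
  unfolding runs_def by (blast intro: run.Assign run_bounded)

lemma runs_Store:
  "bounded B s \<Longrightarrow> \<bar>aval e s\<bar> \<le> B \<Longrightarrow>
   (bounded B (fst s, (snd s)(a := (snd s a)(aval i s := aval e s))) \<Longrightarrow>
     Q (fst s, (snd s)(a := (snd s a)(aval i s := aval e s)))) \<Longrightarrow>
   runs B (Store a i e) s 1 Q"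
  unfolding runs_def by (blast intro: run.Store run_bounded)

lemma runs_Seq: "runs B c1 s T1 (\<lambda>s1. runs B c2 s1 T2 Q) \<Longrightarrow> runs B (Seq c1 c2) s (T1 + T2) Q"
  unfolding runs_def by (meson add_mono run.Seq)

lemma runs_Seq':
  assumes "runs B c1 s T1 P" and "\<And>s1. bounded B s1 \<Longrightarrow>
    (\<And>x. x \<notin> wvars c1 \<Longrightarrow> fst s1 x = fst s x) \<Longrightarrow>
    (\<And>a. a \<notin> warrs c1 \<Longrightarrow> snd s1 a = snd s a) \<Longrightarrow> P s1 \<Longrightarrow> runs B c2 s1 T2 Q"
  shows "runs B (Seq c1 c2) s (T1 + T2) Q"
  by (rule runs_Seq, rule runs_weaken[OF assms(1)]) (use assms(2) in auto)

lemma runs_If: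
  "bounded B s \<Longrightarrow> (bval b s \<Longrightarrow> runs B c1 s T Q) \<Longrightarrow> (\<not> bval b s \<Longrightarrow> runs B c2 s T Q) \<Longrightarrow>
   runs B (If b c1 c2) s (1 + T) Q"
  unfolding runs_def by (cases "bval b s") (meson add_left_mono run.IfTrue run.IfFalse)+

text \<open>The invariant carries the number of finished rounds and must force \<open>k < h\<close>
  while the test succeeds, which gives termination. Costs may differ from round to round; the
  amortized bound of the main loop rests on this.\<close>

lemma runs_While:
  assumes "bounded B s" "I 0 s"
    and step: "\<And>k s. bounded B s \<Longrightarrow> I k s \<Longrightarrow> bval b s \<Longrightarrow> k < h \<and> runs B c s (T k) (I (Suc k))"
    and fin: "\<And>k s. bounded B s \<Longrightarrow> I k s \<Longrightarrow> \<not> bval b s \<Longrightarrow> Q s"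
  shows "runs B (While b c) s (1 + (\<Sum>k<h. 1 + T k)) Q"
proof -
  have "runs B (While b c) s (1 + (\<Sum>k\<in>{k..<h}. 1 + T k)) Q" if "bounded B s" "I k s" for k s
    using that
  proof (induction "h - k" arbitrary: k s)
    case 0
    then have "\<not> bval b s" using step[of s k] by auto
    then show ?case using 0 fin unfolding runs_def by (fastforce intro: run.WhileFalse)
  next
    case (Suc m)
    show ?case
    proof (cases "bval b s")
      case False
      then show ?thesis using Suc.prems fin unfolding runs_def by (fastforce intro: run.WhileFalse)
    next
      case True
      then obtain t1 s1 where 1: "run B c s t1 s1" "t1 \<le> T k" "I (Suc k) s1" "k < h"
        using step[OF Suc.prems] by (auto simp: runs_def)
      have "m = h - Suc k" using Suc.hyps(2) by simp
      from Suc.hyps(1)[OF this run_bounded[OF 1(1)] 1(3)]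
      obtain t2 s2 where 2: "run B (While b c) s1 t2 s2" "t2 \<le> 1 + (\<Sum>k\<in>{Suc k..<h}. 1 + T k)" "Q s2"
        unfolding runs_def by blast
      have "(\<Sum>k\<in>{k..<h}. 1 + T k) = 1 + T k + (\<Sum>k\<in>{Suc k..<h}. 1 + T k)"
        using 1 by (simp add: sum.atLeast_Suc_lessThan)
      then show ?thesis
        using run.WhileTrue[OF Suc.prems(1) True 1(1) 2(1)] 1 2 unfolding runs_def
        by (intro exI[of _ "1 + t1 + t2"] exI[of _ s2]) auto
    qed
  qed
  from this[OF assms(1,2)] show ?thesis by (simp add: atLeast0LessThan)
qed

section \<open>Counting loops and array fills\<close>

definition For :: "nat \<Rightarrow> aexp \<Rightarrow> com \<Rightarrow> com" where
  "For x e c = Seq (Assign x (Const 0))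
     (While (Less (Var x) e) (Seq c (Assign x (Plus (Var x) (Const 1)))))"

lemma wvars_For [simp]: "wvars (For x e c) = insert x (wvars c)"
  and warrs_For [simp]: "warrs (For x e c) = warrs c"
  by (auto simp: For_def)

text \<open>The bound \<open>e\<close> is evaluated anew before each round, so the invariant must
  keep its value at \<open>h\<close>. After the body, the invariant is required of the store in
  which the counter has already been increased.\<close>

lemma runs_For:
  assumes "bounded B s" "int h \<le> B"
    and init: "I 0 ((fst s)(x := 0), snd s)"
    and bound: "\<And>i s. bounded B s \<Longrightarrow> i \<le> h \<Longrightarrow> I i s \<Longrightarrow> fst s x = int i \<Longrightarrow> aval e s = int h"
    and step: "\<And>i s. bounded B s \<Longrightarrow> i < h \<Longrightarrow> I i s \<Longrightarrow> fst s x = int i \<Longrightarrow>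
      runs B c s (T i) (\<lambda>s'. fst s' x = int i \<and> I (Suc i) ((fst s')(x := int (Suc i)), snd s'))"
    and fin: "\<And>s. bounded B s \<Longrightarrow> I h s \<Longrightarrow> fst s x = int h \<Longrightarrow> Q s"
  shows "runs B (For x e c) s (2 + (\<Sum>i<h. 2 + T i)) Q"
proof -
  have "runs B (For x e c) s (1 + (1 + (\<Sum>k<h. 1 + (T k + 1)))) Q"
    unfolding For_def
  proof (intro runs_Seq runs_Assign)
    define s0 where "s0 = ((fst s)(x := aval (Const 0) s), snd s)"
    assume b: "bounded B s0"
    show "runs B (While (Less (Var x) e) (Seq c (Assign x (Plus (Var x) (Const 1))))) s0
        (1 + (\<Sum>k<h. 1 + (T k + 1))) Q"
    proof (rule runs_While[where I = "\<lambda>i s. i \<le> h \<and> I i s \<and> fst s x = int i"])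
      fix k s
      assume *: "bounded B s" "k \<le> h \<and> I k s \<and> fst s x = int k" "bval (Less (Var x) e) s"
      then have k: "k < h" using bound[of s k] by auto
      have "runs B (Seq c (Assign x (Plus (Var x) (Const 1)))) s (T k + 1)
          (\<lambda>s. Suc k \<le> h \<and> I (Suc k) s \<and> fst s x = int (Suc k))"
      proof (rule runs_Seq'[OF step[OF *(1) k]])
        fix s1
        assume s1: "bounded B s1" "fst s1 x = int k \<and> I (Suc k) ((fst s1)(x := int (Suc k)), snd s1)"
        then show "runs B (Assign x (Plus (Var x) (Const 1))) s1 1
          (\<lambda>s. Suc k \<le> h \<and> I (Suc k) s \<and> fst s x = int (Suc k))"
          using k assms(2) by (intro runs_Assign) (auto simp: add.commute)
      qed (use * in auto)
      with k show "k < h \<and> runs B (Seq c (Assign x (Plus (Var x) (Const 1)))) s (T k + 1)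
          (\<lambda>s. Suc k \<le> h \<and> I (Suc k) s \<and> fst s x = int (Suc k))" by blast
    next
      fix k s
      assume *: "bounded B s" "k \<le> h \<and> I k s \<and> fst s x = int k" "\<not> bval (Less (Var x) e) s"
      then have "k = h" using bound[of s k] by auto
      then show "Q s" using fin * by blast
    qed (use b init in \<open>auto simp: s0_def\<close>)
  qed (use assms(1,2) in auto)
  then show ?thesis by (rule runs_weaken) auto
qed

definition Fill :: "nat \<Rightarrow> aexp \<Rightarrow> nat \<Rightarrow> aexp \<Rightarrow> aexp \<Rightarrow> com" where
  "Fill x e a ie ve = For x e (Store a ie ve)"

lemma wvars_Fill [simp]: "wvars (Fill x e a ie ve) = {x}"
  and warrs_Fill [simp]: "warrs (Fill x e a ie ve) = {a}"
  by (auto simp: Fill_def)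

text \<open>The new value may depend on the cell being overwritten: \<open>p\<close> is injective,
  so this cell still holds its original content when its turn comes. In-place updates are thereby
  covered.\<close>

lemma runs_Fill:
  assumes "bounded B s" "int h \<le> B"
    and e: "\<And>i g. aval e ((fst s)(x := i), (snd s)(a := g)) = int h"
    and ie: "\<And>i g. i < h \<Longrightarrow> aval ie ((fst s)(x := int i), (snd s)(a := g)) = p i"
    and ve: "\<And>i g. i < h \<Longrightarrow> g (p i) = snd s a (p i) \<Longrightarrow>
      aval ve ((fst s)(x := int i), (snd s)(a := g)) = f i"
    and inj: "inj_on p {..<h}" and f: "\<And>i. i < h \<Longrightarrow> \<bar>f i\<bar> \<le> B"
    and Q: "\<And>g. (\<And>i. i < h \<Longrightarrow> g (p i) = f i) \<Longrightarrow> (\<And>z. z \<notin> p ` {..<h} \<Longrightarrow> g z = snd s a z) \<Longrightarrow>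
      bounded B ((fst s)(x := int h), (snd s)(a := g)) \<Longrightarrow>
      Q ((fst s)(x := int h), (snd s)(a := g))"
  shows "runs B (Fill x e a ie ve) s (2 + 3 * h) Q"
proof -
  define I where "I k s' \<longleftrightarrow> (\<exists>g. s' = ((fst s)(x := int k), (snd s)(a := g)) \<and>
    (\<forall>i<k. g (p i) = f i) \<and> (\<forall>z. z \<notin> p ` {..<k} \<longrightarrow> g z = snd s a z))" for k s'
  have "runs B (Fill x e a ie ve) s (2 + (\<Sum>i<h. 2 + 1)) Q"
    unfolding Fill_def
  proof (rule runs_For[where I = I])
    show "I 0 ((fst s)(x := 0), snd s)" by (auto simp: I_def intro!: exI[of _ "snd s a"])
  next
    fix k s' assume k: "bounded B s'" "k < h" "I k s'" "fst s' x = int k"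
    then obtain g where g: "s' = ((fst s)(x := int k), (snd s)(a := g))"
      "\<forall>i<k. g (p i) = f i" "\<forall>z. z \<notin> p ` {..<k} \<longrightarrow> g z = snd s a z" by (auto simp: I_def)
    have pk: "p k \<notin> p ` {..<k}" using inj k(2) by (force simp: inj_on_def)
    have pk': "p i \<noteq> p k" if "i < k" for i using pk that by (metis imageI lessThan_iff)
    from pk have v: "aval ve s' = f k" using g k(2) by (auto intro!: ve)
    have i: "aval ie s' = p k" using g k(2) by (auto intro!: ie)
    show "runs B (Store a ie ve) s' 1 (\<lambda>s'. fst s' x = int k \<and>
        I (Suc k) ((fst s')(x := int (Suc k)), snd s'))"
    proof (rule runs_Store)
      have "I (Suc k) ((fst s')(x := int (Suc k)), (snd s')(a := (snd s' a)(p k := f k)))"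
        unfolding I_def
        by (rule exI[of _ "g(p k := f k)"])
          (use g pk pk' in \<open>auto simp: lessThan_Suc less_Suc_eq image_iff\<close>)
      then show "fst (fst s', (snd s')(a := (snd s' a)(aval ie s' := aval ve s'))) x = int k \<and>
        I (Suc k) ((fst (fst s', (snd s')(a := (snd s' a)(aval ie s' := aval ve s'))))(x := int (Suc k)),
          snd (fst s', (snd s')(a := (snd s' a)(aval ie s' := aval ve s'))))"
        unfolding i v using g(1) by simp
    qed (use k f v in auto)
  qed (use assms(1,2) e Q in \<open>auto simp: I_def\<close>)
  then show ?thesis by (rule runs_weaken) auto
qed

section \<open>Calling a program as a subroutine\<close>

fun avs :: "aexp \<Rightarrow> nat set" where
  "avs (Const i) = {}"
| "avs (Var x) = {x}"
| "avs (Arr a e) = avs e"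
| "avs (Plus e1 e2) = avs e1 \<union> avs e2"
| "avs (Minus e1 e2) = avs e1 \<union> avs e2"
| "avs (Times e1 e2) = avs e1 \<union> avs e2"
| "avs (Div e1 e2) = avs e1 \<union> avs e2"

fun bvs :: "bexp \<Rightarrow> nat set" where
  "bvs (Less e1 e2) = avs e1 \<union> avs e2"
| "bvs (Not b) = bvs b"
| "bvs (And b1 b2) = bvs b1 \<union> bvs b2"

fun cvs :: "com \<Rightarrow> nat set" where
  "cvs Skip = {}"
| "cvs (Assign x e) = insert x (avs e)"
| "cvs (Store a i e) = avs i \<union> avs e"
| "cvs (Seq c1 c2) = cvs c1 \<union> cvs c2"
| "cvs (If b c1 c2) = bvs b \<union> cvs c1 \<union> cvs c2"
| "cvs (While b c) = bvs b \<union> cvs c"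

lemma finite_avs [simp]: "finite (avs e)" by (induction e) auto
lemma finite_bvs [simp]: "finite (bvs b)" by (induction b) auto
lemma finite_cvs [simp]: "finite (cvs c)" by (induction c) auto

text \<open>
  Scalars are shifted by \<open>K\<close>, arrays by \<open>A\<close>, and array cells by the value of the scalar \<open>z\<close>.
  Calls with values of \<open>z\<close> that are far enough apart use disjoint memory, so that memory never has
  to be cleared.
\<close>

fun shift_a :: "nat \<Rightarrow> nat \<Rightarrow> nat \<Rightarrow> aexp \<Rightarrow> aexp" where
  "shift_a K A z (Const i) = Const i"
| "shift_a K A z (Var x) = Var (K + x)"
| "shift_a K A z (Arr a e) = Arr (A + a) (Plus (Var z) (shift_a K A z e))"
| "shift_a K A z (Plus e1 e2) = Plus (shift_a K A z e1) (shift_a K A z e2)"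
| "shift_a K A z (Minus e1 e2) = Minus (shift_a K A z e1) (shift_a K A z e2)"
| "shift_a K A z (Times e1 e2) = Times (shift_a K A z e1) (shift_a K A z e2)"
| "shift_a K A z (Div e1 e2) = Div (shift_a K A z e1) (shift_a K A z e2)"

fun shift_b :: "nat \<Rightarrow> nat \<Rightarrow> nat \<Rightarrow> bexp \<Rightarrow> bexp" where
  "shift_b K A z (Less e1 e2) = Less (shift_a K A z e1) (shift_a K A z e2)"
| "shift_b K A z (Not b) = Not (shift_b K A z b)"
| "shift_b K A z (And b1 b2) = And (shift_b K A z b1) (shift_b K A z b2)"

fun shift_c :: "nat \<Rightarrow> nat \<Rightarrow> nat \<Rightarrow> com \<Rightarrow> com" where
  "shift_c K A z Skip = Skip"
| "shift_c K A z (Assign x e) = Assign (K + x) (shift_a K A z e)"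
| "shift_c K A z (Store a i e) = Store (A + a) (Plus (Var z) (shift_a K A z i)) (shift_a K A z e)"
| "shift_c K A z (Seq c1 c2) = Seq (shift_c K A z c1) (shift_c K A z c2)"
| "shift_c K A z (If b c1 c2) = If (shift_b K A z b) (shift_c K A z c1) (shift_c K A z c2)"
| "shift_c K A z (While b c) = While (shift_b K A z b) (shift_c K A z c)"

text \<open>Agreement is demanded only at distance at most \<open>W\<close> from the offset. A
  program running with words bounded by \<open>W\<close> cannot address anything else, so the
  remaining cells are free for other purposes.\<close>

definition shifted :: "int \<Rightarrow> nat \<Rightarrow> nat \<Rightarrow> nat \<Rightarrow> nat \<Rightarrow> store \<Rightarrow> store \<Rightarrow> bool" where
  "shifted W m K A z s s1 \<longleftrightarrow> (\<forall>x<m. fst s1 (K + x) = fst s x) \<and>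
     (\<forall>a i. \<bar>i\<bar> \<le> W \<longrightarrow> snd s1 (A + a) (fst s1 z + i) = snd s a i)"

lemma aval_shift:
  "shifted W m K A z s s1 \<Longrightarrow> afits W e s \<Longrightarrow> avs e \<subseteq> {..<m} \<Longrightarrow>
   aval (shift_a K A z e) s1 = aval e s"
  by (induction e) (auto simp: shifted_def dest: afits_aval)

lemma bval_shift:
  "shifted W m K A z s s1 \<Longrightarrow> bfits W b s \<Longrightarrow> bvs b \<subseteq> {..<m} \<Longrightarrow>
   bval (shift_b K A z b) s1 = bval b s"
  by (induction b) (auto simp: aval_shift)

lemma wvars_shift: "wvars (shift_c K A z c) \<subseteq> {K..}"
  by (induction c) auto

lemma warrs_shift: "warrs (shift_c K A z c) \<subseteq> {A..}"
  by (induction c) auto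

lemma runsI: "run B c s t s' \<Longrightarrow> t \<le> T \<Longrightarrow> Q s' \<Longrightarrow> runs B c s T Q"
  unfolding runs_def by blast

lemma notin_wvars_shift: "x < K \<Longrightarrow> x \<notin> wvars (shift_c K A z c)"
  using wvars_shift[of K A z c] by auto

lemma notin_warrs_shift: "a < A \<Longrightarrow> a \<notin> warrs (shift_c K A z c)"
  using warrs_shift[of K A z c] by auto

text \<open>The word bound of \<open>exec\<close> applies to addresses too, which confines the call
  to the cells within \<open>W\<close> of its offset; the last conjunct records this, and it keeps
  the cells of later calls zero. The assumption \<open>z < K\<close> protects the offset itself from
  the shifted assignments.\<close>

lemma run_shift:
  assumes "exec W c s t s'" "cvs c \<subseteq> {..<m}" "shifted W m K A z s s1" "z < K" "bounded B s1" "W \<le> B"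
  shows "\<exists>s1'. run B (shift_c K A z c) s1 t s1' \<and> shifted W m K A z s' s1' \<and>
    (\<forall>a i. W < \<bar>i - fst s1 z\<bar> \<longrightarrow> snd s1' a i = snd s1 a i)"
  using assms
proof (induction arbitrary: s1 rule: exec.induct)
  case (Skip s)
  then show ?case by (auto intro: run.Skip[simplified])
next
  case (Assign e s x)
  have v: "aval (shift_a K A z e) s1 = aval e s" using Assign by (intro aval_shift) auto
  have "\<bar>aval e s\<bar> \<le> B" using afits_aval[OF Assign(1)] Assign by simp
  then have "run B (Assign (K + x) (shift_a K A z e)) s1 1 ((fst s1)(K + x := aval e s), snd s1)"
    using run.Assign[of B s1 "shift_a K A z e" "K + x"] v Assign by simp
  then show ?case unfolding shift_c.simps
    by (intro exI conjI) (assumption, use Assign in \<open>auto simp: shifted_def\<close>)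
next
  case (Store i s e a)
  have v: "aval (shift_a K A z e) s1 = aval e s" "aval (shift_a K A z i) s1 = aval i s"
    using Store by (auto intro!: aval_shift)
  have "\<bar>aval e s\<bar> \<le> B" "\<bar>aval i s\<bar> \<le> W"
    using afits_aval[OF Store(2)] afits_aval[OF Store(1)] Store by simp_all
  then have "run B (Store (A + a) (Plus (Var z) (shift_a K A z i)) (shift_a K A z e)) s1 1
    (fst s1, (snd s1)(A + a := (snd s1 (A + a))(fst s1 z + aval i s := aval e s)))"
    using run.Store[of B s1 "shift_a K A z e" "A + a" "Plus (Var z) (shift_a K A z i)"] v Store by simp
  then show ?case unfolding shift_c.simps
    by (intro exI conjI) (assumption, use Store \<open>\<bar>aval i s\<bar> \<le> W\<close> in \<open>auto simp: shifted_def\<close>)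
next
  case (Seq c1 s t1 s' c2 t2 s'')
  obtain s2 where 1: "run B (shift_c K A z c1) s1 t1 s2" "shifted W m K A z s' s2"
    "\<forall>a i. W < \<bar>i - fst s1 z\<bar> \<longrightarrow> snd s2 a i = snd s1 a i"
    using Seq.IH(1)[of s1] Seq.prems by auto
  have z: "fst s2 z = fst s1 z"
    using run_frame_var[OF 1(1) notin_wvars_shift] Seq.prems by auto
  obtain s3 where "run B (shift_c K A z c2) s2 t2 s3" "shifted W m K A z s'' s3"
    "\<forall>a i. W < \<bar>i - fst s2 z\<bar> \<longrightarrow> snd s3 a i = snd s2 a i"
    using Seq.IH(2)[of s2] Seq.prems 1 run_bounded[OF 1(1)] by auto
  then show ?case using 1 z by (auto intro!: exI[of _ s3] run.Seq)
next
  case (IfTrue b s c1 t s' c2)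
  obtain s2 where "run B (shift_c K A z c1) s1 t s2" "shifted W m K A z s' s2"
    "\<forall>a i. W < \<bar>i - fst s1 z\<bar> \<longrightarrow> snd s2 a i = snd s1 a i"
    using IfTrue.IH[of s1] IfTrue.prems by auto
  moreover have "bval (shift_b K A z b) s1" using IfTrue by (subst bval_shift) auto
  ultimately show ?case using IfTrue.prems by (auto intro!: exI[of _ s2] run.IfTrue[simplified])
next
  case (IfFalse b s c2 t s' c1)
  obtain s2 where "run B (shift_c K A z c2) s1 t s2" "shifted W m K A z s' s2"
    "\<forall>a i. W < \<bar>i - fst s1 z\<bar> \<longrightarrow> snd s2 a i = snd s1 a i"
    using IfFalse.IH[of s1] IfFalse.prems by auto
  moreover have "\<not> bval (shift_b K A z b) s1" using IfFalse by (subst bval_shift) auto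
  ultimately show ?case using IfFalse.prems by (auto intro!: exI[of _ s2] run.IfFalse[simplified])
next
  case (WhileFalse b s c)
  have "\<not> bval (shift_b K A z b) s1" using WhileFalse by (subst bval_shift) auto
  then show ?case using WhileFalse.prems by (auto intro!: exI[of _ s1] run.WhileFalse[simplified])
next
  case (WhileTrue b s c t1 s' t2 s'')
  obtain s2 where 1: "run B (shift_c K A z c) s1 t1 s2" "shifted W m K A z s' s2"
    "\<forall>a i. W < \<bar>i - fst s1 z\<bar> \<longrightarrow> snd s2 a i = snd s1 a i"
    using WhileTrue.IH(1)[of s1] WhileTrue.prems by auto
  have z: "fst s2 z = fst s1 z"
    using run_frame_var[OF 1(1) notin_wvars_shift] WhileTrue.prems by auto
  obtain s3 where 2: "run B (shift_c K A z (While b c)) s2 t2 s3" "shifted W m K A z s'' s3"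
    "\<forall>a i. W < \<bar>i - fst s2 z\<bar> \<longrightarrow> snd s3 a i = snd s2 a i"
    using WhileTrue.IH(2)[of s2] WhileTrue.prems 1 run_bounded[OF 1(1)] by blast
  have "bval (shift_b K A z b) s1" using WhileTrue by (subst bval_shift) auto
  then have "run B (shift_c K A z (While b c)) s1 (1 + t1 + t2) s3"
    using 1 2 WhileTrue.prems by (auto intro!: run.WhileTrue[simplified])
  then show ?case using 1 2 z by auto
qed

section \<open>Products of blocks of Boolean tables\<close>

definition tab :: "nat \<Rightarrow> (int \<Rightarrow> int) \<Rightarrow> (nat \<Rightarrow> nat \<Rightarrow> bool) \<Rightarrow> bool" where
  "tab N g P \<longleftrightarrow> (\<forall>u<N. \<forall>v<N. g (int (u * N + v)) = of_bool (P u v))"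

definition fresh :: "nat \<Rightarrow> int \<Rightarrow> store \<Rightarrow> bool" where
  "fresh A F s \<longleftrightarrow> (\<forall>a\<ge>A. \<forall>z\<ge>F. snd s a z = 0)"

lemma row_major_inject:
  assumes "(u::nat) * N + v = u' * N + v'" "v < N" "v' < N"
  shows "u = u' \<and> v = v'"
proof -
  have "(u * N + v) div N = u" "(u' * N + v') div N = u'" using assms(2,3) by auto
  then show ?thesis using assms(1) by auto
qed

text \<open>With \<open>x div 0 = 0\<close>, the quotient \<open>e / e\<close> is the indicator of \<open>e \<noteq> 0\<close>.\<close>

definition nonzero :: "aexp \<Rightarrow> aexp" where
  "nonzero e = Div e e"

lemma aval_nonzero [simp]: "aval (nonzero e) s = of_bool (aval e s \<noteq> 0)"
  by (auto simp: nonzero_def)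

fun clear :: "nat \<Rightarrow> nat \<Rightarrow> com" where
  "clear K 0 = Skip"
| "clear K (Suc m) = Seq (Assign (K + m) (Const 0)) (clear K m)"

lemma wvars_clear: "wvars (clear K m) = {K..<K + m}"
  by (induction m) auto

lemma warrs_clear [simp]: "warrs (clear K m) = {}"
  by (induction m) auto

lemma runs_clear:
  assumes "bounded B s" "0 \<le> B"
  shows "runs B (clear K m) s (m + 1) (\<lambda>s'. \<forall>x<m. fst s' (K + x) = 0)"
  using assms(1)
proof (induction m arbitrary: s)
  case 0
  then show ?case by (auto intro: runs_Skip[simplified])
next
  case (Suc m)
  have "runs B (Seq (Assign (K + m) (Const 0)) (clear K m)) s (1 + (m + 1))
    (\<lambda>s'. \<forall>x<Suc m. fst s' (K + x) = 0)"
  proof (rule runs_Seq, rule runs_Assign)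
    fix s1 assume b: "bounded B ((fst s)(K + m := aval (Const 0) s), snd s)"
    show "runs B (clear K m) ((fst s)(K + m := aval (Const 0) s), snd s) (m + 1)
      (\<lambda>s'. \<forall>x<Suc m. fst s' (K + x) = 0)"
      by (rule runs_weaken[OF Suc.IH[OF b]]) (auto simp: less_Suc_eq wvars_clear)
  qed (use Suc assms in auto)
  then show ?case by simp
qed

text \<open>
  The scalars are: 1: width of the tables, 2: loop counter, 8, 9, 11: block row, block column
  and intermediate block, 10: block size, 12: first fresh cell, 13: offset of the call,
  14: word size of the call; those of the called program start at 15.
\<close>

definition block_cell :: "nat \<Rightarrow> nat \<Rightarrow> aexp" where
  "block_cell r c =
     Plus (Times (Plus (Times (Var r) (Var 10)) (Div (Var 2) (Var 10))) (Var 1))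
       (Plus (Times (Var c) (Var 10)) (Minus (Var 2) (Times (Div (Var 2) (Var 10)) (Var 10))))"

definition bcell :: "nat \<Rightarrow> nat \<Rightarrow> nat \<Rightarrow> nat \<Rightarrow> nat \<Rightarrow> nat" where
  "bcell N d r c x = (r * d + x div d) * N + (c * d + x mod d)"

lemma aval_block_cell:
  assumes "fst s r = int r'" "fst s c = int c'" "fst s 1 = int N" "fst s 10 = int d" "fst s 2 = int x"
  shows "aval (block_cell r c) s = int (bcell N d r' c' x)"
  using assms by (simp add: block_cell_def bcell_def zdiv_int zmod_int minus_div_mult_eq_mod)

lemma bcell_inj:
  assumes "c * d + d \<le> N"
  shows "inj_on (bcell N d r c) {..<d * d}"
proof (rule inj_onI)
  fix x y assume *: "x \<in> {..<d * d}" "y \<in> {..<d * d}" "bcell N d r c x = bcell N d r c y"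
  then have d: "d > 0" by (cases d) auto
  have "c * d + x mod d < N" "c * d + y mod d < N"
    using assms mod_less_divisor[OF d, of x] mod_less_divisor[OF d, of y] by linarith+
  from row_major_inject[OF *(3)[unfolded bcell_def] this]
  have "x div d = y div d" "x mod d = y mod d" by auto
  then show "x = y" by (metis div_mult_mod_eq)
qed

lemma bcell_eq:
  assumes "bcell N d r c x = u * N + v" "x < d * d" "c * d + d \<le> N" "v < N"
  shows "u = r * d + x div d \<and> v = c * d + x mod d \<and> u div d = r \<and> v div d = c"
proof -
  from assms(2) have d: "d > 0" by (cases d) auto
  have "x div d < d" using assms(2) d by (simp add: less_mult_imp_div_less)
  have "c * d + x mod d < N" using assms mod_less_divisor[OF d, of x] by linarith
  from row_major_inject[OF assms(1)[unfolded bcell_def] this assms(4)]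
  show ?thesis using d \<open>x div d < d\<close> by auto
qed

text \<open>A multiplier as seen by callers with Boolean tables. The base \<open>n + 3\<close> is
  \<open>n + M + 2\<close> for entries bounded by \<open>M = 1\<close>. An entry of the product
  counts intermediate indices, so it is only ever tested for being nonzero.\<close>

locale matmul_prog =
  fixes q :: com and mq kq :: nat and \<tau> :: "nat \<Rightarrow> nat"
  assumes cvs_q: "cvs q \<subseteq> {..<mq}"
    and spec: "\<And>n P Q. \<exists>t s. exec ((int n + 3) ^ kq) q
        (size_scalar n, (\<lambda>_ _. 0)(1 := table_array n (\<lambda>i j. of_bool (P i j)),
          2 := table_array n (\<lambda>i j. of_bool (Q i j)))) t s \<and> t \<le> \<tau> n \<and>
        (\<forall>i<n. \<forall>j<n. output_table n s i j \<ge> 0 \<and>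
           (output_table n s i j \<noteq> 0 \<longleftrightarrow> (\<exists>w<n. P i w \<and> Q w j)))"
begin

text \<open>The offset lies \<open>W\<close> beyond the first fresh cell, since the called program
  may use negative indices down to \<open>- W\<close>. Scalar 15 is its scalar 0 and receives the
  block size as input size. Both operands are copied before the result is merged, so
  \<open>yi\<close> may coincide with \<open>yj\<close> or \<open>yk\<close>.\<close>

definition call :: "nat \<Rightarrow> nat \<Rightarrow> nat \<Rightarrow> nat \<Rightarrow> com" where
  "call A yi yj yk =
     Seq (Assign 13 (Plus (Var 12) (Var 14)))
    (Seq (clear 15 mq)
    (Seq (Assign 15 (Var 10))
    (Seq (Fill 2 (Times (Var 10) (Var 10)) (A + 1) (Plus (Var 13) (Var 2)) (Arr yj (block_cell 8 11)))
    (Seq (Fill 2 (Times (Var 10) (Var 10)) (A + 2) (Plus (Var 13) (Var 2)) (Arr yk (block_cell 11 9)))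
    (Seq (shift_c 15 A 13 q)
    (Seq (Fill 2 (Times (Var 10) (Var 10)) yi (block_cell 8 9)
            (nonzero (Plus (Arr yi (block_cell 8 9)) (Arr A (Plus (Var 13) (Var 2))))))
         (Assign 12 (Plus (Plus (Var 13) (Var 14)) (Const 1)))))))))"

lemma wvars_call: "wvars (call A yi yj yk) \<subseteq> {2, 12, 13} \<union> {15..}"
  using wvars_shift[of 15 A 13 q] by (auto simp: call_def wvars_clear)

lemma warrs_call: "warrs (call A yi yj yk) \<subseteq> {yi} \<union> {A..}"
  using warrs_shift[of 15 A 13 q] by (auto simp: call_def)

text \<open>The term \<open>9 * (d * d)\<close> pays for two copies in and one merge out at three
  steps per cell, \<open>mq\<close> for resetting the scalars of the callee, \<open>\<tau> d\<close>
  for its run. The next fresh cell is one past offset plus \<open>W\<close>.\<close>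

lemma runs_call:
  assumes B: "bounded B s"
    and vars: "fst s 1 = int N" "fst s 10 = int d" "fst s 8 = int r" "fst s 9 = int c" "fst s 11 = int b"
      "fst s 12 = F" "fst s 14 = W"
    and d: "d > 0" "r * d + d \<le> N" "c * d + d \<le> N" "b * d + d \<le> N"
    and F: "fresh A F s" "0 \<le> F" "(int d + 3) ^ kq \<le> W" "int (d * d) \<le> W" "F + 2 * W + 1 \<le> B"
    and y: "yi < A" "yj < A" "yk < A"
    and tabs: "tab N (snd s yi) P" "tab N (snd s yj) Q" "tab N (snd s yk) R"
  shows "runs B (call A yi yj yk) s (mq + 9 * (d * d) + \<tau> d + 10) (\<lambda>s'.
    fst s' 12 = F + 2 * W + 1 \<and> fresh A (F + 2 * W + 1) s' \<and>
    tab N (snd s' yi) (\<lambda>u v. P u v \<or>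
      u div d = r \<and> v div d = c \<and> (\<exists>w. w div d = b \<and> Q u w \<and> R w v)))"
proof -
  have W: "1 \<le> W" "W \<le> B" "int (d * d) \<le> B" "1 \<le> B" "int d \<le> B"
  proof -
    show "1 \<le> W" using F d by (smt (verit) nat_0_less_mult_iff of_nat_0_less_iff)
    then show "W \<le> B" "int (d * d) \<le> B" "1 \<le> B" using F by auto
    have "d \<le> d * d" using d by simp
    then show "int d \<le> B" using \<open>int (d * d) \<le> B\<close> by linarith
  qed
  have cell: "bcell N d r' c' x = (r' * d + x div d) * N + (c' * d + x mod d)"
    "r' * d + x div d < N" "c' * d + x mod d < N" "x div d < d" "x mod d < d"
    if "x < d * d" "r' * d + d \<le> N" "c' * d + d \<le> N" for r' c' x
  proof -
    show "x div d < d" "x mod d < d" using that d by (simp_all add: less_mult_imp_div_less)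
    then show "r' * d + x div d < N" "c' * d + x mod d < N" using that by linarith+
  qed (simp add: bcell_def)
  define Pq where "Pq i j = Q (r * d + i) (b * d + j)" for i j
  define Pr where "Pr i j = R (b * d + i) (c * d + j)" for i j
  obtain t sq where ex: "exec ((int d + 3) ^ kq) q (size_scalar d, (\<lambda>_ _. 0)(
          1 := table_array d (\<lambda>i j. of_bool (Pq i j)),
          2 := table_array d (\<lambda>i j. of_bool (Pr i j)))) t sq" "t \<le> \<tau> d"
    and out: "\<And>i j. i < d \<Longrightarrow> j < d \<Longrightarrow> output_table d sq i j \<ge> 0 \<and>
           (output_table d sq i j \<noteq> 0 \<longleftrightarrow> (\<exists>w<d. Pq i w \<and> Pr w j))"
    using spec[of d Pq Pr] by blast
  from exec_mono[OF ex(1) F(3)] have ex1: "exec W q (size_scalar d, (\<lambda>_ _. 0)(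
          1 := table_array d (\<lambda>i j. of_bool (Pq i j)),
          2 := table_array d (\<lambda>i j. of_bool (Pr i j)))) t sq" .
  define post where "post = (\<lambda>s'. fst s' 12 = F + 2 * W + 1 \<and> fresh A (F + 2 * W + 1) s' \<and>
    tab N (snd s' yi) (\<lambda>u v. P u v \<or>
      u div d = r \<and> v div d = c \<and> (\<exists>w. w div d = b \<and> Q u w \<and> R w v)))"
  have "runs B (call A yi yj yk) s
    (1 + ((mq + 1) + (1 + ((2 + 3 * (d * d)) + ((2 + 3 * (d * d)) + (\<tau> d + ((2 + 3 * (d * d)) + 1))))))) post"
    unfolding call_def
  proof (rule runs_Seq, rule runs_Assign, goal_cases)
    case B1: 3
    show ?case
    proof (rule runs_Seq, rule runs_weaken[OF runs_clear[OF B1]], goal_cases)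
      case (3 s2)
      note B2 = 3(1) and fv = 3(2) and fa = 3(3) and z = 3(4)
      have v2: "fst s2 1 = int N" "fst s2 10 = int d" "fst s2 8 = int r" "fst s2 9 = int c"
        "fst s2 11 = int b" "fst s2 12 = F" "fst s2 14 = W" "fst s2 13 = F + W"
        using fv vars by (auto simp: wvars_clear)
      have a2: "snd s2 = snd s" using fa by auto
      show ?case
      proof (rule runs_Seq, rule runs_Assign, goal_cases)
        case 3
        show ?case
        proof (rule runs_Seq, rule runs_Fill[where h = "d * d" and p = "\<lambda>x. F + W + int x"
              and f = "\<lambda>x. of_bool (Pq (x div d) (x mod d))"], goal_cases)
          case (5 i g)
          have "snd s yj (int (bcell N d r b i)) = of_bool (Pq (i div d) (i mod d))"
            using tabs(2) cell[OF 5(1) d(2) d(4)] by (simp add: tab_def Pq_def del: of_nat_add of_nat_mult)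
          then show ?case using y v2 a2
            by (simp add: aval_block_cell[where r' = r and c' = b and d = d and N = N and x = i])
        next
          case (8 g1)
          note g1 = 8
          show ?case
          proof (rule runs_Seq, rule runs_Fill[where h = "d * d" and p = "\<lambda>x. F + W + int x"
                and f = "\<lambda>x. of_bool (Pr (x div d) (x mod d))"], goal_cases)
            case (5 i g)
            have "snd s yk (int (bcell N d b c i)) = of_bool (Pr (i div d) (i mod d))"
              using tabs(3) cell[OF 5(1) d(4) d(3)] by (simp add: tab_def Pr_def del: of_nat_add of_nat_mult)
            then show ?case using y v2 a2
              by (simp add: aval_block_cell[where r' = b and c' = c and d = d and N = N and x = i])
          next
            case (8 g2)
            note g2 = 8
            define s4 where "s4 = ((fst ((fst ((fst s2)(15 := aval (Var 10) s2), snd s2))(2 := int (d * d)),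
               (snd ((fst s2)(15 := aval (Var 10) s2), snd s2))(A + 1 := g1)))(2 := int (d * d)),
               (snd ((fst ((fst s2)(15 := aval (Var 10) s2), snd s2))(2 := int (d * d)),
               (snd ((fst s2)(15 := aval (Var 10) s2), snd s2))(A + 1 := g1)))(A + 2 := g2))"
            have s4: "s4 = ((fst s2)(15 := int d, 2 := int (d * d)), (snd s)(A + 1 := g1, A + 2 := g2))"
              by (simp add: s4_def v2 a2)
            have B4: "bounded B s4" using g2(3) unfolding s4_def .
            \<comment> \<open>Outside the copied cells the window is still fresh, hence zero, as
              \<open>table_array\<close> is outside its table.\<close>
            have tabg: "g (F + W + i) = table_array d f i"
              if "\<And>i. i < d * d \<Longrightarrow> g (F + W + int i) = f (i div d) (i mod d)"
                "\<And>z. z \<notin> (\<lambda>x. F + W + int x) ` {..<d * d} \<Longrightarrow> g z = snd s (A + a) z" "\<bar>i\<bar> \<le> W"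
              for g f i a
            proof (cases "0 \<le> i \<and> i < int (d * d)")
              case True
              then show ?thesis using that(1)[of "nat i"] by (auto simp: table_array_def nat_less_iff)
            next
              case False
              then have "F + W + i \<notin> (\<lambda>x. F + W + int x) ` {..<d * d}" by (auto simp del: of_nat_mult)
              moreover have "snd s (A + a) (F + W + i) = 0" using F(1) that(3) by (auto simp: fresh_def)
              ultimately show ?thesis using that(2) False by (auto simp: table_array_def)
            qed
            have g1': "g1 z = snd s (A + 1) z" if "z \<notin> (\<lambda>x. F + W + int x) ` {..<d * d}" for z
              using g1(2)[OF that] a2 by simp
            have g2': "g2 z = snd s (A + 2) z" if "z \<notin> (\<lambda>x. F + W + int x) ` {..<d * d}" for z
              using g2(2)[OF that] a2 by simp
            have "shifted W mq 15 A 13 (size_scalar d, (\<lambda>_ _. 0)(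
                1 := table_array d (\<lambda>i j. of_bool (Pq i j)),
                2 := table_array d (\<lambda>i j. of_bool (Pr i j)))) s4"
              unfolding shifted_def
            proof (intro conjI allI impI)
              fix x assume "x < mq"
              then show "fst s4 (15 + x) = fst (size_scalar d, (\<lambda>_ _. 0)(
                1 := table_array d (\<lambda>i j. of_bool (Pq i j)),
                2 := table_array d (\<lambda>i j. of_bool (Pr i j)))) x"
                using z by (auto simp: s4 size_scalar_def)
            next
              fix a i assume i: "\<bar>i\<bar> \<le> W"
              then have "snd s (A + a) (F + W + i) = 0" using F(1) by (auto simp: fresh_def)
              then show "snd s4 (A + a) (fst s4 13 + i) = snd (size_scalar d, (\<lambda>_ _. 0)(
                1 := table_array d (\<lambda>i j. of_bool (Pq i j)),
                2 := table_array d (\<lambda>i j. of_bool (Pr i j)))) a i"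
                using tabg[where g = g1 and a = 1 and f = "\<lambda>i j. of_bool (Pq i j)", OF g1(1) g1' i]
                  tabg[where g = g2 and a = 2 and f = "\<lambda>i j. of_bool (Pr i j)", OF g2(1) g2' i]
                by (auto simp: s4 v2)
            qed
            from run_shift[OF ex1 cvs_q this _ B4 W(2)] obtain s5 where
              s5: "run B (shift_c 15 A 13 q) s4 t s5" "shifted W mq 15 A 13 sq s5"
              "\<forall>a i. W < \<bar>i - fst s4 13\<bar> \<longrightarrow> snd s5 a i = snd s4 a i" by auto
            have v5: "fst s5 x = fst s4 x" if "x < 15" for x
              using run_frame_var[OF s5(1) notin_wvars_shift] that by auto
            have a5: "snd s5 a = snd s a" if "a < A" for a
              using run_frame_arr[OF s5(1) notin_warrs_shift] that by (auto simp: s4)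
            have v5: "fst s5 1 = int N" "fst s5 10 = int d" "fst s5 8 = int r" "fst s5 9 = int c"
              "fst s5 13 = F + W" "fst s5 14 = W"
              using v5 v2 by (auto simp: s4)
            have out5: "snd s5 A (F + W + int x) = output_table d sq (x div d) (x mod d)"
              if "x < d * d" for x
            proof -
              have "\<bar>int x\<bar> \<le> W" using F(4) that by linarith
              then have "snd s5 (A + 0) (fst s5 13 + int x) = snd sq 0 (int x)"
                using s5(2) unfolding shifted_def by blast
              then show ?thesis by (simp add: v5 output_table_def)
            qed
            have fr5: "fresh A (F + 2 * W + 1) s5"
            proof -
              have "snd s5 a z = 0" if "a \<ge> A" "z \<ge> F + 2 * W + 1" for a z
              proof -
                have "snd s5 a z = snd s4 a z" using s5(3) that by (auto simp: s4 v2)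
                moreover have "z \<notin> (\<lambda>x. F + W + int x) ` {..<d * d}"
                  using that F(4) by (auto simp del: of_nat_mult)
                ultimately show ?thesis using g1' g2' that F(1) W by (auto simp: s4 fresh_def)
              qed
              then show ?thesis by (auto simp: fresh_def)
            qed
            show ?case unfolding s4_def[symmetric]
            proof (rule runs_Seq, rule runsI[OF s5(1) ex(2)], rule runs_Seq, rule runs_Fill[where h = "d * d" and p = "\<lambda>x. int (bcell N d r c x)"
                    and f = "\<lambda>x. of_bool (P (r * d + x div d) (c * d + x mod d) \<or>
                       (\<exists>w<d. Pq (x div d) w \<and> Pr w (x mod d)))"], goal_cases)
                case 1 show ?case using s5(1) by (rule run_bounded)
              next
                case 2 show ?case using W by simp
              next
                case (3 i g) show ?case by (simp add: v5)
              next
                case (4 i g) show ?case by (rule aval_block_cell) (simp_all add: v5[simplified])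
              next
                case (5 i g)
                have bc: "aval (block_cell 8 9) ((fst s5)(2 := int i), (snd s5)(yi := g)) =
                  int (bcell N d r c i)"
                  by (rule aval_block_cell) (simp_all add: v5[simplified])
                have "snd s yi (int (bcell N d r c i)) = of_bool (P (r * d + i div d) (c * d + i mod d))"
                  using tabs(1) cell[OF 5(1) d(2) d(3)] by (simp add: tab_def del: of_nat_add of_nat_mult)
                \<comment> \<open>As the count cannot be negative, nothing cancels: old entry plus
                  count is nonzero exactly if one of them is.\<close>
                moreover have "output_table d sq (i div d) (i mod d) \<ge> 0"
                  "output_table d sq (i div d) (i mod d) \<noteq> 0 \<longleftrightarrow>
                    (\<exists>w<d. Pq (i div d) w \<and> Pr w (i mod d))"
                  using out cell(4,5)[OF 5(1) d(2) d(3)] by auto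
                ultimately show ?case
                  using y 5 a5[of yi] out5[OF 5(1)] by (auto simp: bc v5)
              next
                case 6 show ?case using bcell_inj[OF d(3)] by (auto simp: inj_on_def)
              next
                case (7 i) show ?case using W by simp
              next
                case (8 g)
                have tab': "tab N g (\<lambda>u v. P u v \<or>
                    u div d = r \<and> v div d = c \<and> (\<exists>w. w div d = b \<and> Q u w \<and> R w v))"
                  unfolding tab_def
                proof (intro allI impI)
                  fix u v assume uv: "u < N" "v < N"
                  show "g (int (u * N + v)) = of_bool (P u v \<or>
                    u div d = r \<and> v div d = c \<and> (\<exists>w. w div d = b \<and> Q u w \<and> R w v))"
                  proof (cases "u div d = r \<and> v div d = c")
                    case True
                    \<comment> \<open>The row-major index of the cell \<open>(u, v)\<close> inside
                      its block.\<close>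
                    define x where "x = (u mod d) * d + v mod d"
                    have ud: "u mod d < d" "v mod d < d" using d by auto
                    have "x < (u mod d) * d + d" using ud by (simp add: x_def)
                    also have "\<dots> = Suc (u mod d) * d" by simp
                    also have "\<dots> \<le> d * d" using ud(1) by (intro mult_le_mono1) linarith
                    finally have x: "x < d * d" .
                    have xd: "x div d = u mod d" "x mod d = v mod d" using ud by (auto simp: x_def)
                    have u: "r * d + u mod d = u" "c * d + v mod d = v" using True by auto
                    have "bcell N d r c x = u * N + v" by (simp add: bcell_def xd u)
                    then have "g (int (u * N + v)) = of_bool (P u v \<or> (\<exists>w<d. Pq (u mod d) w \<and> Pr w (v mod d)))"
                      using 8(1)[OF x] by (simp add: xd u del: of_nat_mult of_nat_add)
                    moreover have "(\<exists>w<d. Pq (u mod d) w \<and> Pr w (v mod d)) \<longleftrightarrow>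
                      (\<exists>w. w div d = b \<and> Q u w \<and> R w v)" (is "?l \<longleftrightarrow> ?r")
                    proof
                      assume ?l
                      then obtain w where "w < d" "Q u (b * d + w)" "R (b * d + w) v"
                        by (auto simp: Pq_def Pr_def u)
                      then show ?r using d by (intro exI[of _ "b * d + w"]) auto
                    next
                      assume ?r
                      then obtain w where w: "w div d = b" "Q u w" "R w v" by blast
                      then have "b * d + w mod d = w" by auto
                      then show ?l using w d by (intro exI[of _ "w mod d"]) (auto simp: Pq_def Pr_def u)
                    qed
                    ultimately show ?thesis using True by simp
                  next
                    case False
                    have "int (u * N + v) \<notin> (\<lambda>x. int (bcell N d r c x)) ` {..<d * d}"
                    proof
                      assume "int (u * N + v) \<in> (\<lambda>x. int (bcell N d r c x)) ` {..<d * d}"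
                      then obtain x where "x < d * d" "bcell N d r c x = u * N + v"
                        by (auto simp del: of_nat_mult of_nat_add)
                      from bcell_eq[OF this(2,1) d(3) uv(2)] False show False by auto
                    qed
                    then have "g (int (u * N + v)) = snd s yi (int (u * N + v))"
                      using 8(2) y a5[of yi] by simp
                    then show ?thesis using tabs(1) uv False by (auto simp: tab_def)
                  qed
                qed
                show ?case
                proof (rule runs_Assign, goal_cases)
                  case 1 show ?case using 8 by simp
                next
                  case 2 show ?case using F W by (simp add: v5)
                next
                  case 3
                  show ?case using tab' fr5 y by (auto simp: v5 fresh_def post_def)
                qed
            qed
          qed (use g1 v2 W in \<open>auto simp: inj_on_def\<close>)
        qed (use 3 v2 W in \<open>auto simp: inj_on_def\<close>)
      qed (use B2 v2 W in auto)
    qed (use W in auto)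
  qed (use B F W vars in auto)
  then show ?thesis unfolding post_def by (rule runs_weaken) auto
qed

end

section \<open>The order of evaluation\<close>

text \<open>
  The cells of the table are visited in Z-order with the rows reversed; \<open>od\<close> and \<open>ev\<close> extract
  the reversed row and the column, that is, the odd and the even bits of the position.
\<close>

fun ev :: "nat \<Rightarrow> nat" where
  "ev t = (if t = 0 then 0 else t mod 2 + 2 * ev (t div 4))"

fun od :: "nat \<Rightarrow> nat" where
  "od t = (if t = 0 then 0 else t div 2 mod 2 + 2 * od (t div 4))"

text \<open>The Morton code: the bits of \<open>a\<close> at the odd and those of \<open>b\<close>
  at the even positions.\<close>

function mor :: "nat \<Rightarrow> nat \<Rightarrow> nat" where
  "mor a b = (if a = 0 \<and> b = 0 then 0
     else 2 * (a mod 2) + b mod 2 + 4 * mor (a div 2) (b div 2))"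
  by pat_completeness auto
termination by (relation "measure (\<lambda>(a, b). a + b)") auto

declare ev.simps [simp del] od.simps [simp del] mor.simps [simp del]

lemma ev_0 [simp]: "ev 0 = 0" and od_0 [simp]: "od 0 = 0" and mor_0 [simp]: "mor 0 0 = 0"
  by (simp_all add: ev.simps od.simps mor.simps)

lemma ev_rec: "ev t = t mod 2 + 2 * ev (t div 4)"
  by (cases "t = 0") (auto simp: ev.simps[of t])

lemma od_rec: "od t = t div 2 mod 2 + 2 * od (t div 4)"
  by (cases "t = 0") (auto simp: od.simps[of t])

lemma mor_rec: "mor a b = 2 * (a mod 2) + b mod 2 + 4 * mor (a div 2) (b div 2)"
  by (cases "a = 0 \<and> b = 0") (auto simp: mor.simps[of a b])

lemma two_digits:
  assumes "x < 2" "y < 2"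
  shows "(2 * x + y + 4 * m) mod 2 = y" "(2 * x + y + 4 * m) div 2 mod 2 = x"
    "(2 * x + y + 4 * m) div 4 = (m::nat)" "(y + 2 * m) div 2 = m"
  using assms by presburger+

lemma mor_div_4: "mor a b div 4 = mor (a div 2) (b div 2)"
  by (subst mor_rec, rule two_digits) auto

lemma ev_mor: "ev (mor a b) = b" and od_mor: "od (mor a b) = a"
proof (induction a b rule: mor.induct)
  case (1 a b)
  note IH = 1
  let ?m = "mor (a div 2) (b div 2)"
  have *: "mor a b mod 2 = b mod 2" "mor a b div 2 mod 2 = a mod 2" "mor a b div 4 = ?m"
    by (subst mor_rec, rule two_digits, auto)+
  { case 1
    show ?case using IH by (cases "a = 0 \<and> b = 0") (auto simp: ev_rec[of "mor a b"] *)
  next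
    case 2
    show ?case using IH by (cases "a = 0 \<and> b = 0") (auto simp: od_rec[of "mor a b"] *)
  }
qed

text \<open>Dropping \<open>k\<close> low bits of both coordinates drops \<open>2 * k\<close> low
  bits of the code. Hence an aligned block of size \<open>2 ^ k\<close> is an interval of
  \<open>4 ^ k\<close> consecutive positions that begins at a multiple of
  \<open>4 ^ k\<close>.\<close>

lemma mor_div: "mor a b div 4 ^ k = mor (a div 2 ^ k) (b div 2 ^ k)"
proof (induction k arbitrary: a b)
  case (Suc k)
  show ?case using mor_div_4 Suc[of "a div 2" "b div 2"] by (simp add: div_mult2_eq)
qed simp

lemma ev_div: "ev t div 2 ^ k = ev (t div 4 ^ k)"
proof (induction k arbitrary: t)
  case (Suc k)
  have "ev t div 2 = ev (t div 4)" by (subst ev_rec, rule two_digits(4)[of 0]) auto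
  then show ?case using Suc[of "t div 4"] by (simp add: div_mult2_eq)
qed simp

lemma od_div: "od t div 2 ^ k = od (t div 4 ^ k)"
proof (induction k arbitrary: t)
  case (Suc k)
  have "od t div 2 = od (t div 4)" by (subst od_rec, rule two_digits(4)[of 0]) auto
  then show ?case using Suc[of "t div 4"] by (simp add: div_mult2_eq)
qed simp

lemma ev_less: "t < 4 ^ k \<Longrightarrow> ev t < 2 ^ k"
  using ev_div[of t k] by (simp add: div_eq_0_iff)

lemma od_less: "t < 4 ^ k \<Longrightarrow> od t < 2 ^ k"
  using od_div[of t k] by (simp add: div_eq_0_iff)

lemma mor_less_power: "a < 2 ^ k \<Longrightarrow> b < 2 ^ k \<Longrightarrow> mor a b < 4 ^ k"
  using mor_div[of a b k] by (simp add: div_eq_0_iff)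

text \<open>Z-order extends the componentwise order, because the higher bits decide and the
  induction applies to them. With the rows reversed, this puts every operand before the cell that
  needs it.\<close>

lemma mor_mono: "a \<le> a' \<Longrightarrow> b \<le> b' \<Longrightarrow> mor a b \<le> mor a' b'"
proof (induction a' b' arbitrary: a b rule: mor.induct)
  case (1 a' b')
  show ?case
  proof (cases "a' = 0 \<and> b' = 0")
    case False
    let ?m = "mor (a div 2) (b div 2)" and ?m' = "mor (a' div 2) (b' div 2)"
    have le: "a div 2 \<le> a' div 2" "b div 2 \<le> b' div 2" using 1 by (simp_all add: div_le_mono)
    then have "?m \<le> ?m'" using 1(1)[OF False] by blast
    moreover have "?m = ?m' \<Longrightarrow> a div 2 = a' div 2 \<and> b div 2 = b' div 2"
      by (metis ev_mor od_mor)
    ultimately have "?m < ?m' \<or> a div 2 = a' div 2 \<and> b div 2 = b' div 2 \<and> ?m = ?m'"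
      by linarith
    then show ?thesis
    proof
      \<comment> \<open>The higher part grows by at least 4, which the two lowest bits, worth at
        most 3, cannot undo.\<close>
      assume "?m < ?m'"
      moreover have "a mod 2 < 2" "b mod 2 < 2" by simp_all
      ultimately show ?thesis unfolding mor_rec[of a b] mor_rec[of a' b'] by linarith
    next
      assume *: "a div 2 = a' div 2 \<and> b div 2 = b' div 2 \<and> ?m = ?m'"
      have "a mod 2 \<le> a' mod 2" "b mod 2 \<le> b' mod 2"
        using 1(2,3) * div_mult_mod_eq[of a 2] div_mult_mod_eq[of a' 2]
          div_mult_mod_eq[of b 2] div_mult_mod_eq[of b' 2] by linarith+
      then show ?thesis unfolding mor_rec[of a b] mor_rec[of a' b'] using * by linarith
    qed
  qed (use 1 in auto)
qed

lemma mor_strict_mono: "a \<le> a' \<Longrightarrow> b \<le> b' \<Longrightarrow> a < a' \<or> b < b' \<Longrightarrow> mor a b < mor a' b'"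
  using mor_mono[of a a' b b'] ev_mor[of a b] ev_mor[of a' b'] od_mor[of a b] od_mor[of a' b']
  by (cases "mor a b = mor a' b'") auto

text \<open>Subtraction from \<open>2 ^ L - 1\<close> complements all \<open>L\<close> bits, and
  this commutes with dropping the lowest \<open>k\<close> of them.\<close>

lemma reverse_div:
  assumes "u < 2 ^ L" "k \<le> L"
  shows "(2 ^ L - 1 - u) div 2 ^ k = 2 ^ (L - k) - 1 - u div (2 ^ k :: nat)"
proof (rule div_nat_eqI)
  define q p where "q = u div 2 ^ k" and "p = u mod 2 ^ k"
  have u: "u = q * 2 ^ k + p" "p < 2 ^ k" by (simp_all add: q_def p_def div_mult_mod_eq)
  have L: "(2::nat) ^ L = 2 ^ (L - k) * 2 ^ k" using assms(2) by (simp flip: power_add)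
  have "u < 2 ^ (L - k) * 2 ^ k" using assms(1) L by simp
  then have "q < 2 ^ (L - k)" by (simp add: q_def less_mult_imp_div_less)
  then obtain r where r: "2 ^ (L - k) = q + r + 1" by (metis add.commute less_natE plus_1_eq_Suc add.assoc)
  have "2 ^ L - 1 - u = r * 2 ^ k + (2 ^ k - 1 - p)"
    using u(2) by (simp add: L r u(1) algebra_simps)
  then show "2 ^ k * (2 ^ (L - k) - 1 - u div 2 ^ k) \<le> 2 ^ L - 1 - u"
    "2 ^ L - 1 - u < 2 ^ k * Suc (2 ^ (L - k) - 1 - u div 2 ^ k)"
    using u(2) by (auto simp: r q_def[symmetric] algebra_simps)
qed

text \<open>A cell \<open>(u, v)\<close> depends on \<open>(u, w)\<close> with a smaller column and
  on \<open>(w, v)\<close> with a larger row. Complementing the row makes both of them componentwise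
  smaller.\<close>

definition key :: "nat \<Rightarrow> nat \<Rightarrow> nat \<Rightarrow> nat" where
  "key L u v = mor (2 ^ L - 1 - u) v"

text \<open>
  At the largest scale at which \<open>u\<close>, \<open>w\<close>, \<open>v\<close> still lie in distinct blocks, the block of \<open>w\<close>
  is adjacent to one of the others.
\<close>

lemma separating_scale:
  assumes "u < w" "w < (v::nat)"
  obtains k where "u div 2 ^ k < w div 2 ^ k" "w div 2 ^ k < v div 2 ^ k"
    "w div 2 ^ k = u div 2 ^ k + 1 \<or> w div 2 ^ k = v div 2 ^ k - 1"
proof -
  define P where "P k \<longleftrightarrow> u div 2 ^ k < w div 2 ^ k \<and> w div 2 ^ k < v div (2::nat) ^ k" for k
  have "P 0" using assms by (simp add: P_def)
  \<comment> \<open>Since \<open>v < 2 ^ v\<close>, the quotient of \<open>v\<close> is 0 at scale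
    \<open>v\<close>.\<close>
  moreover have "\<not> P v" by (simp add: P_def)
  ultimately obtain k where k: "P k" "\<not> P (Suc k)"
    using nat_induct[of P v] by blast
  have "w div 2 ^ k = u div 2 ^ k + 1 \<or> w div 2 ^ k = v div 2 ^ k - 1"
  proof -
    have "\<not> (u div 2 ^ k div 2 < w div 2 ^ k div 2 \<and> w div 2 ^ k div 2 < v div 2 ^ k div 2)"
      using k(2) by (simp add: P_def div_mult2_eq power_Suc2 del: power_Suc)
    \<comment> \<open>Numbers at distance at least 2 stay distinct when halved, so a middle block
      away from both others would still separate at the next scale.\<close>
    moreover have "y = x + 1 \<or> y = z - 1" if "\<not> (x div 2 < y div 2 \<and> y div 2 < z div 2)" "x < y" "y < z"
      for x y z :: nat
    proof (rule ccontr)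
      assume "\<not> ?thesis"
      then have "(x + 2) div 2 \<le> y div 2" "(y + 2) div 2 \<le> z div 2"
        using that(2,3) by (auto intro!: div_le_mono)
      then show False using that(1) by simp
    qed
    ultimately show ?thesis using k(1) unfolding P_def by blast
  qed
  with k(1) that show ?thesis by (auto simp: P_def)
qed

text \<open>Operands are taken from \<open>Y\<close>, the tables before a step, and results are
  demanded in \<open>Y'\<close>, the tables after it. Whatever else happens during the step only
  enlarges the tables, which preserves the property.\<close>

definition block_closed ::
    "(nat \<times> nat \<times> nat) list \<Rightarrow> nat \<Rightarrow> nat \<Rightarrow> nat \<Rightarrow> nat \<Rightarrow>
     (nat \<Rightarrow> nat \<Rightarrow> nat \<Rightarrow> bool) \<Rightarrow> (nat \<Rightarrow> nat \<Rightarrow> nat \<Rightarrow> bool) \<Rightarrow> bool" where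
  "block_closed rs d r b c Y Y' \<longleftrightarrow> (\<forall>i j k u w v. (i, j, k) \<in> set rs \<longrightarrow>
     u div d = r \<longrightarrow> w div d = b \<longrightarrow> v div d = c \<longrightarrow> Y j u w \<longrightarrow> Y k w v \<longrightarrow> Y' i u v)"

text \<open>
  \<open>R i\<close> is the relation of the symbol with number \<open>i\<close>; \<open>(i, j, k) \<in> rs\<close> means that a path of
  type \<open>j\<close> followed by a path of type \<open>k\<close> is a path of type \<open>i\<close>.
\<close>

locale binary_system =
  fixes L :: nat and rs :: "(nat \<times> nat \<times> nat) list"
    and base R :: "nat \<Rightarrow> nat \<Rightarrow> nat \<Rightarrow> bool"
  assumes base: "base \<le> R"
    and closed: "\<And>i j k u w v. (i, j, k) \<in> set rs \<Longrightarrow> R j u w \<Longrightarrow> R k w v \<Longrightarrow> R i u v"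
    and unfold: "\<And>i u v. R i u v \<Longrightarrow> base i u v \<or> (\<exists>j k w. (i, j, k) \<in> set rs \<and> R j u w \<and> R k w v)"
    and strict: "\<And>i u v. R i u v \<Longrightarrow> u < v \<and> v < 2 ^ L"
begin

definition block_row :: "nat \<Rightarrow> nat \<Rightarrow> nat" where
  "block_row t s = (2 ^ L - 1 - od t) div 2 ^ s"

definition block_col :: "nat \<Rightarrow> nat \<Rightarrow> nat" where
  "block_col t s = ev t div 2 ^ s"

text \<open>The number \<open>4 ^ s * (key L u v div 4 ^ s)\<close> is the position of the first
  cell of the size-\<open>2 ^ s\<close> block around \<open>(u, v)\<close>, that is, the moment at
  which the products for this block are added.\<close>

definition covered :: "nat \<Rightarrow> (nat \<Rightarrow> nat \<Rightarrow> nat \<Rightarrow> bool) \<Rightarrow> bool" where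
  "covered t Y \<longleftrightarrow> (\<forall>i j k u w v s. (i, j, k) \<in> set rs \<longrightarrow> R j u w \<longrightarrow> R k w v \<longrightarrow>
     u div 2 ^ s < w div 2 ^ s \<longrightarrow> w div 2 ^ s < v div 2 ^ s \<longrightarrow>
     w div 2 ^ s = u div 2 ^ s + 1 \<or> w div 2 ^ s = v div 2 ^ s - 1 \<longrightarrow>
     4 ^ s * (key L u v div 4 ^ s) < t \<longrightarrow> Y i u v)"

text \<open>A block begins no later than any of its cells. So once position \<open>t\<close> is past
  the cell, every split point of it has been treated at the scale given by
  \<open>separating_scale\<close>.\<close>

lemma covered_complete:
  assumes "covered t Y" "base \<le> Y" "key L u v < t" "R i u v"
  shows "Y i u v"
  using unfold[OF assms(4)]
proof
  assume "\<exists>j k w. (i, j, k) \<in> set rs \<and> R j u w \<and> R k w v"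
  then obtain j k w where *: "(i, j, k) \<in> set rs" "R j u w" "R k w v" by blast
  have "u < w" "w < v" using strict * by auto
  then obtain s where "u div 2 ^ s < w div 2 ^ s" "w div 2 ^ s < v div 2 ^ s"
    "w div 2 ^ s = u div 2 ^ s + 1 \<or> w div 2 ^ s = v div 2 ^ s - 1"
    by (rule separating_scale)
  moreover have "4 ^ s * (key L u v div 4 ^ s) < t"
    using assms(3) by (meson le_less_trans times_div_less_eq_dividend)
  ultimately show ?thesis using assms(1) * unfolding covered_def by blast
qed (use assms(2) in \<open>auto simp: le_fun_def\<close>)

text \<open>The blocks that begin at position 0 have block column 0 and leave no room for a smaller
  middle block. The loop can thus start at position 1.\<close>

lemma covered_1: "covered 1 Y"
proof -
  have False if "R k w v" "w div 2 ^ s < v div 2 ^ s" "4 ^ s * (key L u v div 4 ^ s) < 1" for k u w v s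
  proof -
    have "mor ((2 ^ L - 1 - u) div 2 ^ s) (v div 2 ^ s) = 0"
      using that(3) by (simp add: key_def mor_div)
    then have "v div 2 ^ s = 0" by (metis ev_0 ev_mor)
    then show False using that(2) by simp
  qed
  then show ?thesis unfolding covered_def by blast
qed

text \<open>The new obligations concern the blocks whose first cell is \<open>t\<close>. For a
  middle block strictly between block row and block column, both operand blocks have a smaller code
  at the same scale, hence lie entirely before \<open>t\<close> and are complete in
  \<open>Y\<close>.\<close>

lemma covered_Suc:
  assumes cov: "covered t Y" and Y: "base \<le> Y" "Y \<le> Y'"
    and step: "\<And>s b. 4 ^ s dvd t \<Longrightarrow> block_row t s < block_col t s \<Longrightarrow>
      b = block_row t s + 1 \<or> b = block_col t s - 1 \<Longrightarrow>
      block_closed rs (2 ^ s) (block_row t s) b (block_col t s) Y Y'"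
  shows "covered (Suc t) Y'"
  unfolding covered_def
proof (intro allI impI)
  fix i j k u w v s
  assume rs: "(i, j, k) \<in> set rs" "R j u w" "R k w v"
    and s: "u div 2 ^ s < w div 2 ^ s" "w div 2 ^ s < v div 2 ^ s"
      "w div 2 ^ s = u div 2 ^ s + 1 \<or> w div 2 ^ s = v div 2 ^ s - 1"
    and t: "4 ^ s * (key L u v div 4 ^ s) < Suc t"
  show "Y' i u v"
  proof (cases "4 ^ s * (key L u v div 4 ^ s) < t")
    case True
    then have "Y i u v" using cov rs s unfolding covered_def by blast
    then show ?thesis using Y by (auto simp: le_fun_def)
  next
    case False
    then have t: "t = 4 ^ s * (key L u v div 4 ^ s)" using t by simp
    then have t': "t div 4 ^ s = mor ((2 ^ L - 1 - u) div 2 ^ s) (v div 2 ^ s)"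
      by (simp add: key_def mor_div)
    have uv: "u < w" "w < v" "v < 2 ^ L" using strict rs by auto
    then have "u < 2 ^ L" "w < 2 ^ L" by simp_all
    have sL: "s \<le> L"
    proof (rule ccontr)
      assume "\<not> s \<le> L"
      then have "(2::nat) ^ L \<le> 2 ^ s" by simp
      then have "v < 2 ^ s" using uv(3) by linarith
      then show False using s(2) by simp
    qed
    have col: "block_col t s = v div 2 ^ s" by (simp add: block_col_def ev_div t' ev_mor)
    have t4: "t < 4 ^ L"
    proof -
      have "t \<le> key L u v" using t by simp
      also have "\<dots> < 4 ^ L" unfolding key_def using uv by (intro mor_less_power) auto
      finally show ?thesis .
    qed
    have ub: "u div 2 ^ s < 2 ^ (L - s)"
    proof -
      have "u < 2 ^ (L - s) * 2 ^ s" using uv sL by (simp flip: power_add)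
      then show ?thesis by (rule less_mult_imp_div_less)
    qed
    have row: "block_row t s = u div 2 ^ s"
    proof -
      have "block_row t s = 2 ^ (L - s) - 1 - od t div 2 ^ s"
        unfolding block_row_def by (rule reverse_div[OF od_less[OF t4] sL])
      also have "od t div 2 ^ s = 2 ^ (L - s) - 1 - u div 2 ^ s"
        using reverse_div[of u L s] uv sL by (simp add: od_div t' od_mor)
      finally show ?thesis using ub by linarith
    qed
    \<comment> \<open>A block with a smaller code ends before the block of \<open>(u, v)\<close>
      begins, and the latter begins at \<open>t\<close>.\<close>
    have lt: "key L x y < t" if "key L x y div 4 ^ s < key L u v div 4 ^ s" for x y
    proof -
      have "key L x y < key L u v div 4 ^ s * 4 ^ s"
        using that div_less_iff_less_mult[of "4 ^ s" "key L x y"] by simp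
      then show ?thesis using t by (metis mult.commute)
    qed
    have "key L u w < t"
      by (rule lt, unfold key_def mor_div, rule mor_strict_mono) (use s in auto)
    then have 1: "Y j u w" using covered_complete[OF cov Y(1)] rs by blast
    have wb: "w div 2 ^ s < 2 ^ (L - s)"
    proof -
      have "w < 2 ^ (L - s) * 2 ^ s" using uv sL by (simp flip: power_add)
      then show ?thesis by (rule less_mult_imp_div_less)
    qed
    have "key L w v < t"
    proof (rule lt)
      have "(2 ^ L - 1 - w) div 2 ^ s < (2 ^ L - 1 - u) div 2 ^ s"
        unfolding reverse_div[OF \<open>u < 2 ^ L\<close> sL] reverse_div[OF \<open>w < 2 ^ L\<close> sL]
        using s(1) wb by linarith
      then show "key L w v div 4 ^ s < key L u v div 4 ^ s"
        unfolding key_def mor_div by (intro mor_strict_mono) auto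
    qed
    then have 2: "Y k w v" using covered_complete[OF cov Y(1)] rs by blast
    have "4 ^ s dvd t" using t by simp
    have "block_row t s < block_col t s" unfolding row col using s by linarith
    from step[OF \<open>4 ^ s dvd t\<close> this, of "w div 2 ^ s"]
    have "block_closed rs (2 ^ s) (u div 2 ^ s) (w div 2 ^ s) (v div 2 ^ s) Y Y'"
      unfolding row col using s(3) by blast
    then show ?thesis unfolding block_closed_def using rs(1) 1 2 by blast
  qed
qed

lemma covered_all:
  assumes "covered (4 ^ L) Y" "base \<le> Y" "Y \<le> R"
  shows "Y = R"
proof (intro ext iffI)
  fix i u v assume *: "R i u v"
  then have "u < 2 ^ L" "v < 2 ^ L" using strict[of i u v] by auto
  then have "key L u v < 4 ^ L" unfolding key_def by (intro mor_less_power) auto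
  then show "Y i u v" using covered_complete[OF assms(1,2)] * by blast
qed (use assms(3) in \<open>auto simp: le_fun_def\<close>)

end

section \<open>Valiant's algorithm as a loop\<close>

text \<open>Scalar 6 holds the bits not yet read, scalar 7 the current power of 2; scalars 8 and 9
  collect the odd and the even bits. For want of a remainder operation, the lowest bit of
  \<open>x\<close> is computed as \<open>x - 2 * (x div 2)\<close>, the next one likewise.\<close>

definition decode_step :: com where
  "decode_step =
     Seq (Assign 9 (Plus (Var 9) (Times (Minus (Var 6) (Times (Const 2) (Div (Var 6) (Const 2)))) (Var 7))))
       (Seq (Assign 8 (Plus (Var 8) (Times (Minus (Div (Var 6) (Const 2))
           (Times (Const 2) (Div (Var 6) (Const 4)))) (Var 7))))
       (Seq (Assign 6 (Div (Var 6) (Const 4)))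
            (Assign 7 (Plus (Var 7) (Var 7)))))"

definition decode :: com where
  "decode =
     Seq (Assign 6 (Plus (Var 5) (Const 1))) (Seq (Assign 7 (Const 1))
     (Seq (Assign 8 (Const 0)) (Seq (Assign 9 (Const 0))
     (While (Less (Const 0) (Var 6))
       decode_step))))"

context matmul_prog
begin

fun prods :: "nat \<Rightarrow> nat \<Rightarrow> (nat \<times> nat \<times> nat) list \<Rightarrow> com" where
  "prods A y0 [] = Skip"
| "prods A y0 ((i, j, k) # rs) = Seq (call A (y0 + i) (y0 + j) (y0 + k)) (prods A y0 rs)"

definition block_step :: "nat \<Rightarrow> nat \<Rightarrow> (nat \<times> nat \<times> nat) list \<Rightarrow> com" where
  "block_step A y0 rs = If (Less (Var 8) (Var 9))
     (Seq (Assign 11 (Plus (Var 8) (Const 1))) (Seq (prods A y0 rs)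
     (Seq (Assign 11 (Minus (Var 9) (Const 1))) (prods A y0 rs)))) Skip"

definition level_step :: "nat \<Rightarrow> nat \<Rightarrow> (nat \<times> nat \<times> nat) list \<Rightarrow> com" where
  "level_step A y0 rs =
     Seq (Assign 6 (Div (Var 6) (Const 4)))
       (Seq (block_step A y0 rs)
       (Seq (Assign 10 (Plus (Var 10) (Var 10)))
       (Seq (Assign 8 (Div (Var 8) (Const 2)))
            (Assign 9 (Div (Var 9) (Const 2))))))"

text \<open>Scalar 6 starts at four times the position \<open>t\<close>. At the entry of round
  \<open>n\<close> it is \<open>4 * t div 4 ^ n\<close>, which is a multiple of 4 exactly if
  \<open>4 ^ n\<close> divides \<open>t\<close>: the loop test decides whether a block of size
  \<open>2 ^ n\<close> begins here. The first assignment turns the reversed row back into the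
  row.\<close>

definition levels :: "nat \<Rightarrow> nat \<Rightarrow> (nat \<times> nat \<times> nat) list \<Rightarrow> com" where
  "levels A y0 rs =
     Seq (Assign 8 (Minus (Minus (Var 1) (Const 1)) (Var 8)))
     (Seq (Assign 6 (Times (Const 4) (Plus (Var 5) (Const 1))))
     (Seq (Assign 10 (Const 1))
     (While (Not (Less (Const 0) (Minus (Var 6) (Times (Const 4) (Div (Var 6) (Const 4))))))
       (level_step A y0 rs))))"

definition closure_loop :: "nat \<Rightarrow> nat \<Rightarrow> (nat \<times> nat \<times> nat) list \<Rightarrow> com" where
  "closure_loop A y0 rs =
     For 5 (Minus (Times (Var 1) (Var 1)) (Const 1)) (Seq decode (levels A y0 rs))"

lemma notin_wvars_call:
  "x < 15 \<Longrightarrow> x \<noteq> 2 \<Longrightarrow> x \<noteq> 12 \<Longrightarrow> x \<noteq> 13 \<Longrightarrow> x \<notin> wvars (call A yi yj yk)"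
  using wvars_call[of A yi yj yk] by auto

lemma notin_wvars_prods:
  "x < 15 \<Longrightarrow> x \<noteq> 2 \<Longrightarrow> x \<noteq> 12 \<Longrightarrow> x \<noteq> 13 \<Longrightarrow> x \<notin> wvars (prods A y0 rs)"
  by (induction A y0 rs rule: prods.induct) (auto simp: notin_wvars_call)

lemma notin_wvars_block_step:
  "x < 15 \<Longrightarrow> x \<noteq> 2 \<Longrightarrow> x \<noteq> 11 \<Longrightarrow> x \<noteq> 12 \<Longrightarrow> x \<noteq> 13 \<Longrightarrow> x \<notin> wvars (block_step A y0 rs)"
  by (auto simp: block_step_def notin_wvars_prods)

lemma wvars_closure_loop: "x \<in> {0, 1, 3, 4, 14} \<Longrightarrow> x \<notin> wvars (closure_loop A y0 rs)"
  by (auto simp: closure_loop_def decode_def decode_step_def levels_def level_step_def notin_wvars_block_step)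

lemma notin_warrs_call: "a < A \<Longrightarrow> a \<noteq> yi \<Longrightarrow> a \<notin> warrs (call A yi yj yk)"
  using warrs_call[of A yi yj yk] by auto

lemma notin_warrs_prods: "a < A \<Longrightarrow> a < y0 \<Longrightarrow> a \<notin> warrs (prods A y0 rs)"
  by (induction A y0 rs rule: prods.induct) (auto simp: notin_warrs_call)

lemma notin_warrs_closure_loop: "a < A \<Longrightarrow> a < y0 \<Longrightarrow> a \<notin> warrs (closure_loop A y0 rs)"
  by (auto simp: closure_loop_def decode_def decode_step_def levels_def level_step_def block_step_def notin_warrs_prods)

definition call_time :: "nat \<Rightarrow> nat" where
  "call_time d = mq + 9 * (d * d) + \<tau> d + 10"

definition step_time :: "(nat \<times> nat \<times> nat) list \<Rightarrow> nat \<Rightarrow> nat" where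
  "step_time rs d = 2 * length rs * call_time d + 5"

text \<open>One step is charged for every scale, whether reached or not, but the products only for
  the scales whose blocks begin at \<open>t\<close>. The latter is what the amortization over all
  positions uses.\<close>

definition levels_time :: "(nat \<times> nat \<times> nat) list \<Rightarrow> nat \<Rightarrow> nat \<Rightarrow> nat" where
  "levels_time rs L t = 4 + (\<Sum>n<L. 1 + (if 4 ^ n dvd t then step_time rs (2 ^ n) + 4 else 0))"

definition loop_time :: "(nat \<times> nat \<times> nat) list \<Rightarrow> nat \<Rightarrow> nat" where
  "loop_time rs L = 2 + (\<Sum>t<4 ^ L - 1. 2 + (5 + 5 * L + levels_time rs L (Suc t)))"

end

section \<open>Correctness and cost of the loop\<close>

lemma runs_decode:
  assumes B: "bounded B s" and t: "fst s 5 = int t" "Suc t < 4 ^ L" and "4 ^ L \<le> B"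
  shows "runs B decode s (5 + 5 * L)
    (\<lambda>s'. fst s' 8 = int (od (Suc t)) \<and> fst s' 9 = int (ev (Suc t)))"
proof -
  let ?t = "Suc t"
  define I where "I n s' \<longleftrightarrow> (\<exists>x r c. 4 ^ n * x \<le> ?t \<and> fst s' 6 = int x \<and> fst s' 7 = 2 ^ n \<and>
    fst s' 8 = int r \<and> fst s' 9 = int c \<and> r + 2 ^ n * od x = od ?t \<and> c + 2 ^ n * ev x = ev ?t)"
    for n and s' :: store
  have le: "(2::nat) ^ L \<le> 4 ^ L" by (simp add: power_mono)
  have B2: "2 ^ L \<le> B" "int ?t \<le> B"
  proof -
    show "2 ^ L \<le> B" using assms(4) power_mono[of "2::int" 4 L] by simp
    have "int ?t < int (4 ^ L)" using t(2) by (simp only: of_nat_less_iff)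
    then show "int ?t \<le> B" using assms(4) by simp
  qed
  have bnd: "int (od ?t) \<le> B" "int (ev ?t) \<le> B"
  proof -
    have "int (2 ^ L) \<le> B" using B2 by simp
    moreover have "od ?t \<le> 2 ^ L" "ev ?t \<le> 2 ^ L" using od_less[OF t(2)] ev_less[OF t(2)] by simp_all
    ultimately show "int (od ?t) \<le> B" "int (ev ?t) \<le> B" by (metis of_nat_mono order_trans)+
  qed
  have "runs B decode s (1 + (1 + (1 + (1 + (1 + (\<Sum>n<L. 1 + (1 + (1 + (1 + 1)))))))))
    (\<lambda>s'. fst s' 8 = int (od ?t) \<and> fst s' 9 = int (ev ?t))"
    unfolding decode_def
  proof (intro runs_Seq runs_Assign, goal_cases)
    case 9
    show ?case
    proof (rule runs_While[where I = I], goal_cases)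
      case 1 show ?case using 9 by simp
    next
      case 2 show ?case using t unfolding I_def by (intro exI[of _ ?t] exI[of _ 0]) auto
    next
      case (3 n s)
      then obtain x r c where x: "4 ^ n * x \<le> ?t" "fst s 6 = int x" "fst s 7 = 2 ^ n"
        "fst s 8 = int r" "fst s 9 = int c" "r + 2 ^ n * od x = od ?t" "c + 2 ^ n * ev x = ev ?t"
        unfolding I_def by blast
      have "x > 0" using 3(3) x by simp
      then have "(4::nat) ^ n * 1 \<le> 4 ^ n * x" by (intro mult_le_mono2) simp
      with x(1) t(2) have "(4::nat) ^ n < 4 ^ L" by linarith
      then have nL: "n < L" by simp
      have p2: "(2::int) ^ Suc n \<le> B"
        using power_increasing[of "Suc n" L "2::int"] nL B2 by simp
      have od2: "2 ^ n * od x = (x div 2 mod 2) * 2 ^ n + 2 ^ Suc n * od (x div 4)"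
        "2 ^ n * ev x = (x mod 2) * 2 ^ n + 2 ^ Suc n * ev (x div 4)"
        unfolding od_rec[of x] ev_rec[of x] by (simp_all only: power_Suc distrib_left mult.commute mult.left_commute)
      have E: "int (r + (x div 2 mod 2) * 2 ^ n) = int r + (int x div 2 mod 2) * 2 ^ n"
        "int (c + (x mod 2) * 2 ^ n) = int c + (int x mod 2) * 2 ^ n"
        by (simp_all only: of_nat_add of_nat_mult of_nat_power of_nat_mod of_nat_div of_nat_numeral)
      have c2: "int c + (int x mod 2) * 2 ^ n \<le> B" "int r + (int x div 2 mod 2) * 2 ^ n \<le> B"
      proof -
        have "c + (x mod 2) * 2 ^ n \<le> ev ?t"
          using x(7) od2(2) by linarith
        then have "int (c + (x mod 2) * 2 ^ n) \<le> int (ev ?t)" by (rule of_nat_mono)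
        then show "int c + (int x mod 2) * 2 ^ n \<le> B" using bnd(2) unfolding E by linarith
        have "r + (x div 2 mod 2) * 2 ^ n \<le> od ?t"
          using x(6) od2(1) by linarith
        then have "int (r + (x div 2 mod 2) * 2 ^ n) \<le> int (od ?t)" by (rule of_nat_mono)
        then show "int r + (int x div 2 mod 2) * 2 ^ n \<le> B" using bnd(1) unfolding E by linarith
      qed
      have x4: "4 ^ Suc n * (x div 4) \<le> ?t"
      proof -
        have "4 ^ n * (4 * (x div 4)) \<le> 4 ^ n * x" by (intro mult_le_mono2) simp
        moreover have "4 ^ Suc n * (x div 4) = 4 ^ n * (4 * (x div 4))" by simp
        ultimately show ?thesis using x(1) by linarith
      qed
      have xB: "int x div 4 \<le> B"
      proof -
        have "1 * (x div 4) \<le> 4 ^ Suc n * (x div 4)" by (intro mult_le_mono1) simp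
        then have "x div 4 \<le> ?t" using x4 by linarith
        then have "int (x div 4) \<le> int ?t" by (simp only: of_nat_le_iff)
        then show ?thesis using B2 by (simp add: zdiv_int)
      qed
      have m1: "int x - 2 * (int x div 2) = int x mod 2" by (simp add: minus_mult_div_eq_mod)
      have "int x div 4 = int x div 2 div 2" using zdiv_zmult2_eq[of 2 "int x" 2] by simp
      then have m2: "int x div 2 - 2 * (int x div 4) = int x div 2 mod 2"
        using minus_mult_div_eq_mod[of "int x div 2" 2] by simp
      have "runs B decode_step s (1 + (1 + (1 + 1))) (I (Suc n))"
        unfolding decode_step_def
      proof (intro runs_Seq runs_Assign, goal_cases)
        case 2
        have "0 \<le> int c + int x mod 2 * 2 ^ n" by simp
        then show ?case using c2 x by (simp add: m1)
      next
        case 4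
        have "0 \<le> int r + int x div 2 mod 2 * 2 ^ n" by simp
        then show ?case using c2 x by (simp add: m2)
      next
        case 9
        have "r + (x div 2 mod 2) * 2 ^ n + 2 ^ Suc n * od (x div 4) = od ?t"
          "c + (x mod 2) * 2 ^ n + 2 ^ Suc n * ev (x div 4) = ev ?t"
          using x(6,7) od2 by linarith+
        then show ?case unfolding I_def
          by (intro exI[of _ "x div 4"] exI[of _ "r + (x div 2 mod 2) * 2 ^ n"]
              exI[of _ "c + (x mod 2) * 2 ^ n"] conjI)
            (use x4 x(2-5) in \<open>simp_all add: m1 m2 E of_nat_div del: of_nat_add of_nat_mult\<close>)
      qed (use 3 x p2 xB in auto)
      then show ?case using nL by (intro conjI)
    next
      case (4 n s)
      then show ?case unfolding I_def by auto
    qed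
  qed (use assms B2 in auto)
  then show ?thesis by (rule runs_weaken) auto
qed

text \<open>The bound \<open>4 * N * N\<close> is for the quadrupled position in
  \<open>levels\<close>. The other bound on \<open>B\<close> is the address space: at most
  \<open>N * N\<close> positions, \<open>L\<close> scales and \<open>2 * length rs\<close> calls,
  each using up \<open>2 * W + 1\<close> cells. It may be generous, for fresh cells cost no
  time.\<close>

locale valiant = matmul_prog q mq kq \<tau> + binary_system L rs base R
  for q mq kq \<tau> L rs base R +
  fixes cI y0 A N :: nat and B W :: int
  assumes N: "N = 2 ^ L"
    and rs_less: "\<And>i j k. (i, j, k) \<in> set rs \<Longrightarrow> i < cI \<and> j < cI \<and> k < cI"
    and A: "y0 + cI \<le> A"
    and W: "(int N + 3) ^ kq \<le> W" "int (N * N) \<le> W"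
    and B: "4 * int (N * N) \<le> B" "int (N * N * L * (2 * length rs)) * (2 * W + 1) \<le> B"
begin

definition state :: "(nat \<Rightarrow> nat \<Rightarrow> nat \<Rightarrow> bool) \<Rightarrow> int \<Rightarrow> store \<Rightarrow> bool" where
  "state Y F s \<longleftrightarrow> fst s 1 = int N \<and> fst s 14 = W \<and> fst s 12 = F \<and> 0 \<le> F \<and> fresh A F s \<and>
     (\<forall>i<cI. tab N (snd s (y0 + i)) (Y i))"

lemma state_upd [simp]:
  "x \<noteq> 1 \<Longrightarrow> x \<noteq> 12 \<Longrightarrow> x \<noteq> 14 \<Longrightarrow> state Y F (f(x := v), g) \<longleftrightarrow> state Y F (f, g)"
  by (auto simp: state_def fresh_def)

lemma W_nonneg: "0 \<le> W"
  using W(2) by (meson of_nat_0_le_iff order_trans)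

text \<open>Rules are applied one after the other, and a later one may see what an earlier one
  wrote. Such extra entries are sound because \<open>R\<close> is closed under the rules, so only
  the products of the initial \<open>Y\<close> have to be guaranteed.\<close>

lemma runs_prods:
  assumes "set rs' \<subseteq> set rs" "bounded B s" "state Y F s"
    and "fst s 10 = int d" "fst s 8 = int r" "fst s 9 = int c" "fst s 11 = int b"
    and d: "d > 0" "r * d + d \<le> N" "c * d + d \<le> N" "b * d + d \<le> N"
    and "F + int (length rs') * (2 * W + 1) \<le> B" and "Y \<le> R"
  shows "runs B (prods A y0 rs') s (length rs' * call_time d + 1)
    (\<lambda>s'. \<exists>Y'. state Y' (F + int (length rs') * (2 * W + 1)) s' \<and> Y \<le> Y' \<and> Y' \<le> R \<and>
       block_closed rs' d r b c Y Y')"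
  using assms(1-7,12,13)
proof (induction rs' arbitrary: s Y F)
  case Nil
  then show ?case by (auto intro!: runs_Skip[simplified] exI[of _ Y] simp: block_closed_def)
next
  case (Cons rule rs')
  obtain i j k where rule: "rule = (i, j, k)" by (cases rule)
  have ijk: "i < cI" "j < cI" "k < cI" using rs_less Cons.prems(1) rule by auto
  note st = Cons.prems(3)[unfolded state_def]
  define Y1 where "Y1 = Y(i := \<lambda>u v. Y i u v \<or>
      u div d = r \<and> v div d = c \<and> (\<exists>w. w div d = b \<and> Y j u w \<and> Y k w v))"
  have dN: "d \<le> N" using d by linarith
  have "(int d + 3) ^ kq \<le> (int N + 3) ^ kq" using dN by (intro power_mono) auto
  then have Wk: "(int d + 3) ^ kq \<le> W" using W(1) by linarith
  have "int (d * d) \<le> int (N * N)" using dN by (simp only: of_nat_le_iff mult_le_mono)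
  then have Wd: "int (d * d) \<le> W" using W(2) by linarith
  have len: "F + (2 * W + 1) + int (length rs') * (2 * W + 1) \<le> B"
    using Cons.prems(8) by (simp add: algebra_simps)
  have "int (length rs') * (2 * W + 1) \<ge> 0" using W_nonneg by simp
  then have FB: "F + 2 * W + 1 \<le> B" using len by linarith
  have "runs B (prods A y0 (rule # rs')) s ((mq + 9 * (d * d) + \<tau> d + 10) + (length rs' * call_time d + 1))
    (\<lambda>s'. \<exists>Y'. state Y' (F + int (length (rule # rs')) * (2 * W + 1)) s' \<and> Y \<le> Y' \<and> Y' \<le> R \<and>
       block_closed (rule # rs') d r b c Y Y')"
    unfolding rule prods.simps
  proof (rule runs_Seq'[OF runs_call[where N = N and F = F and W = W and r = r and b = b and c = c and d = d
        and P = "Y i" and Q = "Y j" and R = "Y k"]])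
    show "bounded B s" "fst s 10 = int d" "fst s 8 = int r" "fst s 9 = int c" "fst s 11 = int b" "d > 0"
      "r * d + d \<le> N" "c * d + d \<le> N" "b * d + d \<le> N"
      using Cons.prems d by auto
  next
    fix s1
    assume s1: "bounded B s1" and fv: "\<And>x. x \<notin> wvars (call A (y0 + i) (y0 + j) (y0 + k)) \<Longrightarrow> fst s1 x = fst s x"
      and fa: "\<And>a. a \<notin> warrs (call A (y0 + i) (y0 + j) (y0 + k)) \<Longrightarrow> snd s1 a = snd s a"
      and *: "fst s1 12 = F + 2 * W + 1 \<and> fresh A (F + 2 * W + 1) s1 \<and>
        tab N (snd s1 (y0 + i)) (\<lambda>u v. Y i u v \<or>
          u div d = r \<and> v div d = c \<and> (\<exists>w. w div d = b \<and> Y j u w \<and> Y k w v))"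
    have tab1: "tab N (snd s1 (y0 + i')) (Y1 i')" if "i' < cI" for i'
    proof (cases "i' = i")
      case False
      then have "snd s1 (y0 + i') = snd s (y0 + i')" using that A by (intro fa notin_warrs_call) auto
      then show ?thesis using False st that by (simp add: Y1_def)
    qed (use * in \<open>simp add: Y1_def\<close>)
    have st1: "state Y1 (F + (2 * W + 1)) s1"
      using st * tab1 W_nonneg by (simp add: state_def fv notin_wvars_call add.assoc)
    have Y1: "Y \<le> Y1" by (auto simp: Y1_def le_fun_def)
    have "Y1 i' u v \<Longrightarrow> R i' u v" for i' u v
      using Cons.prems(1,9) closed[of i j k] by (fastforce simp: Y1_def le_fun_def rule split: if_splits)
    then have Y1R: "Y1 \<le> R" by (auto simp: le_fun_def)
    have "runs B (prods A y0 rs') s1 (length rs' * call_time d + 1)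
      (\<lambda>s'. \<exists>Y'. state Y' (F + (2 * W + 1) + int (length rs') * (2 * W + 1)) s' \<and> Y1 \<le> Y' \<and> Y' \<le> R \<and>
         block_closed rs' d r b c Y1 Y')"
      using Cons.prems s1 st1 Y1R len by (intro Cons.IH) (auto simp: fv notin_wvars_call)
    then show "runs B (prods A y0 rs') s1 (length rs' * call_time d + 1)
      (\<lambda>s'. \<exists>Y'. state Y' (F + int (length ((i, j, k) # rs')) * (2 * W + 1)) s' \<and> Y \<le> Y' \<and> Y' \<le> R \<and>
         block_closed ((i, j, k) # rs') d r b c Y Y')"
    proof (rule runs_weaken)
      fix s' assume "\<exists>Y'. state Y' (F + (2 * W + 1) + int (length rs') * (2 * W + 1)) s' \<and> Y1 \<le> Y' \<and> Y' \<le> R \<and>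
         block_closed rs' d r b c Y1 Y'"
      then obtain Y' where Y': "state Y' (F + (2 * W + 1) + int (length rs') * (2 * W + 1)) s'" "Y1 \<le> Y'" "Y' \<le> R"
        "block_closed rs' d r b c Y1 Y'" by blast
      have "Y' i u v" if "u div d = r" "w div d = b" "v div d = c" "Y j u w" "Y k w v" for u w v
      proof -
        have "Y1 i u v" using that by (auto simp: Y1_def)
        then show ?thesis using Y'(2) by (auto simp: le_fun_def)
      qed
      moreover have "Y' i' u v" if "(i', j', k') \<in> set rs'" "u div d = r" "w div d = b" "v div d = c"
        "Y j' u w" "Y k' w v" for i' j' k' u w v
      proof -
        have "Y1 j' u w" "Y1 k' w v" using Y1 that by (auto simp: le_fun_def)
        then show ?thesis using Y'(4) that(1-4) unfolding block_closed_def by blast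
      qed
      ultimately have "block_closed ((i, j, k) # rs') d r b c Y Y'"
        unfolding block_closed_def by auto
      moreover have "F + (2 * W + 1) + int (length rs') * (2 * W + 1) =
        F + int (length ((i, j, k) # rs')) * (2 * W + 1)"
        by (simp add: algebra_simps)
      ultimately show "\<exists>Y'. state Y' (F + int (length ((i, j, k) # rs')) * (2 * W + 1)) s' \<and> Y \<le> Y' \<and> Y' \<le> R \<and>
         block_closed ((i, j, k) # rs') d r b c Y Y'"
        using Y' Y1 by (metis order_trans)
    qed simp
  qed (use st ijk A Wk Wd FB in \<open>auto\<close>)
  then show ?case by (rule runs_weaken) (auto simp: call_time_def)
qed

lemma block_closed_mono: "block_closed rs' d r b c Y Y' \<Longrightarrow> X \<le> Y \<Longrightarrow> Y' \<le> Z \<Longrightarrow> block_closed rs' d r b c X Z"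
  unfolding block_closed_def le_fun_def le_bool_def by blast

text \<open>For \<open>c = r + 1\<close> the two middle blocks are \<open>c\<close> and
  \<open>r\<close> themselves, whose operand blocks may be incomplete. These products remain within
  \<open>R\<close>, so the program need not single out this case.\<close>

lemma runs_block_step:
  assumes "bounded B s" "state Y F s" "fst s 10 = int d" "fst s 8 = int r" "fst s 9 = int c"
    and d: "d > 0" "r * d + d \<le> N" "c * d + d \<le> N"
    and F: "F + int (2 * length rs) * (2 * W + 1) \<le> B" and Y: "Y \<le> R"
  shows "runs B (block_step A y0 rs) s (step_time rs d)
    (\<lambda>s'. \<exists>Y' F'. state Y' F' s' \<and> F' \<le> F + int (2 * length rs) * (2 * W + 1) \<and> Y \<le> Y' \<and> Y' \<le> R \<and>
       (\<forall>b. r < c \<longrightarrow> b = r + 1 \<or> b = c - 1 \<longrightarrow> block_closed rs d r b c Y Y'))"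
proof -
  let ?E = "int (length rs) * (2 * W + 1)"
  have E: "0 \<le> ?E" using W_nonneg by simp
  have F2: "F + ?E + ?E \<le> B" using F by (simp add: algebra_simps)
  have dd: "int N \<le> B"
  proof -
    have "int N \<le> int (N * N)" by (cases N) auto
    then show ?thesis using B(1) by linarith
  qed
  have rc: "int r + 1 \<le> B" "int c \<le> B"
  proof -
    have "r * 1 \<le> r * d" "c * 1 \<le> c * d" using d by (simp_all only: mult_le_mono2)
    then have "r + 1 \<le> N" "c \<le> N" using d by linarith+
    then show "int r + 1 \<le> B" "int c \<le> B" using dd by linarith+
  qed
  define Q where "Q = (\<lambda>s'. \<exists>Y' F'. state Y' F' s' \<and> F' \<le> F + int (2 * length rs) * (2 * W + 1) \<and> Y \<le> Y' \<and> Y' \<le> R \<and>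
       (\<forall>b. r < c \<longrightarrow> b = r + 1 \<or> b = c - 1 \<longrightarrow> block_closed rs d r b c Y Y'))"
  let ?P = "length rs * call_time d + 1"
  have "runs B (block_step A y0 rs) s (1 + (1 + (?P + (1 + ?P)))) Q"
    unfolding block_step_def
  proof (rule runs_If)
    show "bounded B s" by fact
  next
    assume "bval (Less (Var 8) (Var 9)) s"
    then have lt: "r < c" using assms by simp
    have bd: "(r + 1) * d + d \<le> N" "(c - 1) * d + d \<le> N"
    proof -
      have "(r + 1) * d \<le> c * d" using lt by (intro mult_le_mono1) simp
      then show "(r + 1) * d + d \<le> N" using d by linarith
      have "(c - 1) * d \<le> c * d" by (intro mult_le_mono1) simp
      then show "(c - 1) * d + d \<le> N" using d by linarith
    qed
    show "runs B (Seq (Assign 11 (Plus (Var 8) (Const 1))) (Seq (prods A y0 rs)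
      (Seq (Assign 11 (Minus (Var 9) (Const 1))) (prods A y0 rs)))) s (1 + (?P + (1 + ?P))) Q"
    proof (rule runs_Seq, rule runs_Assign, goal_cases)
      case 3
      let ?s1 = "((fst s)(11 := aval (Plus (Var 8) (Const 1)) s), snd s)"
      have "runs B (prods A y0 rs) ?s1 ?P (\<lambda>s'. \<exists>Y'. state Y' (F + ?E) s' \<and> Y \<le> Y' \<and> Y' \<le> R \<and>
        block_closed rs d r (r + 1) c Y Y')"
        by (rule runs_prods) (use 3 assms bd F2 E in auto)
      then show ?case
      proof (rule runs_Seq', goal_cases)
        case (1 s2)
        then obtain Y2 where Y2: "state Y2 (F + ?E) s2" "Y \<le> Y2" "Y2 \<le> R"
          "block_closed rs d r (r + 1) c Y Y2" by blast
        have v2: "fst s2 10 = int d" "fst s2 8 = int r" "fst s2 9 = int c"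
          using 1(2) assms by (auto simp: notin_wvars_prods)
        show ?case
        proof (rule runs_Seq, rule runs_Assign, goal_cases)
          case 3
          let ?s3 = "((fst s2)(11 := aval (Minus (Var 9) (Const 1)) s2), snd s2)"
          have "runs B (prods A y0 rs) ?s3 ?P (\<lambda>s'. \<exists>Y'. state Y' (F + ?E + ?E) s' \<and> Y2 \<le> Y' \<and> Y' \<le> R \<and>
            block_closed rs d r (c - 1) c Y2 Y')"
            by (rule runs_prods) (use 3 v2 Y2 bd F2 d lt in \<open>auto simp: of_nat_diff\<close>)
          then show ?case
          proof (rule runs_weaken, goal_cases)
            case (2 s4)
            then obtain Y4 where Y4: "state Y4 (F + ?E + ?E) s4" "Y2 \<le> Y4" "Y4 \<le> R"
              "block_closed rs d r (c - 1) c Y2 Y4" by blast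
            have "block_closed rs d r (r + 1) c Y Y4"
              by (rule block_closed_mono[OF Y2(4) order_refl Y4(2)])
            moreover have "block_closed rs d r (c - 1) c Y Y4"
              by (rule block_closed_mono[OF Y4(4) Y2(2) order_refl])
            moreover have "F + ?E + ?E \<le> F + int (2 * length rs) * (2 * W + 1)"
              by (simp add: algebra_simps)
            ultimately show ?case unfolding Q_def using Y4(1,3) order_trans[OF Y2(2) Y4(2)] by blast
          qed simp
        qed (use 1 v2 rc in auto)
      qed
    qed (use assms rc in auto)
  next
    assume "\<not> bval (Less (Var 8) (Var 9)) s"
    then have "\<not> r < c" using assms by simp
    moreover have "F \<le> F + int (2 * length rs) * (2 * W + 1)" using W_nonneg by simp
    ultimately have "Q s" unfolding Q_def using assms by blast
    then have "runs B Skip s 1 Q" using assms by (intro runs_Skip)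
    then show "runs B Skip s (1 + (?P + (1 + ?P))) Q" by (rule runs_weaken) auto
  qed
  then show ?thesis unfolding Q_def by (rule runs_weaken) (auto simp: step_time_def)
qed

lemma block_fits:
  assumes "x < 2 ^ L" "n \<le> L"
  shows "x div 2 ^ n * 2 ^ n + 2 ^ n \<le> N"
proof -
  have L: "(2::nat) ^ L = 2 ^ (L - n) * 2 ^ n" using assms(2) by (simp flip: power_add)
  then have "x div 2 ^ n < 2 ^ (L - n)" using assms(1) by (simp add: less_mult_imp_div_less)
  then have "Suc (x div 2 ^ n) * 2 ^ n \<le> 2 ^ (L - n) * 2 ^ n" by (intro mult_le_mono1) simp
  then show ?thesis using N L by simp
qed

lemma N4: "4 ^ L = N * N"
proof -
  have "(4::nat) ^ L = (2 * 2) ^ L" by simp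
  also have "\<dots> = 2 ^ L * 2 ^ L" by (rule power_mult_distrib)
  finally show ?thesis unfolding N .
qed

lemma N_le_B: "int N \<le> B"
proof -
  have "int N \<le> int (N * N)" by (cases N) auto
  then show ?thesis using B(1) by linarith
qed

text \<open>Several blocks may begin at the same position. Each scale is only required to handle the
  tables as they were on entry, which is all that \<open>covered_Suc\<close> asks for; the smaller
  scales treated before can only have added entries.\<close>

lemma runs_levels:
  assumes "bounded B s" "state Y F s" "Y \<le> R" and t: "0 < t" "t < 4 ^ L"
    and "fst s 5 + 1 = int t" "fst s 8 = int (od t)" "fst s 9 = int (ev t)"
    and FB: "F + int (L * (2 * length rs)) * (2 * W + 1) \<le> B"
  shows "runs B (levels A y0 rs) s (levels_time rs L t)
    (\<lambda>s'. \<exists>Y' F'. state Y' F' s' \<and> F' \<le> F + int (L * (2 * length rs)) * (2 * W + 1) \<and> Y \<le> Y' \<and> Y' \<le> R \<and>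
       (\<forall>n b. 4 ^ n dvd t \<longrightarrow> block_row t n < block_col t n \<longrightarrow>
          b = block_row t n + 1 \<or> b = block_col t n - 1 \<longrightarrow>
          block_closed rs (2 ^ n) (block_row t n) b (block_col t n) Y Y'))"
proof -
  define C where "C = int (2 * length rs) * (2 * W + 1)"
  have C: "0 \<le> C" using W_nonneg by (simp add: C_def)
  have LC: "int (L * (2 * length rs)) * (2 * W + 1) = int L * C"
    by (simp only: C_def of_nat_mult mult.assoc)
  have N1: "1 \<le> N" unfolding N by simp
  note od = od_less[OF t(2)] ev_less[OF t(2)]
  define Q where "Q Y' = (\<lambda>n. \<forall>b. block_row t n < block_col t n \<longrightarrow>
          b = block_row t n + 1 \<or> b = block_col t n - 1 \<longrightarrow>
          block_closed rs (2 ^ n) (block_row t n) b (block_col t n) Y Y')" for Y'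
  have Q_mono: "Q Y1 n \<Longrightarrow> Y1 \<le> Y2 \<Longrightarrow> Q Y2 n" for Y1 Y2 n
    unfolding Q_def by (auto intro: block_closed_mono[OF _ order_refl])
  define I where "I n s' \<longleftrightarrow> 4 ^ n dvd 4 * t \<and> fst s' 6 = int (4 * t div 4 ^ n) \<and> fst s' 10 = int (2 ^ n) \<and>
    fst s' 8 = int (block_row t n) \<and> fst s' 9 = int (block_col t n) \<and>
    (\<exists>Y' F'. state Y' F' s' \<and> F' \<le> F + int n * C \<and> Y \<le> Y' \<and> Y' \<le> R \<and> (\<forall>n'<n. Q Y' n'))"
    for n and s' :: store
  have dvd_less: "n < L" if "4 ^ n dvd t" for n
  proof -
    have "(4::nat) ^ n < 4 ^ L" using dvd_imp_le[OF that t(1)] t(2) by linarith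
    then show ?thesis by simp
  qed
  have "runs B (levels A y0 rs) s (1 + (1 + (1 + (1 + (\<Sum>n<L. 1 + (if 4 ^ n dvd t then step_time rs (2 ^ n) + 4 else 0))))))
    (\<lambda>s'. \<exists>Y' F'. state Y' F' s' \<and> F' \<le> F + int L * C \<and> Y \<le> Y' \<and> Y' \<le> R \<and> (\<forall>n. 4 ^ n dvd t \<longrightarrow> Q Y' n))"
    unfolding levels_def
  proof (intro runs_Seq runs_Assign, goal_cases)
    case 1 show ?case by fact
  next
    case 2
    have "od t < N" using od N by simp
    then have "\<bar>int N - 1 - int (od t)\<bar> \<le> int N" by linarith
    then show ?case using assms N_le_B by (auto simp: state_def)
  next
    case 3 then show ?case by simp
  next
    case 4
    have "4 * t \<le> 4 * (N * N)" using t(2) N4 by linarith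
    then have "int (4 * t) \<le> int (4 * (N * N))" by (rule of_nat_mono)
    then show ?case using assms B(1) by simp
  next
    case 5 then show ?case by simp
  next
    case 6 show ?case using N_le_B N1 by simp
  next
    case 7
    show ?case
    proof (rule runs_While[where I = I], goal_cases)
      case 1 show ?case using 7 by simp
    next
      case 2
      have "int N - 1 - int (od t) = int (2 ^ L - 1 - od t)" using od unfolding N by linarith
      then show ?case using assms unfolding I_def
        by (auto simp: block_row_def block_col_def state_def fresh_def intro!: exI[of _ Y] exI[of _ F])
    next
      case (3 n s)
      then obtain Y1 F1 where I: "4 ^ n dvd 4 * t" "fst s 6 = int (4 * t div 4 ^ n)" "fst s 10 = int (2 ^ n)"
        "fst s 8 = int (block_row t n)" "fst s 9 = int (block_col t n)"
        "state Y1 F1 s" "F1 \<le> F + int n * C" "Y \<le> Y1" "Y1 \<le> R" "\<forall>n'<n. Q Y1 n'"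
        unfolding I_def by blast
      define x where "x = 4 * t div 4 ^ n"
      have "int x - 4 * (int x div 4) \<le> 0" using 3(3) I by (simp add: x_def)
      then have "int x mod 4 = 0"
        using pos_mod_sign[of 4 "int x"] by (simp add: minus_mult_div_eq_mod)
      then have "x mod 4 = 0" using zmod_int[of x 4] by simp
      then obtain y where y: "x = 4 * y" by auto
      have "4 * t = 4 ^ n * x" using I(1) by (simp add: x_def)
      then have ty: "t = 4 ^ n * y" using y by simp
      then have n: "4 ^ n dvd t" by simp
      then have nL: "n < L" by (rule dvd_less)
      have fit: "block_row t n * 2 ^ n + 2 ^ n \<le> N" "block_col t n * 2 ^ n + 2 ^ n \<le> N"
        unfolding block_row_def block_col_def using nL od by (auto intro!: block_fits)
      have Fn: "F1 + C \<le> F + int (Suc n) * C" using I(7) by (simp add: algebra_simps)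
      moreover have "int (Suc n) * C \<le> int L * C" using nL C by (intro mult_right_mono) auto
      ultimately have F1B: "F1 + C \<le> B" using FB LC by linarith
      have sB: "int (2 ^ Suc n) \<le> B"
      proof -
        have "(2::nat) ^ Suc n \<le> 2 ^ L" using nL by (intro power_increasing) auto
        then have "int (2 ^ Suc n) \<le> int N" unfolding N by (simp only: of_nat_le_iff)
        then show ?thesis using N_le_B by linarith
      qed
      have rcB: "int (block_row t n) \<le> B" "int (block_col t n) \<le> B"
      proof -
        have "block_row t n * 1 \<le> block_row t n * 2 ^ n" "block_col t n * 1 \<le> block_col t n * 2 ^ n"
          by (intro mult_le_mono2; simp)+
        then have "block_row t n \<le> N" "block_col t n \<le> N" using fit by linarith+
        then show "int (block_row t n) \<le> B" "int (block_col t n) \<le> B" using N_le_B by linarith+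
      qed
      have yB: "int y \<le> B"
      proof -
        have "y \<le> t" using ty by simp
        then have "y \<le> N * N" using t(2) unfolding N4 by linarith
        then have "int y \<le> int (N * N)" by (simp only: of_nat_le_iff)
        then show ?thesis using B(1) by linarith
      qed
      define I' where "I' s' \<longleftrightarrow> (\<exists>Y' F'. state Y' F' s' \<and> F' \<le> F + int (Suc n) * C \<and> Y \<le> Y' \<and> Y' \<le> R \<and>
        (\<forall>n'<Suc n. Q Y' n'))" for s'
      have "runs B (level_step A y0 rs) s
        (1 + (step_time rs (2 ^ n) + (1 + (1 + 1)))) (I (Suc n))"
        unfolding level_step_def
      proof (rule runs_Seq, rule runs_Assign, goal_cases)
        case 1 show ?case by fact
      next
        case 2 show ?case using I yB y by (simp add: x_def)
      next
        case 3
        have x6: "aval (Div (Var 6) (Const 4)) s = int y" using I y by (simp add: x_def)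
        let ?s1 = "((fst s)(6 := int y), snd s)"
        have "runs B (block_step A y0 rs) ?s1 (step_time rs (2 ^ n))
          (\<lambda>s'. \<exists>Y' F'. state Y' F' s' \<and> F' \<le> F1 + int (2 * length rs) * (2 * W + 1) \<and> Y1 \<le> Y' \<and> Y' \<le> R \<and>
           (\<forall>b. block_row t n < block_col t n \<longrightarrow> b = block_row t n + 1 \<or> b = block_col t n - 1 \<longrightarrow>
              block_closed rs (2 ^ n) (block_row t n) b (block_col t n) Y1 Y'))"
          by (rule runs_block_step) (use 3[unfolded x6] I fit F1B in \<open>auto simp: C_def\<close>)
        then show ?case unfolding x6
        proof (rule runs_Seq', goal_cases)
          case (1 s2)
          then obtain Y2 F2 where Y2: "state Y2 F2 s2" "F2 \<le> F1 + C" "Y1 \<le> Y2" "Y2 \<le> R"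
            "\<And>b. block_row t n < block_col t n \<Longrightarrow> b = block_row t n + 1 \<or> b = block_col t n - 1 \<Longrightarrow>
              block_closed rs (2 ^ n) (block_row t n) b (block_col t n) Y1 Y2"
            unfolding C_def by blast
          have "Q Y2 n" unfolding Q_def by (auto intro: block_closed_mono[OF Y2(5) I(8) order_refl])
          then have I2: "I' s2" unfolding I'_def
            using Y2 Q_mono[OF _ Y2(3)] I(10) order_trans[OF Y2(2) Fn] order_trans[OF I(8) Y2(3)]
            by (intro exI[of _ Y2] exI[of _ F2]) (auto simp: less_Suc_eq)
          have v2: "fst s2 6 = int y" "fst s2 10 = int (2 ^ n)" "fst s2 8 = int (block_row t n)"
            "fst s2 9 = int (block_col t n)"
            using 1(2) I by (auto simp: notin_wvars_block_step)
          have y': "4 * t div 4 ^ Suc n = y" "4 ^ Suc n dvd 4 * t" using ty by simp_all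
          have "int (block_row t n) div 2 \<le> B" "int (block_col t n) div 2 \<le> B"
            using rcB abs_div_le[of "int (block_row t n)" 2] abs_div_le[of "int (block_col t n)" 2] by linarith+
          note * = this
          show ?case
          proof (intro runs_Seq runs_Assign, goal_cases)
            case 7
            show ?case unfolding I_def using I2 v2 y'
              by (auto simp: I'_def block_row_def block_col_def zdiv_int div_mult2_eq power_Suc2 simp del: power_Suc)
          qed (use 1 v2 sB * in auto)
        qed
      qed
      then have "runs B (level_step A y0 rs) s
        (if 4 ^ n dvd t then step_time rs (2 ^ n) + 4 else 0) (I (Suc n))"
        by (rule runs_weaken) (use n in auto)
      then show ?case using nL by (intro conjI)
    next
      case (4 n s)
      then obtain Y1 F1 where I: "4 ^ n dvd 4 * t" "fst s 6 = int (4 * t div 4 ^ n)"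
        "state Y1 F1 s" "F1 \<le> F + int n * C" "Y \<le> Y1" "Y1 \<le> R" "\<forall>n'<n. Q Y1 n'"
        unfolding I_def by blast
      have "n' < n" if "4 ^ n' dvd t" for n'
      proof (rule ccontr)
        assume "\<not> n' < n"
        then have "4 ^ n dvd t" using that by (meson dvd_trans le_imp_power_dvd not_less)
        then obtain y where "t = 4 ^ n * y" by blast
        then have "4 * t div 4 ^ n = 4 * y" by simp
        then show False using 4(3) I(2) by simp
      qed
      moreover have "n \<le> L"
      proof (cases n)
        case (Suc n')
        then have "4 ^ n' dvd t" using I(1) by simp
        from dvd_less[OF this] show ?thesis using Suc by linarith
      qed simp
      then have "int n * C \<le> int L * C" using C by (intro mult_right_mono) auto
      then have "F1 \<le> F + int L * C" using I(4) by linarith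
      ultimately show ?case using I by blast
    qed
  qed
  then show ?thesis unfolding LC
    by (rule runs_weaken) (auto simp: levels_time_def Q_def)
qed

lemma runs_closure_loop:
  assumes "bounded B s" "state base 0 s"
  shows "runs B (closure_loop A y0 rs) s (loop_time rs L) (\<lambda>s'. \<exists>F. state R F s')"
proof -
  define C where "C = int (L * (2 * length rs)) * (2 * W + 1)"
  have C: "0 \<le> C" using W_nonneg by (simp add: C_def)
  have N1: "1 \<le> N" unfolding N by simp
  then have NN: "1 \<le> N * N" by (cases N) auto
  have NC: "int (N * N) * C \<le> B" using B(2) by (simp add: C_def mult.assoc)
  \<comment> \<open>After \<open>t\<close> rounds the positions up to \<open>t\<close> are done,
    position 0 being free. Each round uses up at most \<open>C\<close> fresh cells.\<close>
  define I where "I t s' \<longleftrightarrow> (\<exists>Y F. state Y F s' \<and> F \<le> int t * C \<and> base \<le> Y \<and> Y \<le> R \<and> covered (Suc t) Y)"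
    for t s'
  show ?thesis
    unfolding closure_loop_def loop_time_def N4
  proof (rule runs_For[where I = I and h = "N * N - 1"], goal_cases)
    case 1 show ?case by fact
  next
    case 2
    have "int (N * N - 1) \<le> int (N * N)" by (rule of_nat_mono) simp
    then show ?case using B(1) by linarith
  next
    case 3
    show ?case unfolding I_def using assms covered_1 base
      by (intro exI[of _ base] exI[of _ 0]) auto
  next
    case (4 i s)
    then show ?case using NN by (auto simp: I_def state_def of_nat_diff)
  next
    case (5 t s)
    then obtain Y F where Y: "state Y F s" "F \<le> int t * C" "base \<le> Y" "Y \<le> R" "covered (Suc t) Y"
      unfolding I_def by blast
    have t: "Suc t < 4 ^ L" using 5(2) N4 by linarith
    have "4 ^ L \<le> B"
    proof -
      have "(4::int) ^ L = int (4 ^ L)" by simp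
      also have "\<dots> = int (N * N)" by (simp only: N4)
      finally show ?thesis using B(1) by linarith
    qed
    have FC: "F + C \<le> int (Suc t) * C" using Y(2) by (simp add: algebra_simps)
    have "int (Suc t) * C \<le> int (N * N) * C"
      using 5(2) C by (intro mult_right_mono of_nat_mono) auto
    with FC NC have FB: "F + C \<le> B" by linarith
    show ?case
    proof (rule runs_Seq, rule runs_weaken[OF runs_decode[OF 5(1,4) t \<open>4 ^ L \<le> B\<close>]], goal_cases)
      case (2 s1)
      have fv: "fst s1 x = fst s x" if "x \<in> {1, 5, 12, 14}" for x
        using 2(2)[of x] that by (auto simp: decode_def decode_step_def)
      have fa: "snd s1 = snd s" using 2(3) by (auto simp: decode_def decode_step_def)
      have "state Y F s1" using Y(1) fv fa by (simp add: state_def fresh_def)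
      from runs_levels[OF 2(1) this Y(4) _ t] show ?case
      proof (rule runs_weaken, goal_cases)
        case (7 s2)
        then obtain Y' F' where Y': "state Y' F' s2" "F' \<le> F + C" "Y \<le> Y'" "Y' \<le> R"
          "\<And>n b. 4 ^ n dvd Suc t \<Longrightarrow> block_row (Suc t) n < block_col (Suc t) n \<Longrightarrow>
          b = block_row (Suc t) n + 1 \<or> b = block_col (Suc t) n - 1 \<Longrightarrow>
          block_closed rs (2 ^ n) (block_row (Suc t) n) b (block_col (Suc t) n) Y Y'"
          unfolding C_def by blast
        have "covered (Suc (Suc t)) Y'" by (rule covered_Suc[OF Y(5,3) Y'(3,5)])
        moreover have "fst s2 5 = int t"
          using 7(2)[of 5] fv[of 5] 5(4) by (auto simp: levels_def level_step_def notin_wvars_block_step)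
        ultimately show ?case unfolding I_def
          using Y' order_trans[OF Y(3) Y'(3)] order_trans[OF Y'(2) FC] by auto
      qed (use 2(4) fv[of 5] 5(4) FB in \<open>auto simp: C_def\<close>)
    qed simp
  next
    case (6 s)
    then obtain Y F where Y: "state Y F s" "base \<le> Y" "Y \<le> R" "covered (N * N) Y"
      using NN unfolding I_def by auto
    then show ?case using covered_all[of Y] by (auto simp: N4)
  qed
qed

end

section \<open>The matrix multiplication exponent\<close>

text \<open>Only \<open>Store\<close> alters an array, one cell per step; in sequences and loops the
  sets of altered cells unite. A program therefore cannot write a large output quickly.\<close>

lemma exec_changes:
  "exec W c s t s' \<Longrightarrow> finite {i. snd s' a i \<noteq> snd s a i} \<and> card {i. snd s' a i \<noteq> snd s a i} \<le> t"
proof (induction rule: exec.induct)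
  case (Store i s e b)
  have "{j. ((snd s)(b := (snd s b)(aval i s := aval e s))) a j \<noteq> snd s a j} \<subseteq> {aval i s}" by auto
  from finite_subset[OF this] card_mono[OF _ this] show ?case by simp
next
  case (Seq c1 s t1 s1 c2 t2 s2)
  let ?D = "\<lambda>s s'. {i. snd s' a i \<noteq> snd s a i}"
  have sub: "?D s s2 \<subseteq> ?D s s1 \<union> ?D s1 s2" by auto
  have fin: "finite (?D s s1 \<union> ?D s1 s2)" using Seq.IH by blast
  have "card (?D s s2) \<le> card (?D s s1) + card (?D s1 s2)"
    using card_mono[OF fin sub] card_Un_le[of "?D s s1" "?D s1 s2"] by linarith
  then show ?case using Seq.IH finite_subset[OF sub fin] by linarith
next
  case (WhileTrue b s c t1 s1 t2 s2)
  let ?D = "\<lambda>s s'. {i. snd s' a i \<noteq> snd s a i}"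
  have sub: "?D s s2 \<subseteq> ?D s s1 \<union> ?D s1 s2" by auto
  have fin: "finite (?D s s1 \<union> ?D s1 s2)" using WhileTrue.IH by blast
  have "card (?D s s2) \<le> card (?D s s1) + card (?D s1 s2)"
    using card_mono[OF fin sub] card_Un_le[of "?D s s1" "?D s1 s2"] by linarith
  then show ?case using WhileTrue.IH finite_subset[OF sub fin] by linarith
qed auto

text \<open>The square of the all-ones matrix has no zero entry, and a run changes at most one cell per step.\<close>

lemma multiplies_matrices_time_ge:
  assumes "multiplies_matrices_within p T"
  shows "real (n * n) \<le> T n"
proof -
  define A :: "int mat" where "A = mat n n (\<lambda>_. 1)"
  have A: "A \<in> carrier_mat n n" by (simp add: A_def)
  obtain k where *: "\<forall>n M. \<forall>A \<in> carrier_mat n n. \<forall>B \<in> carrier_mat n n.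
        (\<forall>i<n. \<forall>j<n. \<bar>A $$ (i, j)\<bar> \<le> int M \<and> \<bar>B $$ (i, j)\<bar> \<le> int M) \<longrightarrow>
        (\<exists>t s. exec (int ((n + M + 2) ^ k)) p (matmul_input n A B) t s \<and>
           real t \<le> T n \<and>
           (\<forall>i<n. \<forall>j<n. output_table n s i j = (A * B) $$ (i, j)))"
    using assms unfolding multiplies_matrices_within_def ..
  have "\<forall>i<n. \<forall>j<n. \<bar>A $$ (i, j)\<bar> \<le> int 1 \<and> \<bar>A $$ (i, j)\<bar> \<le> int 1"
    by (simp add: A_def)
  from *[THEN spec, THEN spec, THEN bspec, OF A, THEN bspec, OF A, THEN mp, OF this]
  obtain t s where ts: "exec (int ((n + 1 + 2) ^ k)) p (matmul_input n A A) t s" "real t \<le> T n"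
    and out: "\<forall>i<n. \<forall>j<n. output_table n s i j = (A * A) $$ (i, j)"
    by (elim exE conjE)
  let ?D = "{i. snd s 0 i \<noteq> snd (matmul_input n A A) 0 i}"
  have "(\<lambda>x. int x) ` {..<n * n} \<subseteq> ?D"
  proof
    fix y assume "y \<in> int ` {..<n * n}"
    then obtain x where x: "x < n * n" "y = int x" by auto
    then have n: "0 < n" by (cases n) auto
    have d: "x div n < n" "x mod n < n" using x n by (simp_all add: less_mult_imp_div_less)
    have "output_table n s (x div n) (x mod n) = (A * A) $$ (x div n, x mod n)" using d out by simp
    also have "\<dots> = int n" using d by (simp add: A_def scalar_prod_def)
    finally have "snd s 0 y = int n" unfolding output_table_def div_mult_mod_eq x(2) .
    then show "y \<in> ?D" using n by (simp add: matmul_input_def)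
  qed
  from card_mono[OF _ this] exec_changes[OF ts(1), of 0] have "card (int ` {..<n * n}) \<le> t" by linarith
  then have "n * n \<le> t" by (simp add: card_image)
  then have "real (n * n) \<le> real t" by (simp only: of_nat_le_iff)
  then show ?thesis using ts(2) by linarith
qed

text \<open>This yields \<open>\<omega> \<ge> 2\<close>, so that every exponent above
  \<open>\<omega>\<close> exceeds 2, as the geometric series requires.\<close>

lemma matmul_exponents_ge_2:
  assumes "c \<in> matmul_exponents"
  shows "2 \<le> c"
proof -
  obtain p T where T: "multiplies_matrices_within p T" "T \<in> O(\<lambda>n. real n powr c)"
    using assms by (auto simp: matmul_exponents_def)
  have "(\<lambda>n. real n powr 2) \<in> O(T)"
  proof (rule landau_o.big_mono, intro always_eventually allI)
    fix n
    have "real n powr 2 = real (n * n)" by (cases "n = 0") (simp_all add: powr_numeral power2_eq_square)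
    also have "\<dots> \<le> T n" by (rule multiplies_matrices_time_ge[OF T(1)])
    finally show "norm (real n powr 2) \<le> norm (T n)" by simp
  qed
  then have "(\<lambda>n. real n powr 2) \<in> O(\<lambda>n. real n powr c)"
    using T(2) by (rule landau_o.big_trans)
  then show ?thesis using powr_bigo_iff[OF filterlim_real_sequentially, of 2 c] by simp
qed

text \<open>The schoolbook algorithm shows that some exponent exists at all; otherwise the infimum
  \<open>\<omega>\<close> would say nothing.\<close>

definition naive_matmul :: com where
  "naive_matmul = For 1 (Times (Var 0) (Var 0)) (Seq (Assign 3 (Const 0))
     (Seq (For 2 (Var 0) (Assign 3 (Plus (Var 3) (Times
         (Arr 1 (Plus (Times (Div (Var 1) (Var 0)) (Var 0)) (Var 2)))
         (Arr 2 (Plus (Times (Var 2) (Var 0))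
            (Minus (Var 1) (Times (Div (Var 1) (Var 0)) (Var 0)))))))))
       (Store 0 (Var 1) (Var 3))))"

text \<open>The cube of \<open>n + M + 2\<close> dominates both \<open>n * n\<close>, for the loop
  counters, and \<open>n * M * M\<close>, for the partial sums.\<close>

lemma runs_naive_matmul:
  assumes C: "C \<in> carrier_mat n n" and D: "D \<in> carrier_mat n n"
    and M: "\<And>i j. i < n \<Longrightarrow> j < n \<Longrightarrow> \<bar>C $$ (i, j)\<bar> \<le> int M \<and> \<bar>D $$ (i, j)\<bar> \<le> int M"
  shows "runs (int ((n + M + 2) ^ 3)) naive_matmul (matmul_input n C D)
    (2 + n * n * (6 + 3 * n)) (\<lambda>s. \<forall>i<n. \<forall>j<n. output_table n s i j = (C * D) $$ (i, j))"
proof -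
  define B where "B = int ((n + M + 2) ^ 3)"
  define e where "e x w = C $$ (x div n, w) * D $$ (w, x mod n)" for x w
  have pow: "(n + M + 2) ^ 3 = (n + M + 2) * ((n + M + 2) * (n + M + 2))"
    by (simp add: power3_eq_cube)
  have nB: "n * n \<le> (n + M + 2) ^ 3" "M \<le> (n + M + 2) ^ 3" "n * (M * M) \<le> (n + M + 2) ^ 3"
  proof -
    have "1 * (n * n) \<le> (n + M + 2) * ((n + M + 2) * (n + M + 2))" by (intro mult_le_mono) auto
    then show "n * n \<le> (n + M + 2) ^ 3" by (simp only: pow mult_1)
    have "1 * (1 * M) \<le> (n + M + 2) * ((n + M + 2) * (n + M + 2))" by (intro mult_le_mono) auto
    then show "M \<le> (n + M + 2) ^ 3" by (simp only: pow mult_1)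
    show "n * (M * M) \<le> (n + M + 2) ^ 3" unfolding pow by (intro mult_le_mono) auto
  qed
  have NB: "int (n * n) \<le> B" "int M \<le> B" "int (n * (M * M)) \<le> B" "int n \<le> B"
  proof -
    show "int (n * n) \<le> B" "int M \<le> B" "int (n * (M * M)) \<le> B"
      unfolding B_def using nB by (simp_all only: of_nat_le_iff)
    have "int n \<le> int (n * n)" by (cases n) auto
    then show "int n \<le> B" using \<open>int (n * n) \<le> B\<close> by linarith
  qed
  have e: "\<bar>e x w\<bar> \<le> int (M * M)" if "x < n * n" "w < n" for x w
  proof -
    have n: "0 < n" using that by auto
    have "x div n < n" "x mod n < n" using that n by (simp_all add: less_mult_imp_div_less)
    then have "\<bar>C $$ (x div n, w)\<bar> * \<bar>D $$ (w, x mod n)\<bar> \<le> int M * int M"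
      using M that by (intro mult_mono) auto
    then show ?thesis by (simp add: e_def abs_mult)
  qed
  have sum_e: "\<bar>\<Sum>w<j. e x w\<bar> \<le> B" if "x < n * n" "j \<le> n" for x j
  proof -
    have "\<bar>\<Sum>w<j. e x w\<bar> \<le> (\<Sum>w<j. int (M * M))"
      using e that by (intro order_trans[OF sum_abs] sum_mono) auto
    also have "\<dots> = int (j * (M * M))" by simp
    also have "\<dots> \<le> int (n * (M * M))" using that by (intro of_nat_mono mult_le_mono1)
    finally show ?thesis using NB by linarith
  qed
  have ta: "\<bar>table_array n (\<lambda>i j. X $$ (i, j)) z\<bar> \<le> int M" if "X = C \<or> X = D" for X z
  proof (cases "0 \<le> z \<and> z < int (n * n)")
    case True
    then have z: "nat z < n * n" by linarith
    then have "0 < n" by (cases n) auto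
    then have "nat z div n < n" "nat z mod n < n" using z by (simp_all add: less_mult_imp_div_less)
    then have "\<bar>X $$ (nat z div n, nat z mod n)\<bar> \<le> int M" using that M by blast
    then show ?thesis using True by (simp add: table_array_def)
  next
    case False
    then have "table_array n (\<lambda>i j. X $$ (i, j)) z = 0" unfolding table_array_def by (rule if_not_P)
    then show ?thesis by simp
  qed
  have B0: "bounded B (matmul_input n C D)"
    using order_trans[OF ta NB(2)] NB by (auto simp: bounded_def matmul_input_def size_scalar_def)
  define I where "I x s \<longleftrightarrow> fst s 0 = int n \<and> snd s 1 = snd (matmul_input n C D) 1 \<and>
    snd s 2 = snd (matmul_input n C D) 2 \<and> (\<forall>y<x. snd s 0 (int y) = (\<Sum>w<n. e y w))"
    for x and s :: store
  have "runs B naive_matmul (matmul_input n C D)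
    (2 + (\<Sum>x<n * n. 2 + (1 + ((2 + (\<Sum>w<n. 2 + 1)) + 1))))
    (\<lambda>s. \<forall>i<n. \<forall>j<n. output_table n s i j = (C * D) $$ (i, j))"
    unfolding naive_matmul_def
  proof (rule runs_For[where I = I], goal_cases)
    case 1 show ?case by (rule B0)
  next
    case 2 show ?case by (rule NB(1))
  next
    case 3 show ?case by (simp add: I_def matmul_input_def size_scalar_def)
  next
    case (4 i s)
    then show ?case by (simp add: I_def)
  next
    case (5 x s)
    have d: "x div n < n" "x mod n < n" "0 < n"
      using 5(2) by (auto simp: less_mult_imp_div_less intro!: mod_less_divisor gr0I)
    have tabs: "table_array n (\<lambda>i j. A $$ (i, j)) (int (u * n + v)) = A $$ (u, v)"
      if "u < n" "v < n" for A :: "int mat" and u v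
    proof -
      have "u * n + v < n * n"
      proof -
        have "u * n + v < Suc u * n" using that by simp
        also have "\<dots> \<le> n * n" using that by (intro mult_le_mono1) simp
        finally show ?thesis .
      qed
      then show ?thesis using that by (simp add: table_array_def del: of_nat_add of_nat_mult)
    qed
    show ?case
    proof (rule runs_Seq, rule runs_Assign, goal_cases)
      case 3
      let ?s1 = "((fst s)(3 := aval (Const 0) s), snd s)"
      show ?case
      proof (rule runs_Seq, rule runs_For[where h = n and I = "\<lambda>w s'. fst s' 0 = int n \<and> fst s' 1 = int x \<and>
          snd s' = snd s \<and> fst s' 3 = (\<Sum>w<w. e x w)"], goal_cases)
        case (5 w s2)
        have "snd s2 1 (int (x div n * n + w)) = C $$ (x div n, w)"
          "snd s2 2 (int (w * n + x mod n)) = D $$ (w, x mod n)"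
          using \<open>I x s\<close> 5 tabs[of "x div n" w C] tabs[of w "x mod n" D] d
          by (simp_all add: I_def matmul_input_def del: of_nat_add of_nat_mult)
        moreover have "int x div int n * int n + int w = int (x div n * n + w)"
          "int w * int n + (int x - int x div int n * int n) = int (w * n + x mod n)"
          by (simp_all add: zdiv_int zmod_int minus_div_mult_eq_mod)
        ultimately have val: "aval (Plus (Var 3) (Times
         (Arr 1 (Plus (Times (Div (Var 1) (Var 0)) (Var 0)) (Var 2)))
         (Arr 2 (Plus (Times (Var 2) (Var 0))
            (Minus (Var 1) (Times (Div (Var 1) (Var 0)) (Var 0))))))) s2 = (\<Sum>w<Suc w. e x w)"
          using 5 by (simp add: e_def)
        show ?case
          by (rule runs_Assign, unfold val) (use 5 sum_e[OF \<open>x < n * n\<close>, of "Suc w"] in auto)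
      next
        case (6 s2)
        show ?case
          by (rule runs_Store)
            (use 6 \<open>I x s\<close> sum_e[OF \<open>x < n * n\<close>, of n] in \<open>auto simp: I_def less_Suc_eq\<close>)
      qed (use 3 5 NB in \<open>auto simp: I_def\<close>)
    qed (use 5 NB in auto)
  next
    case (6 s)
    show ?case
    proof (intro allI impI)
      fix i j assume ij: "i < n" "j < n"
      have lt: "i * n + j < n * n"
      proof -
        have "i * n + j < Suc i * n" using ij by simp
        also have "\<dots> \<le> n * n" using ij by (intro mult_le_mono1) simp
        finally show ?thesis .
      qed
      have "output_table n s i j = (\<Sum>w<n. e (i * n + j) w)"
        using 6(2) lt unfolding output_table_def I_def by blast
      also have "\<dots> = (C * D) $$ (i, j)"
        using C D ij by (simp add: e_def scalar_prod_def atLeast0LessThan)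
      finally show "output_table n s i j = (C * D) $$ (i, j)" .
    qed
  qed
  then show ?thesis unfolding B_def by (rule runs_weaken) (auto simp: algebra_simps)
qed

lemma matmul_exponents_nonempty: "3 \<in> matmul_exponents"
proof -
  obtain k where k: "cfits_power k naive_matmul" using cfits_power_ex by blast
  define T where "T n = real (2 + n * n * (6 + 3 * n))" for n
  have "multiplies_matrices_within naive_matmul T"
    unfolding multiplies_matrices_within_def
  \<comment> \<open>With \<open>m = n + M + 2\<close>, stored values are at most
    \<open>m ^ 3\<close>, and \<open>(m ^ 3 + 2) ^ k\<close> is at most
    \<open>(m * m ^ 3) ^ k\<close>.\<close>
  proof (rule exI[of _ "4 * k"], intro allI ballI impI)
    fix n M C D assume *: "C \<in> carrier_mat n n" "D \<in> carrier_mat n n"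
      "\<forall>i<n. \<forall>j<n. \<bar>C $$ (i, j)\<bar> \<le> int M \<and> \<bar>D $$ (i, j)\<bar> \<le> int M"
    let ?m = "n + M + 2"
    from runs_naive_matmul[OF *(1,2), of M] *(3) obtain t s where
      r: "run (int (?m ^ 3)) naive_matmul (matmul_input n C D) t s" "t \<le> 2 + n * n * (6 + 3 * n)"
      "\<forall>i<n. \<forall>j<n. output_table n s i j = (C * D) $$ (i, j)"
      unfolding runs_def by blast
    have "2 \<le> ?m ^ 3"
    proof -
      have "2 ^ 1 \<le> ?m ^ 1" by simp
      also have "?m ^ 1 \<le> ?m ^ 3" by (rule power_increasing) auto
      finally show ?thesis by simp
    qed
    then have "?m ^ 3 + 2 \<le> 2 * ?m ^ 3" by linarith
    also have "\<dots> \<le> ?m * ?m ^ 3" by (rule mult_le_mono1) simp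
    finally have "(?m ^ 3 + 2) ^ k \<le> (?m * ?m ^ 3) ^ k" by (rule power_mono) simp
    also have "\<dots> = ?m ^ (4 * k)" by (simp only: power_mult power_Suc[symmetric]) simp
    finally have "int ((?m ^ 3 + 2) ^ k) \<le> int (?m ^ (4 * k))" by (rule of_nat_mono)
    moreover have "int ((?m ^ 3 + 2) ^ k) = (int (?m ^ 3) + 2) ^ k"
      by (simp only: of_nat_power of_nat_add of_nat_numeral)
    ultimately have le: "(int (?m ^ 3) + 2) ^ k \<le> int (?m ^ (4 * k))" by (simp only:)
    have "exec ((int (?m ^ 3) + 2) ^ k) naive_matmul (matmul_input n C D) t s"
      by (rule run_exec[OF r(1) _ k]) simp
    from exec_mono[OF this le]
    have "exec (int (?m ^ (4 * k))) naive_matmul (matmul_input n C D) t s" .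
    moreover have "real t \<le> T n" unfolding T_def using r(2) by (simp only: of_nat_le_iff)
    ultimately show "\<exists>t s. exec (int (?m ^ (4 * k))) naive_matmul (matmul_input n C D) t s \<and>
      real t \<le> T n \<and> (\<forall>i<n. \<forall>j<n. output_table n s i j = (C * D) $$ (i, j))"
      using r(3) by blast
  qed
  moreover have "T \<in> O(\<lambda>n. real n powr 3)"
  \<comment> \<open>The constant is the sum of the coefficients 2, 6 and 3.\<close>
  proof (rule bigoI[of _ 11], rule eventually_mono[OF eventually_ge_at_top[of 1]])
    fix n :: nat assume n: "1 \<le> n"
    have "2 + n * n * (6 + 3 * n) \<le> 11 * (n * n * n)"
    proof -
      have "1 * 1 * 1 \<le> n * n * n" "n * n * 1 \<le> n * n * n" using n by (intro mult_le_mono; simp)+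
      moreover have "2 + n * n * (6 + 3 * n) = 2 + 6 * (n * n) + 3 * (n * n * n)" by (simp add: algebra_simps)
      ultimately show ?thesis by linarith
    qed
    then have "T n \<le> real (11 * (n * n * n))" unfolding T_def by (simp only: of_nat_le_iff)
    also have "\<dots> = 11 * real n powr 3" using n by (simp add: powr_numeral power3_eq_cube)
    finally show "norm (T n) \<le> 11 * norm (real n powr 3)" by (simp add: T_def)
  qed
  ultimately show ?thesis unfolding matmul_exponents_def by blast
qed

section \<open>Topological sorting and the complete program\<close>

definition padding :: com where
  "padding = Seq (Assign 1 (Const 1)) (While (Less (Var 1) (Var 0)) (Assign 1 (Plus (Var 1) (Var 1))))"

definition log_ceil :: "nat \<Rightarrow> nat" where
  "log_ceil n = (LEAST L. n \<le> 2 ^ L)"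

lemma log_ceil_ge: "n \<le> 2 ^ log_ceil n"
  unfolding log_ceil_def by (rule LeastI[of _ n]) (simp add: less_imp_le)

lemma log_ceil_le: "n \<le> 2 ^ L \<Longrightarrow> log_ceil n \<le> L"
  unfolding log_ceil_def by (rule Least_le)

text \<open>By minimality, half of the padded size is below \<open>n\<close>; the summand 1 is for
  \<open>n = 0\<close>, which is padded to size 1.\<close>

lemma power_log_ceil_le: "2 ^ log_ceil n \<le> 2 * n + 1"
proof (cases "log_ceil n")
  case (Suc L)
  have "\<not> n \<le> 2 ^ L" using log_ceil_le[of n L] Suc by linarith
  then show ?thesis using Suc by simp
qed simp

lemma runs_padding:
  assumes "bounded B s" "fst s 0 = int n" "2 * int n + 1 \<le> B"
  shows "runs B padding s (2 + 2 * log_ceil n) (\<lambda>s'. fst s' 1 = int (2 ^ log_ceil n))"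
proof -
  define I where "I k s' \<longleftrightarrow> k \<le> log_ceil n \<and> fst s' 0 = int n \<and> fst s' 1 = int (2 ^ k)"
    for k and s' :: store
  have "runs B padding s (1 + (1 + (\<Sum>k<log_ceil n. 1 + 1))) (\<lambda>s'. fst s' 1 = int (2 ^ log_ceil n))"
    unfolding padding_def
  proof (rule runs_Seq, rule runs_Assign, goal_cases)
    case 3
    show ?case
    proof (rule runs_While[where I = I], goal_cases)
      case (3 k s)
      then have k: "2 ^ k < n" "fst s 1 = int (2 ^ k)" "fst s 0 = int n"
        by (auto simp: I_def)
      have lt: "k < log_ceil n"
      proof (rule ccontr)
        assume "\<not> k < log_ceil n"
        then have "(2::nat) ^ log_ceil n \<le> 2 ^ k" by (intro power_increasing) auto
        then show False using k(1) log_ceil_ge[of n] by linarith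
      qed
      have "2 * 2 ^ k \<le> 2 * n" using k(1) by simp
      then have "int (2 * 2 ^ k) \<le> int (2 * n)" by (rule of_nat_mono)
      then have "int (2 ^ k) + int (2 ^ k) \<le> B"
        using assms(3) by (simp only: of_nat_mult of_nat_numeral)
      then have "runs B (Assign 1 (Plus (Var 1) (Var 1))) s 1 (I (Suc k))"
        by (intro runs_Assign) (use 3(1) k lt in \<open>auto simp: I_def\<close>)
      then show ?case using lt by blast
    next
      case (4 k s)
      then have "n \<le> 2 ^ k" "k \<le> log_ceil n" "fst s 1 = int (2 ^ k)"
        by (auto simp: I_def)
      then show ?case using log_ceil_le[of n k] by simp
    qed (use assms 3 in \<open>auto simp: I_def\<close>)
  qed (use assms in auto)
  then show ?thesis by (rule runs_weaken) auto
qed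

text \<open>The sum over the labels is unrolled when the program is built, so looking at all
  parallel edges between two vertices is a single expression and costs one step.\<close>

fun label_sum :: "nat list \<Rightarrow> aexp \<Rightarrow> aexp" where
  "label_sum [] e = Const 0"
| "label_sum (l # ls) e = Plus (Arr (Suc l) e) (label_sum ls e)"

section \<open>Topological sorting by removal of sources\<close>

definition labels :: "nat \<Rightarrow> nat \<Rightarrow> (nat \<Rightarrow> nat \<Rightarrow> nat \<Rightarrow> bool) \<Rightarrow> store \<Rightarrow> bool" where
  "labels ml n e s \<longleftrightarrow> (\<forall>l<ml. tab n (snd s (Suc l)) (e l))"

lemma aval_label_sum:
  assumes "labels ml n e s" "set ls \<subseteq> {..<ml}" "aval ie s = int (u * n + v)" "u < n" "v < n"
  shows "aval (label_sum ls ie) s = (\<Sum>l\<leftarrow>ls. of_bool (e l u v))"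
  using assms(2)
proof (induction ls)
  case (Cons l ls)
  then have "tab n (snd s (Suc l)) (e l)" using assms(1) by (auto simp: labels_def)
  then have "snd s (Suc l) (int (u * n + v)) = of_bool (e l u v)"
    using assms(4,5) unfolding tab_def by blast
  then show ?case using Cons by (simp add: assms(3) del: of_nat_add of_nat_mult)
qed simp

lemma label_sum_bounds:
  "0 \<le> (\<Sum>l\<leftarrow>ls. of_bool (P l) :: int)" "(\<Sum>l\<leftarrow>ls. of_bool (P l) :: int) \<le> int (length ls)"
  by (induction ls) auto

lemma label_sum_eq_0: "(\<Sum>l\<leftarrow>ls. of_bool (P l) :: int) = 0 \<longleftrightarrow> (\<forall>l\<in>set ls. \<not> P l)"
proof (induction ls)
  case (Cons l ls)
  have "0 \<le> (\<Sum>l\<leftarrow>ls. of_bool (P l) :: int)" by (rule label_sum_bounds)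
  then show ?case using Cons by (auto simp del: sum_list_eq_0_iff)
qed simp

definition degrees :: "nat \<Rightarrow> nat \<Rightarrow> com" where
  "degrees ml dg = For 3 (Var 0) (Fill 2 (Var 0) dg (Var 2)
     (Plus (Arr dg (Var 2)) (label_sum [0..<ml] (Plus (Times (Var 3) (Var 0)) (Var 2)))))"

text \<open>Kahn's algorithm with a linear scan for a source in each round, quadratic in total. The
  degree of a removed vertex is raised by 1, so that it never passes for a source again.\<close>

definition topsort :: "nat \<Rightarrow> nat \<Rightarrow> nat \<Rightarrow> com" where
  "topsort ml dg ord = For 3 (Var 0) (Seq (Assign 4 (Const 0))
     (Seq (For 2 (Var 0) (If (Less (Arr dg (Var 2)) (Const 1)) (Assign 4 (Var 2)) Skip))
     (Seq (Fill 2 (Var 0) dg (Var 2)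
             (Minus (Arr dg (Var 2)) (label_sum [0..<ml] (Plus (Times (Var 4) (Var 0)) (Var 2)))))
     (Seq (Store dg (Var 4) (Plus (Arr dg (Var 4)) (Const 1)))
          (Store ord (Var 3) (Var 4))))))"

locale label_tables =
  fixes ml n :: nat and e :: "nat \<Rightarrow> nat \<Rightarrow> nat \<Rightarrow> bool" and B :: int
  assumes B: "int (n * ml) + 1 \<le> B" "int (n * n) \<le> B"
begin

definition mult_edges :: "nat \<Rightarrow> nat \<Rightarrow> int" where
  "mult_edges u v = (\<Sum>l\<leftarrow>[0..<ml]. of_bool (e l u v))"

definition edges :: "(nat \<times> nat) set" where
  "edges = {(u, v). u < n \<and> v < n \<and> (\<exists>l<ml. e l u v)}"

lemma mult_edges_0: "u < n \<Longrightarrow> v < n \<Longrightarrow> mult_edges u v = 0 \<longleftrightarrow> (u, v) \<notin> edges"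
  unfolding mult_edges_def label_sum_eq_0 by (auto simp: edges_def)

lemma mult_edges_bounds: "0 \<le> mult_edges u v" "mult_edges u v \<le> int ml"
  unfolding mult_edges_def using label_sum_bounds[of "\<lambda>l. e l u v" "[0..<ml]"] by auto

lemma n_le_B: "int n \<le> B"
proof -
  have "int n \<le> int (n * n)" by (cases n) auto
  then show ?thesis using B(2) by linarith
qed

lemma sum_mult_edges_bounds:
  assumes "U \<subseteq> {..<n}"
  shows "0 \<le> (\<Sum>u\<in>U. mult_edges u v)" "(\<Sum>u\<in>U. mult_edges u v) \<le> int (n * ml)"
proof -
  show "0 \<le> (\<Sum>u\<in>U. mult_edges u v)" by (intro sum_nonneg) (auto simp: mult_edges_bounds)
  have "(\<Sum>u\<in>U. mult_edges u v) \<le> (\<Sum>u\<in>U. int ml)" by (intro sum_mono) (auto simp: mult_edges_bounds)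
  also have "\<dots> = int (card U * ml)" by simp
  also have "\<dots> \<le> int (n * ml)"
    using card_mono[OF _ assms] by (intro of_nat_mono mult_le_mono1) simp
  finally show "(\<Sum>u\<in>U. mult_edges u v) \<le> int (n * ml)" .
qed

lemma runs_degrees:
  assumes "bounded B s" "fst s 0 = int n" "labels ml n e s" "\<And>v. snd s dg v = 0" "ml < dg"
  shows "runs B (degrees ml dg) s (2 + n * (4 + 3 * n))
    (\<lambda>s'. \<forall>v<n. snd s' dg (int v) = (\<Sum>u<n. mult_edges u v))"
proof -
  define I where "I x s' \<longleftrightarrow> fst s' 0 = int n \<and> labels ml n e s' \<and>
    (\<forall>v<n. snd s' dg (int v) = (\<Sum>u<x. mult_edges u v))" for x s'
  have "runs B (degrees ml dg) s (2 + (\<Sum>u<n. 2 + (2 + 3 * n)))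
    (\<lambda>s'. \<forall>v<n. snd s' dg (int v) = (\<Sum>u<n. mult_edges u v))"
    unfolding degrees_def
  proof (rule runs_For[where I = I], goal_cases)
    case (5 u s)
    note s = 5
    show ?case
    proof (rule runs_Fill[where h = n and p = int and f = "\<lambda>v. \<Sum>u<Suc u. mult_edges u v"], goal_cases)
      case (5 v g)
      have "labels ml n e ((fst s)(2 := int v), (snd s)(dg := g))"
        using s(3) assms(5) by (auto simp: I_def labels_def)
      then have "aval (label_sum [0..<ml] (Plus (Times (Var 3) (Var 0)) (Var 2)))
          ((fst s)(2 := int v), (snd s)(dg := g)) = mult_edges u v"
        unfolding mult_edges_def by (rule aval_label_sum) (use s 5 in \<open>auto simp: I_def\<close>)
      then show ?case using 5 s by (simp add: I_def)
    next
      case (7 v)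
      have "{..<Suc u} \<subseteq> {..<n}" using s by auto
      from sum_mult_edges_bounds[OF this, of v] show ?case using B by simp
    next
      case (8 g)
      have "labels ml n e ((fst s)(2 := int n, 3 := int (Suc u)), (snd s)(dg := g))"
        using s(3) assms(5) by (auto simp: I_def labels_def)
      then show ?case using 8 s by (auto simp: I_def)
    qed (use s n_le_B in \<open>auto simp: I_def\<close>)
  qed (use assms n_le_B in \<open>auto simp: I_def labels_def\<close>)
  then show ?thesis by (rule runs_weaken) (auto simp: algebra_simps)
qed

definition sorted_prefix :: "nat list \<Rightarrow> bool" where
  "sorted_prefix os \<longleftrightarrow> distinct os \<and> set os \<subseteq> {..<n} \<and>
     (\<forall>i<length os. \<forall>u. (u, os ! i) \<in> edges \<longrightarrow> u \<in> set (take i os))"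

lemma runs_topsort:
  assumes "bounded B s" "fst s 0 = int n" "labels ml n e s" "ml < dg" "ml < ord" "ord \<noteq> dg"
    and deg: "\<forall>v<n. snd s dg (int v) = (\<Sum>u<n. mult_edges u v)"
    and acyclic: "acyclic edges"
  shows "runs B (topsort ml dg ord) s (2 + n * (10 + 7 * n))
    (\<lambda>s'. \<exists>os. sorted_prefix os \<and> length os = n \<and> (\<forall>i<n. snd s' ord (int i) = int (os ! i)))"
proof -
  define I where "I x s' \<longleftrightarrow> fst s' 0 = int n \<and> labels ml n e s' \<and>
    (\<exists>os. sorted_prefix os \<and> length os = x \<and> (\<forall>i<x. snd s' ord (int i) = int (os ! i)) \<and>
      (\<forall>v<n. snd s' dg (int v) = (\<Sum>u\<in>{..<n} - set os. mult_edges u v) + of_bool (v \<in> set os)))"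
    for x s'
  have "finite edges" by (rule finite_subset[of _ "{..<n} \<times> {..<n}"]) (auto simp: edges_def)
  then have wf: "wf edges" using acyclic by (rule finite_acyclic_wf)
  have "runs B (topsort ml dg ord) s (2 + (\<Sum>u<n. 2 + (1 + ((2 + (\<Sum>v<n. 2 + 2)) + ((2 + 3 * n) + (1 + 1))))))
    (\<lambda>s'. \<exists>os. sorted_prefix os \<and> length os = n \<and> (\<forall>i<n. snd s' ord (int i) = int (os ! i)))"
    unfolding topsort_def
  proof (rule runs_For[where I = I], goal_cases)
    case 3
    then show ?case using assms
      by (auto simp: I_def labels_def sorted_prefix_def intro!: exI[of _ "[]"])
  next
    case (5 x s)
    note s = 5
    then obtain os where os: "fst s 0 = int n" "labels ml n e s" "sorted_prefix os" "length os = x"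
      "\<forall>i<x. snd s ord (int i) = int (os ! i)"
      "\<forall>v<n. snd s dg (int v) = (\<Sum>u\<in>{..<n} - set os. mult_edges u v) + of_bool (v \<in> set os)"
      unfolding I_def by blast
    have fin: "finite ({..<n} - set os)" by simp
    have "set os \<noteq> {..<n}"
    proof
      assume "set os = {..<n}"
      then have "card (set os) = n" by simp
      then show False using os(3,4) s(2) by (simp add: sorted_prefix_def distinct_card)
    qed
    then obtain z where "z \<in> {..<n} - set os" using os(3) by (auto simp: sorted_prefix_def)
    \<comment> \<open>A finite acyclic relation is well-founded; a minimal remaining vertex has no
      remaining predecessor, so the scan cannot fail.\<close>
    from wfE_min[OF wf this] obtain v0 where v0: "v0 \<in> {..<n} - set os"
      "\<And>u. (u, v0) \<in> edges \<Longrightarrow> u \<notin> {..<n} - set os" by blast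
    have "(\<Sum>u\<in>{..<n} - set os. mult_edges u v0) = 0"
      by (intro sum.neutral) (use v0 mult_edges_0 in auto)
    then have dv0: "snd s dg (int v0) < 1" "v0 < n" using v0 os(6) by auto
    show ?case
    proof (rule runs_Seq, rule runs_Assign, goal_cases)
      case 3
      define s1 where "s1 = ((fst s)(4 := aval (Const 0) s), snd s)"
      \<comment> \<open>Scalar 4 is preset to vertex 0, which exists as \<open>x < n\<close>, and
        keeps the last source met.\<close>
      define J where "J j s' \<longleftrightarrow> fst s' 0 = int n \<and> fst s' 3 = int x \<and> snd s' = snd s \<and>
        (\<exists>f<n. fst s' 4 = int f \<and> ((\<exists>v<j. snd s dg (int v) < 1) \<longrightarrow> snd s dg (int f) < 1))"
        for j and s' :: store
      show ?case unfolding s1_def[symmetric]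
      proof (rule runs_Seq, rule runs_For[where h = n and I = J], goal_cases)
        case (5 j s2)
        then obtain f where f: "fst s2 0 = int n" "fst s2 3 = int x" "snd s2 = snd s" "f < n" "fst s2 4 = int f"
          "(\<exists>v<j. snd s dg (int v) < 1) \<longrightarrow> snd s dg (int f) < 1"
          unfolding J_def by blast
        have "runs B (If (Less (Arr dg (Var 2)) (Const 1)) (Assign 4 (Var 2)) Skip) s2 (1 + 1)
          (\<lambda>s'. fst s' 2 = int j \<and> J (Suc j) ((fst s')(2 := int (Suc j)), snd s'))"
        proof (rule runs_If)
          assume "bval (Less (Arr dg (Var 2)) (Const 1)) s2"
          then show "runs B (Assign 4 (Var 2)) s2 1
            (\<lambda>s'. fst s' 2 = int j \<and> J (Suc j) ((fst s')(2 := int (Suc j)), snd s'))"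
            by (intro runs_Assign) (use 5 f n_le_B in \<open>auto simp: J_def\<close>)
        next
          assume "\<not> bval (Less (Arr dg (Var 2)) (Const 1)) s2"
          then show "runs B Skip s2 1
            (\<lambda>s'. fst s' 2 = int j \<and> J (Suc j) ((fst s')(2 := int (Suc j)), snd s'))"
            by (intro runs_Skip) (use 5 f in \<open>auto simp: J_def less_Suc_eq\<close>)
        qed (use 5 in auto)
        then show ?case by (rule runs_weaken) auto
      next
        case (6 s3)
        then obtain f where f: "fst s3 0 = int n" "fst s3 3 = int x" "snd s3 = snd s" "f < n" "fst s3 4 = int f"
          "snd s dg (int f) < 1"
          unfolding J_def using dv0 by blast
        let ?U = "{..<n} - set os"
        have nn: "0 \<le> (\<Sum>u\<in>?U. mult_edges u f)" by (rule sum_mult_edges_bounds) auto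
        have df: "snd s dg (int f) = (\<Sum>u\<in>?U. mult_edges u f) + of_bool (f \<in> set os)"
          using os(6) f(4) by blast
        have "f \<notin> set os"
        proof
          assume "f \<in> set os"
          then show False using df nn f(6) by simp
        qed
        have "(\<Sum>u\<in>?U. mult_edges u f) = 0" using df nn f(6) \<open>f \<notin> set os\<close> by simp
        then have "\<forall>u\<in>?U. mult_edges u f = 0"
          using sum_nonneg_eq_0_iff[OF fin, of "\<lambda>u. mult_edges u f"] mult_edges_bounds by blast
        then have pre: "u \<in> set os" if "(u, f) \<in> edges" for u
          using that mult_edges_0[of u f] f(4) by (auto simp: edges_def)
        let ?U' = "{..<n} - set (os @ [f])"
        have U': "(\<Sum>u\<in>?U. mult_edges u v) = mult_edges f v + (\<Sum>u\<in>?U'. mult_edges u v)" for v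
        proof -
          have eq: "?U = insert f ?U'" using f(4) \<open>f \<notin> set os\<close> by auto
          show ?thesis unfolding eq by (rule sum.insert) auto
        qed
        have sp: "sorted_prefix (os @ [f])"
          using os(3) \<open>f \<notin> set os\<close> f(4) pre
          by (auto simp: sorted_prefix_def nth_append less_Suc_eq)
        define d where "d v = (\<Sum>u\<in>?U'. mult_edges u v) + of_bool (v \<in> set os)" for v
        have dB: "0 \<le> d v" "d v \<le> B" for v
        proof -
          have "0 \<le> (\<Sum>u\<in>?U'. mult_edges u v)" "(\<Sum>u\<in>?U'. mult_edges u v) \<le> int (n * ml)"
            by (rule sum_mult_edges_bounds; blast)+
          moreover have "0 \<le> (of_bool (v \<in> set os) :: int)" "of_bool (v \<in> set os) \<le> (1 :: int)" by simp_all
          ultimately show "0 \<le> d v" "d v \<le> B" unfolding d_def using B(1) by linarith+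
        qed
        have df1: "d f + 1 \<le> B"
        proof -
          have "(\<Sum>u\<in>?U'. mult_edges u f) \<le> int (n * ml)"
            by (rule sum_mult_edges_bounds) blast
          then show ?thesis unfolding d_def using \<open>f \<notin> set os\<close> B(1) by simp
        qed
        show ?case
        proof (rule runs_Seq, rule runs_Fill[where h = n and p = int and f = d], goal_cases)
          case (5 v g)
          have "labels ml n e ((fst s3)(2 := int v), (snd s3)(dg := g))"
            using os(2) f(3) assms(4) by (auto simp: labels_def)
          then have "aval (label_sum [0..<ml] (Plus (Times (Var 4) (Var 0)) (Var 2)))
              ((fst s3)(2 := int v), (snd s3)(dg := g)) = mult_edges f v"
            unfolding mult_edges_def by (rule aval_label_sum) (use f 5 in auto)
          then show ?case using 5 f os(6) U'[of v] by (simp add: d_def)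
        next
          case (8 g)
          show ?case
          proof (intro runs_Seq runs_Store, goal_cases)
            case 1 show ?case using 8 by simp
          next
            case 2 show ?case using 8 f dB(1)[of f] df1 by simp
          next
            case 3 then show ?case by simp
          next
            case 4 show ?case using f n_le_B by simp
          next
            case 5
            show ?case unfolding I_def
            proof (intro conjI exI[of _ "os @ [f]"])
              show "sorted_prefix (os @ [f])" by (rule sp)
            qed (use f 8 os assms(4-6) \<open>f \<notin> set os\<close> in
                \<open>auto simp: labels_def nth_append less_Suc_eq d_def\<close>)
          qed
        qed (use 6(1) f dB n_le_B in auto)
      qed (use s os 3 n_le_B in \<open>auto simp: s1_def J_def\<close>)
    qed (use s n_le_B in auto)
  qed (use assms n_le_B in \<open>auto simp: I_def\<close>)
  then show ?thesis by (rule runs_weaken) (auto simp: algebra_simps)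
qed

end

text \<open>Loops over all pairs use one counter \<open>x\<close>, standing for the topological
  positions \<open>x div n\<close> and \<open>x mod n\<close>. This is the cell of the pair in a
  padded table; \<open>vertex_cell\<close> is its cell in the tables of the input and output, after
  translation to vertex numbers.\<close>

definition pos_cell :: aexp where
  "pos_cell = Plus (Times (Div (Var 2) (Var 0)) (Var 1))
     (Minus (Var 2) (Times (Div (Var 2) (Var 0)) (Var 0)))"

definition vertex_cell :: "nat \<Rightarrow> aexp" where
  "vertex_cell ord = Plus (Times (Arr ord (Div (Var 2) (Var 0))) (Var 0))
     (Arr ord (Minus (Var 2) (Times (Div (Var 2) (Var 0)) (Var 0))))"

fun base_tables :: "nat \<Rightarrow> nat \<Rightarrow> (nat \<Rightarrow> nat list) \<Rightarrow> nat \<Rightarrow> com" where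
  "base_tables y0 ord bl 0 = Skip"
| "base_tables y0 ord bl (Suc i) = Seq (base_tables y0 ord bl i)
     (Fill 2 (Times (Var 0) (Var 0)) (y0 + i) pos_cell (nonzero (label_sum (bl i) (vertex_cell ord))))"

lemma wvars_base_tables: "x \<noteq> 2 \<Longrightarrow> x \<notin> wvars (base_tables y0 ord bl i)"
  by (induction i) auto

lemma warrs_base_tables: "a < y0 \<or> y0 + i \<le> a \<Longrightarrow> a \<notin> warrs (base_tables y0 ord bl i)"
  by (induction i) auto

text \<open>In an acyclic graph only the empty path leads from a vertex to itself. The diagonal is
  thus constant: \<open>nul\<close> tells whether the empty word is in the language.\<close>

definition output_tables :: "nat \<Rightarrow> nat \<Rightarrow> int \<Rightarrow> com" where
  "output_tables y ord nul = Seq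
     (Fill 2 (Times (Var 0) (Var 0)) 0 (vertex_cell ord) (Arr y pos_cell))
     (Fill 2 (Var 0) 0 (Plus (Times (Var 2) (Var 0)) (Var 2)) (Const nul))"

section \<open>Moving tables into and out of topological order\<close>

lemma div_mod_less:
  assumes "x < n * (n::nat)"
  shows "x div n < n" "x mod n < n" "0 < n"
proof -
  show n: "0 < n" using assms by (cases n) auto
  then show "x div n < n" "x mod n < n" using assms by (auto simp: less_mult_imp_div_less)
qed

lemma aval_pos_cell:
  assumes "fst s 0 = int n" "fst s 1 = int N" "fst s 2 = int x"
  shows "aval pos_cell s = int (bcell N n 0 0 x)"
proof -
  have "int x - int x div int n * int n = int (x mod n)"
    by (simp only: minus_div_mult_eq_mod of_nat_mod)
  moreover have "int x div int n = int (x div n)" by (simp only: of_nat_div)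
  ultimately show ?thesis using assms by (simp add: pos_cell_def bcell_def)
qed

lemma aval_vertex_cell:
  assumes "fst s 0 = int n" "fst s 2 = int x" "x < n * n" "\<forall>i<n. snd s ord (int i) = int (p i)"
  shows "aval (vertex_cell ord) s = int (p (x div n) * n + p (x mod n))"
proof -
  have "int x - int x div int n * int n = int (x mod n)"
    by (simp only: minus_div_mult_eq_mod of_nat_mod)
  moreover have "int x div int n = int (x div n)" by (simp only: of_nat_div)
  ultimately show ?thesis using assms(1,2,4) div_mod_less[OF assms(3)] by (simp add: vertex_cell_def)
qed

text \<open>Rows and columns from \<open>n\<close> on are never written and stay zero, which makes
  the padding vertices isolated.\<close>

lemma runs_base_tables:
  assumes s: "bounded B s" "fst s 0 = int n" "fst s 1 = int N" "n \<le> N"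
    and B: "int (n * n) \<le> B" "1 \<le> B"
    and lab: "labels ml n e s" "ml < ord" "ord < y0" "\<And>i. i < cI \<Longrightarrow> set (bl i) \<subseteq> {..<ml}"
    and ord: "\<forall>i<n. snd s ord (int i) = int (p i)" "\<And>i. i < n \<Longrightarrow> p i < n"
    and zero: "\<And>i z. snd s (y0 + i) z = 0"
  shows "runs B (base_tables y0 ord bl cI) s (cI * (2 + 3 * (n * n)) + 1)
    (\<lambda>s'. \<forall>i<cI. tab N (snd s' (y0 + i)) (\<lambda>x y. x < n \<and> y < n \<and> (\<exists>l\<in>set (bl i). e l (p x) (p y))))"
  using lab(4)
proof (induction cI)
  case 0
  then show ?case using s by (auto intro: runs_Skip[simplified])
next
  case (Suc c)
  have "runs B (base_tables y0 ord bl (Suc c)) s ((c * (2 + 3 * (n * n)) + 1) + (2 + 3 * (n * n)))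
    (\<lambda>s'. \<forall>i<Suc c. tab N (snd s' (y0 + i)) (\<lambda>x y. x < n \<and> y < n \<and> (\<exists>l\<in>set (bl i). e l (p x) (p y))))"
    unfolding base_tables.simps
  proof (rule runs_Seq'[OF Suc.IH], goal_cases)
    case (1 i)
    then show ?case using Suc.prems by simp
  next
    case (2 s1)
    have v1: "fst s1 0 = int n" "fst s1 1 = int N"
      using 2(2) s by (auto simp: wvars_base_tables)
    have a1: "snd s1 a = snd s a" if "a < y0 \<or> y0 + c \<le> a" for a
      using 2(3) that by (auto simp: warrs_base_tables)
    have cell: "aval (vertex_cell ord) ((fst s1)(2 := int x), (snd s1)(y0 + c := g)) =
        int (p (x div n) * n + p (x mod n))" if "x < n * n" for x g
      by (rule aval_vertex_cell[OF _ _ that]) (use v1 a1 lab ord in auto)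
    have lab1: "labels ml n e ((fst s1)(2 := int x), (snd s1)(y0 + c := g))" for x g
      using lab a1 by (auto simp: labels_def)
    show ?case
    proof (rule runs_Fill[where h = "n * n" and p = "\<lambda>x. int (bcell N n 0 0 x)"
        and f = "\<lambda>x. of_bool (\<exists>l\<in>set (bl c). e l (p (x div n)) (p (x mod n)))"], goal_cases)
      case (4 x g)
      show ?case by (rule aval_pos_cell) (use v1 in auto)
    next
      case (5 x g)
      have "aval (label_sum (bl c) (vertex_cell ord)) ((fst s1)(2 := int x), (snd s1)(y0 + c := g)) =
        (\<Sum>l\<leftarrow>bl c. of_bool (e l (p (x div n)) (p (x mod n))))"
        by (rule aval_label_sum[OF lab1 _ cell])
          (use Suc.prems[of c] 5(1) div_mod_less[OF 5(1)] ord in auto)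
      then show ?case by (simp add: label_sum_eq_0 del: sum_list_eq_0_iff)
    next
      case 6
      show ?case using bcell_inj[of 0 n N 0] s(4) by (auto simp: inj_on_def)
    next
      case (8 g)
      have "tab N g (\<lambda>x y. x < n \<and> y < n \<and> (\<exists>l\<in>set (bl c). e l (p x) (p y)))"
        unfolding tab_def
      proof (intro allI impI)
        fix x y assume xy: "x < N" "y < N"
        show "g (int (x * N + y)) = of_bool (x < n \<and> y < n \<and> (\<exists>l\<in>set (bl c). e l (p x) (p y)))"
        proof (cases "x < n \<and> y < n")
          case True
          define z where "z = x * n + y"
          have "z < Suc x * n" using True by (simp add: z_def)
          also have "\<dots> \<le> n * n" using True by (intro mult_le_mono1) simp
          finally have z: "z < n * n" .
          have zd: "z div n = x" "z mod n = y" using True by (auto simp: z_def)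
          have "bcell N n 0 0 z = x * N + y" by (simp add: bcell_def zd)
          then show ?thesis using 8(1)[OF z] True by (simp add: zd del: of_nat_add of_nat_mult)
        next
          case False
          have "int (x * N + y) \<notin> (\<lambda>x. int (bcell N n 0 0 x)) ` {..<n * n}"
          proof
            assume "int (x * N + y) \<in> (\<lambda>x. int (bcell N n 0 0 x)) ` {..<n * n}"
            then obtain z where z: "z < n * n" "bcell N n 0 0 z = x * N + y"
              by (auto simp del: of_nat_mult of_nat_add)
            from bcell_eq[OF z(2,1) _ xy(2)] s(4) have "x = z div n \<and> y = z mod n" by simp
            then show False using False div_mod_less[OF z(1)] by simp
          qed
          then have "g (int (x * N + y)) = snd s1 (y0 + c) (int (x * N + y))" by (rule 8(2))
          then show ?thesis using False a1[of "y0 + c"] zero[of c] by auto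
        qed
      qed
      then show ?case using 2(4) by (auto simp: less_Suc_eq)
    qed (use 2(1) v1 B in auto)
  qed
  then show ?case by (rule runs_weaken) auto
qed

lemma runs_output_tables:
  assumes s: "bounded B s" "fst s 0 = int n" "fst s 1 = int N" "n \<le> N"
    and B: "int (n * n) \<le> B" "1 \<le> B"
    and tab: "tab N (snd s y) R" and y: "0 < y" "0 < ord"
    and nul: "\<bar>nul\<bar> \<le> 1"
    and ord: "\<forall>i<n. snd s ord (int i) = int (p i)" "\<And>i. i < n \<Longrightarrow> p i < n" "inj_on p {..<n}"
  shows "runs B (output_tables y ord nul) s (4 + 3 * (n * n) + 3 * n)
    (\<lambda>s'. \<forall>i<n. \<forall>j<n. snd s' 0 (int (p i * n + p j)) = (if i = j then nul else of_bool (R i j)))"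
proof -
  have nB: "int n \<le> B"
  proof -
    have "int n \<le> int (n * n)" by (cases n) auto
    then show ?thesis using B(1) by linarith
  qed
  have inj: "i = i' \<and> j = j'" if "p i * n + p j = p i' * n + p j'" "i < n" "i' < n" "j < n" "j' < n"
    for i j i' j'
    using row_major_inject[OF that(1)] that ord(2,3) by (auto dest: inj_onD)
  have "runs B (output_tables y ord nul) s ((2 + 3 * (n * n)) + (2 + 3 * n))
    (\<lambda>s'. \<forall>i<n. \<forall>j<n. snd s' 0 (int (p i * n + p j)) = (if i = j then nul else of_bool (R i j)))"
    unfolding output_tables_def
  proof (rule runs_Seq, rule runs_Fill[where h = "n * n"
        and p = "\<lambda>x. int (p (x div n) * n + p (x mod n))" and f = "\<lambda>x. of_bool (R (x div n) (x mod n))"], goal_cases)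
    case (4 x g)
    show ?case by (rule aval_vertex_cell) (use 4 s y ord in auto)
  next
    case (5 x g)
    have "aval pos_cell ((fst s)(2 := int x), (snd s)(0 := g)) = int (bcell N n 0 0 x)"
      by (rule aval_pos_cell) (use s in auto)
    moreover have "snd s y (int (bcell N n 0 0 x)) = of_bool (R (x div n) (x mod n))"
    proof -
      have "x div n < N" "x mod n < N" using div_mod_less[OF 5(1)] s(4) by linarith+
      then show ?thesis using tab by (simp add: tab_def bcell_def del: of_nat_add of_nat_mult)
    qed
    ultimately show ?case using y by simp
  next
    case 6
    show ?case
    proof (rule inj_onI)
      fix x x' assume *: "x \<in> {..<n * n}" "x' \<in> {..<n * n}"
        "int (p (x div n) * n + p (x mod n)) = int (p (x' div n) * n + p (x' mod n))"
      then have "x div n = x' div n \<and> x mod n = x' mod n"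
        by (intro inj) (simp_all only: of_nat_eq_iff, auto simp: div_mod_less)
      then show "x = x'" by (metis div_mult_mod_eq)
    qed
  next
    case (8 g)
    have g: "g (int (p i * n + p j)) = of_bool (R i j)" if "i < n" "j < n" for i j
    proof -
      define z where "z = i * n + j"
      have "z < Suc i * n" using that by (simp add: z_def)
      also have "\<dots> \<le> n * n" using that by (intro mult_le_mono1) simp
      finally have z: "z < n * n" .
      have zd: "z div n = i" "z mod n = j" using that by (auto simp: z_def)
      show ?thesis using 8(1)[OF z] unfolding zd .
    qed
    show ?case
    proof (rule runs_Fill[where h = n and p = "\<lambda>x. int (x * n + x)" and f = "\<lambda>x. nul"], goal_cases)
      case 6
      show ?case by (auto simp: inj_on_def dest!: row_major_inject simp del: of_nat_add of_nat_mult)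
    next
      case (8 g')
      show ?case
      proof (intro allI impI)
        fix i j assume ij: "i < n" "j < n"
        show "snd (((fst ((fst s)(2 := int (n * n)), (snd s)(0 := g)))(2 := int n),
            (snd ((fst s)(2 := int (n * n)), (snd s)(0 := g)))(0 := g'))) 0 (int (p i * n + p j)) =
          (if i = j then nul else of_bool (R i j))"
        proof (cases "i = j")
          case True
          then show ?thesis using 8(1)[of "p i"] ord(2)[OF ij(1)] by simp
        next
          case False
          have "int (p i * n + p j) \<notin> (\<lambda>x. int (x * n + x)) ` {..<n}"
          proof
            assume "int (p i * n + p j) \<in> (\<lambda>x. int (x * n + x)) ` {..<n}"
            then obtain x where x: "p i * n + p j = x * n + x" "x < n"
              by (auto simp del: of_nat_mult of_nat_add)
            from row_major_inject[OF x(1)] ord(2) ij x(2) have "p i = p j" by simp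
            then show False using False ord(3) ij by (auto dest: inj_onD)
          qed
          from 8(2)[OF this] g[OF ij] False show ?thesis by simp
        qed
      qed
    qed (use 8(3) s B nB nul in auto)
  qed (use s B in auto)
  then show ?thesis by (rule runs_weaken) auto
qed

section \<open>The whole program\<close>

fun power_exp :: "aexp \<Rightarrow> nat \<Rightarrow> aexp" where
  "power_exp e 0 = Const 1"
| "power_exp e (Suc k) = Times e (power_exp e k)"

lemma aval_power_exp [simp]: "aval (power_exp e k) s = aval e s ^ k"
  by (induction k) auto

locale cfl_program = matmul_prog q mq kq \<tau> for q mq kq \<tau> +
  fixes ml cI st :: nat and rs :: "(nat \<times> nat \<times> nat) list" and bl :: "nat \<Rightarrow> nat list" and nul :: int
  assumes rs_less: "\<And>i j k. (i, j, k) \<in> set rs \<Longrightarrow> i < cI \<and> j < cI \<and> k < cI"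
    and bl_less: "\<And>i. set (bl i) \<subseteq> {..<ml}" and st: "st < cI" and nul: "\<bar>nul\<bar> \<le> 1"
begin

text \<open>
  Above the input labels, the arrays are: \<open>ml + 1\<close>: degrees, \<open>ml + 2\<close>: vertex order, then \<open>cI\<close>
  tables, then the memory of the called program.
\<close>

definition solver :: com where
  "solver = Seq padding
    (Seq (Assign 14 (power_exp (Plus (Var 1) (Const 3)) (kq + 2)))
    (Seq (degrees ml (ml + 1))
    (Seq (topsort ml (ml + 1) (ml + 2))
    (Seq (base_tables (ml + 3) (ml + 2) bl cI)
    (Seq (closure_loop (ml + 3 + cI) (ml + 3) rs)
         (output_tables (ml + 3 + st) (ml + 2) nul))))))"

definition solver_time :: "nat \<Rightarrow> nat" where
  "solver_time n = (2 + 2 * log_ceil n) + (1 + ((2 + n * (4 + 3 * n)) + ((2 + n * (10 + 7 * n)) +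
     ((cI * (2 + 3 * (n * n)) + 1) + (loop_time rs (log_ceil n) + (4 + 3 * (n * n) + 3 * n))))))"

text \<open>With \<open>N\<close> the padded size, the power \<open>kq\<close> is for calls on
  blocks of size up to \<open>N\<close>; the two additional factors give at least
  \<open>N * N\<close>, so that copied operands fit into the window of a call.\<close>

definition word :: "nat \<Rightarrow> int" where
  "word n = (int (2 ^ log_ceil n) + 3) ^ (kq + 2)"

definition label_edges :: "nat \<Rightarrow> (nat \<Rightarrow> nat \<Rightarrow> nat \<Rightarrow> bool) \<Rightarrow> (nat \<times> nat) set" where
  "label_edges n e = {(u, v). u < n \<and> v < n \<and> (\<exists>l<ml. e l u v)}"

text \<open>All that the machine part has to know about grammar and paths. The last clause makes
  each relation strictly upper triangular in every topological order of the edges.\<close>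

definition path_system :: "nat \<Rightarrow> (nat \<Rightarrow> nat \<Rightarrow> nat \<Rightarrow> bool) \<Rightarrow> (nat \<Rightarrow> nat \<Rightarrow> nat \<Rightarrow> bool) \<Rightarrow> bool" where
  "path_system n e R \<longleftrightarrow> acyclic (label_edges n e) \<and>
     (\<forall>i l u v. l \<in> set (bl i) \<longrightarrow> u < n \<longrightarrow> v < n \<longrightarrow> e l u v \<longrightarrow> R i u v) \<and>
     (\<forall>i j k u w v. (i, j, k) \<in> set rs \<longrightarrow> R j u w \<longrightarrow> R k w v \<longrightarrow> R i u v) \<and>
     (\<forall>i u v. R i u v \<longrightarrow> (\<exists>l\<in>set (bl i). e l u v) \<or>
        (\<exists>j k w. (i, j, k) \<in> set rs \<and> R j u w \<and> R k w v)) \<and>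
     (\<forall>i u v. R i u v \<longrightarrow> (u, v) \<in> (label_edges n e)\<^sup>+)"

lemma runs_solver:
  fixes n :: nat and e :: "nat \<Rightarrow> nat \<Rightarrow> nat \<Rightarrow> bool"
  defines "N \<equiv> 2 ^ log_ceil n"
  defines "edges \<equiv> label_edges n e"
  assumes B: "int (n * ml) + 1 \<le> B" "4 * int (N * N) \<le> B" "word n \<le> B"
      "int (N * N * log_ceil n * (2 * length rs)) * (2 * word n + 1) \<le> B"
    and s: "bounded B s" "fst s = size_scalar n" "labels ml n e s"
      "\<And>a z. a = 0 \<or> ml < a \<Longrightarrow> snd s a z = 0"
    and system: "path_system n e R"
  shows "runs B solver s (solver_time n)
    (\<lambda>s'. \<forall>u<n. \<forall>v<n. output_table n s' u v = (if u = v then nul else of_bool (R st u v)))"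
proof -
  note sys = system[unfolded path_system_def, folded edges_def]
  note acyclic = sys[THEN conjunct1]
    and R_base = sys[THEN conjunct2, THEN conjunct1, rule_format]
    and R_closed = sys[THEN conjunct2, THEN conjunct2, THEN conjunct1, rule_format]
    and R_unfold = sys[THEN conjunct2, THEN conjunct2, THEN conjunct2, THEN conjunct1, rule_format]
    and R_path = sys[THEN conjunct2, THEN conjunct2, THEN conjunct2, THEN conjunct2, rule_format]
  let ?L = "log_ceil n"
  define NN where "NN = N"
  have NN: "NN = 2 ^ ?L" "n \<le> NN" "1 \<le> NN" "NN \<le> NN * NN"
    using log_ceil_ge[of n] by (simp_all add: NN_def N_def)
  note B' = B[folded NN_def]
  have nn: "n * n \<le> NN * NN" using NN(2) by (intro mult_le_mono)
  have B1: "1 \<le> B" "int (NN * NN) \<le> B" "int (n * n) \<le> B" "int NN \<le> B" "2 * int n + 1 \<le> B"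
  proof -
    have "1 \<le> NN * NN" using NN(3,4) by linarith
    then show "1 \<le> B" "int (NN * NN) \<le> B" "int (n * n) \<le> B" "int NN \<le> B" "2 * int n + 1 \<le> B"
      using B'(2) nn NN(2,4) by linarith+
  qed
  interpret lt: label_tables ml n e B
    by unfold_locales (use B'(1) B1 in auto)
  have edges: "edges = lt.edges" by (simp add: edges_def label_edges_def lt.edges_def)
  have W: "(int NN + 3) ^ kq \<le> word n" "int (NN * NN) \<le> word n" "0 \<le> word n"
  proof -
    have w: "word n = (int NN + 3) ^ kq * (int NN + 3)\<^sup>2"
      by (simp only: word_def NN power_add)
    have 1: "1 \<le> (int NN + 3) ^ kq" "1 \<le> (int NN + 3)\<^sup>2" by (simp_all add: one_le_power)
    show "(int NN + 3) ^ kq \<le> word n" unfolding w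
      using mult_left_mono[OF 1(2), of "(int NN + 3) ^ kq"] 1 by simp
    have "int (NN * NN) \<le> (int NN + 3)\<^sup>2" by (simp add: power2_eq_square algebra_simps)
    also have "\<dots> \<le> word n" unfolding w
      using mult_right_mono[OF 1(1), of "(int NN + 3)\<^sup>2"] 1 by simp
    finally show "int (NN * NN) \<le> word n" .
    show "0 \<le> word n" by (simp add: word_def)
  qed
  define J where "J s' \<longleftrightarrow> fst s' 0 = int n \<and> fst s' 1 = int NN \<and> fst s' 12 = 0 \<and> fst s' 14 = word n \<and>
    labels ml n e s' \<and> (\<forall>a z. a = 0 \<or> ml + 3 \<le> a \<longrightarrow> snd s' a z = 0)" for s'
  define Q where "Q = (\<lambda>s'. \<forall>u<n. \<forall>v<n. output_table n s' u v = (if u = v then nul else of_bool (R st u v)))"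
  have J_frame: "J s2" if "J s1" "\<And>x. x \<notin> wvars c \<Longrightarrow> fst s2 x = fst s1 x"
    "\<And>a. a \<notin> warrs c \<Longrightarrow> snd s2 a = snd s1 a" "wvars c \<inter> {0, 1, 12, 14} = {}"
    "warrs c \<subseteq> {ml + 1, ml + 2}" for s1 s2 c
  proof -
    have "fst s2 x = fst s1 x" if "x \<in> {0, 1, 12, 14}" for x
      using that \<open>wvars c \<inter> {0, 1, 12, 14} = {}\<close> by (intro \<open>\<And>x. x \<notin> wvars c \<Longrightarrow> fst s2 x = fst s1 x\<close>) blast
    moreover have "snd s2 a = snd s1 a" if "a \<le> ml \<or> ml + 3 \<le> a" for a
      using that \<open>warrs c \<subseteq> {ml + 1, ml + 2}\<close> by (intro \<open>\<And>a. a \<notin> warrs c \<Longrightarrow> snd s2 a = snd s1 a\<close>) auto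
    ultimately show ?thesis using \<open>J s1\<close> by (auto simp: J_def labels_def)
  qed
  have "runs B solver s (solver_time n) Q"
    unfolding solver_def solver_time_def
  proof (rule runs_Seq'[OF runs_padding], goal_cases)
    case (4 s1)
    have s1: "fst s1 0 = int n" "fst s1 1 = int NN" "fst s1 12 = 0" "snd s1 = snd s"
      using 4 s(2) by (auto simp: padding_def size_scalar_def NN)
    show ?case
    proof (rule runs_Seq, rule runs_Assign, goal_cases)
      case 1 show ?case using 4 by simp
    next
      case 2
      have "aval (power_exp (Plus (Var 1) (Const 3)) (kq + 2)) s1 = word n"
        by (simp only: aval_power_exp aval.simps s1 word_def NN)
      then show ?case using W(3) B'(3) by simp
    next
      case 3
      let ?s2 = "((fst s1)(14 := aval (power_exp (Plus (Var 1) (Const 3)) (kq + 2)) s1), snd s1)"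
      have "aval (power_exp (Plus (Var 1) (Const 3)) (kq + 2)) s1 = word n"
        by (simp only: aval_power_exp aval.simps s1 word_def NN)
      then have J2: "J ?s2" using s1 s(3,4) by (simp add: J_def labels_def)
      have dg: "snd ?s2 (ml + 1) z = 0" for z using s1 s(4) by simp
      show ?case
      proof (rule runs_Seq'[OF lt.runs_degrees[OF 3]], goal_cases)
        case (5 s3)
        have J3: "J s3"
          by (rule J_frame[where c = "degrees ml (ml + 1)", OF J2 5(2,3)]) (auto simp: degrees_def)
        show ?case
        proof (rule runs_Seq'[OF lt.runs_topsort[OF 5(1)]], goal_cases)
          case (8 s4)
          have J4: "J s4"
            by (rule J_frame[where c = "topsort ml (ml + 1) (ml + 2)", OF J3 8(2,3)]) (auto simp: topsort_def)
          from 8(4) obtain os where os: "lt.sorted_prefix os" "length os = n"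
            "\<forall>i<n. snd s4 (ml + 2) (int i) = int (os ! i)" by blast
          \<comment> \<open>The vertex at a given topological position; a bijection of
            \<open>{..<n}\<close> along which edges lead upwards.\<close>
          define p where "p = (!) os"
          have p_lt: "p i < n" if "i < n" for i
            using os that nth_mem[of i os] unfolding lt.sorted_prefix_def p_def by blast
          have set_os: "set os = {..<n}"
            using os by (intro card_subset_eq) (auto simp: lt.sorted_prefix_def distinct_card)
          have p_inj: "inj_on p {..<n}"
            using os by (auto simp: lt.sorted_prefix_def p_def inj_on_def nth_eq_iff_index_eq)
          have p_surj: "\<exists>i<n. p i = u" if "u < n" for u
            using that set_os os(2) by (metis in_set_conv_nth lessThan_iff p_def)
          have p_edge: "x < y" if "(p x, p y) \<in> edges" "x < n" "y < n" for x y
          proof -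
            have "p x \<in> set (take y os)"
              using os that unfolding edges lt.sorted_prefix_def p_def by blast
            then obtain z where z: "z < y" "os ! z = p x" "z < n"
              using os(2) by (auto simp: in_set_conv_nth)
            then have "z = x" using p_inj that(2) by (auto simp: p_def dest: inj_onD)
            then show ?thesis using z by simp
          qed
          have edges_sub: "edges \<subseteq> {..<n} \<times> {..<n}" by (auto simp: edges_def label_edges_def)
          have p_trancl: "(u, v) \<in> edges\<^sup>+ \<Longrightarrow> x < n \<Longrightarrow> y < n \<Longrightarrow> u = p x \<Longrightarrow> v = p y \<Longrightarrow> x < y" for u v x y
          proof (induction arbitrary: y rule: trancl_induct)
            case (base v)
            then show ?case using p_edge by simp
          next
            case (step w v)
            then obtain z where z: "z < n" "p z = w" using p_surj edges_sub by blast
            then have "x < z" using step.IH step.prems by simp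
            moreover have "z < y" using p_edge z step by simp
            ultimately show ?case by simp
          qed
          have R_lt: "u < n \<and> v < n" if "R i u v" for i u v
            using R_path[OF that] trancl_subset_Sigma[OF edges_sub] by auto
          \<comment> \<open>The relations are moved to topological positions, where they satisfy
            \<open>strict\<close> of \<open>binary_system\<close>.\<close>
          define Rp where "Rp i x y \<longleftrightarrow> x < n \<and> y < n \<and> R i (p x) (p y)" for i x y
          define Bs where "Bs i x y \<longleftrightarrow> x < n \<and> y < n \<and> (\<exists>l\<in>set (bl i). e l (p x) (p y))" for i x y
          interpret va: valiant q mq kq \<tau> ?L rs Bs Rp cI "ml + 3" "ml + 3 + cI" NN B "word n"
          proof unfold_locales
            show "Bs \<le> Rp" using R_base p_lt by (auto simp: Bs_def Rp_def le_fun_def)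
          next
            fix i j k u w v assume "(i, j, k) \<in> set rs" "Rp j u w" "Rp k w v"
            then show "Rp i u v" using R_closed by (auto simp: Rp_def)
          next
            fix i u v assume *: "Rp i u v"
            then have "R i (p u) (p v)" "u < n" "v < n" by (auto simp: Rp_def)
            from R_unfold[OF this(1)]
            show "Bs i u v \<or> (\<exists>j k w. (i, j, k) \<in> set rs \<and> Rp j u w \<and> Rp k w v)"
            proof
              assume "\<exists>l\<in>set (bl i). e l (p u) (p v)"
              then show ?thesis using * by (auto simp: Bs_def Rp_def)
            next
              assume "\<exists>j k w. (i, j, k) \<in> set rs \<and> R j (p u) w \<and> R k w (p v)"
              then obtain j k w where w: "(i, j, k) \<in> set rs" "R j (p u) w" "R k w (p v)" by blast
              then obtain z where "z < n" "p z = w" using R_lt p_surj by blast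
              then show ?thesis using w * by (auto simp: Rp_def)
            qed
          next
            fix i u v assume "Rp i u v"
            then show "u < v \<and> v < 2 ^ ?L"
              using p_trancl[OF R_path] NN by (auto simp: Rp_def)
          qed (use NN rs_less W B' in auto)
          show ?case
          proof (rule runs_Seq'[OF runs_base_tables[where e = e and p = p and N = NN and ml = ml and n = n]], goal_cases)
            case (14 s5)
            have f5: "fst s5 x = fst s4 x" if "x \<noteq> 2" for x
              using 14(2) that by (simp add: wvars_base_tables)
            have a5: "snd s5 a = snd s4 a" if "a < ml + 3 \<or> ml + 3 + cI \<le> a" for a
              using 14(3) that by (simp add: warrs_base_tables)
            have "Bs i = (\<lambda>x y. x < n \<and> y < n \<and> (\<exists>l\<in>set (bl i). e l (p x) (p y)))" for i
              by (intro ext) (simp add: Bs_def)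
            then have st5: "va.state Bs 0 s5"
              using J4 14(4) f5 a5 by (auto simp: va.state_def J_def fresh_def)
            show ?case
            proof (rule runs_Seq'[OF va.runs_closure_loop[OF 14(1) st5]], goal_cases)
              case (1 s6)
              then have tab6: "tab NN (snd s6 (ml + 3 + st)) (Rp st)" using st by (auto simp: va.state_def)
              have f6: "fst s6 0 = int n" "fst s6 1 = int NN"
                using 1(2) f5 J4 by (auto simp: wvars_closure_loop J_def)
              have ord6: "\<forall>i<n. snd s6 (ml + 2) (int i) = int (p i)"
                using 1(3)[OF notin_warrs_closure_loop] a5 os(3) by (auto simp: p_def)
              have "0 < ml + 3 + st" "0 < ml + 2" by simp_all
              from runs_output_tables[OF 1(1) f6 NN(2) B1(3,1) tab6 this nul ord6 p_lt p_inj]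
              show ?case
              proof (rule runs_weaken, goal_cases)
                case (3 s7)
                show ?case unfolding Q_def
                proof (intro allI impI)
                  fix u v assume "u < n" "v < n"
                  then obtain i j where ij: "i < n" "j < n" "u = p i" "v = p j" using p_surj by metis
                  then have "i = j \<longleftrightarrow> u = v" using p_inj by (auto dest: inj_onD)
                  then show "output_table n s7 u v = (if u = v then nul else of_bool (R st u v))"
                    using 3(4) ij by (simp add: output_table_def Rp_def del: of_nat_add of_nat_mult)
                qed
              qed auto
            qed
          qed (use 8(1) J4 NN B1 bl_less p_lt os in \<open>auto simp: J_def p_def\<close>)
        qed (use 5(4) J3 acyclic in \<open>auto simp: J_def edges\<close>)
      qed (use J2 dg in \<open>auto simp: J_def\<close>)
    qed
  qed (use s B1 in \<open>auto simp: size_scalar_def\<close>)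
  then show ?thesis by (simp only: Q_def)
qed

end

section \<open>Running time and word size\<close>

text \<open>The small blocks are multiplied for every input, however large, so a bound that holds
  only eventually is of no use. The finitely many exceptions are absorbed into the constant by
  \<open>S\<close>.\<close>

lemma bigo_powr_bound:
  fixes f :: "nat \<Rightarrow> real"
  assumes "f \<in> O(\<lambda>n. real n powr c)" "0 \<le> c"
  obtains C where "0 \<le> C" "\<And>n. 1 \<le> n \<Longrightarrow> f n \<le> C * real n powr c"
proof -
  obtain D where D: "0 < D" "\<forall>\<^sub>F n in at_top. norm (f n) \<le> D * norm (real n powr c)"
    using assms(1) by (elim landau_o.bigE)
  then obtain n0 where n0: "\<And>n. n \<ge> n0 \<Longrightarrow> norm (f n) \<le> D * norm (real n powr c)"
    unfolding eventually_at_top_linorder by blast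
  define S where "S = (\<Sum>i<n0. \<bar>f i\<bar>)"
  have S: "0 \<le> S" by (simp add: S_def sum_nonneg)
  have "f n \<le> (D + S) * real n powr c" if n: "1 \<le> n" for n
  proof (cases "n \<ge> n0")
    case True
    have "f n \<le> D * real n powr c" using n0[OF True] by simp
    also have "\<dots> \<le> (D + S) * real n powr c" using S by (intro mult_right_mono) auto
    finally show ?thesis .
  next
    case False
    have "f n \<le> \<bar>f n\<bar>" by simp
    also have "\<dots> \<le> S" unfolding S_def using False by (intro member_le_sum) auto
    also have "\<dots> \<le> (D + S) * 1" using D by simp
    also have "\<dots> \<le> (D + S) * real n powr c"
      using D S n assms(2) by (intro mult_left_mono ge_one_powr_ge_zero) auto
    finally show ?thesis .
  qed
  then show ?thesis using that[of "D + S"] D S by simp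
qed

text \<open>These are the positions at which scale \<open>n\<close> is treated, and the bound is the
  number of aligned blocks of size \<open>2 ^ n\<close>.\<close>

lemma card_multiples_le: "card {t. t < 4 ^ L - 1 \<and> 4 ^ n dvd Suc t} \<le> 4 ^ L div 4 ^ n"
proof -
  have "{t. t < 4 ^ L - 1 \<and> 4 ^ n dvd Suc t} \<subseteq> (\<lambda>y. 4 ^ n * y - 1) ` {1..4 ^ L div 4 ^ n}"
  proof
    fix t :: nat assume "t \<in> {t. t < 4 ^ L - 1 \<and> 4 ^ n dvd Suc t}"
    then obtain y where y: "Suc t = 4 ^ n * y" "Suc t \<le> 4 ^ L" by auto
    then have "y \<noteq> 0" by (intro notI) simp
    have "4 ^ n * y div 4 ^ n \<le> 4 ^ L div 4 ^ n" using y by (intro div_le_mono) simp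
    then have "y \<le> 4 ^ L div 4 ^ n" by simp
    moreover have "t = 4 ^ n * y - 1" using y(1) by linarith
    ultimately show "t \<in> (\<lambda>y. 4 ^ n * y - 1) ` {1..4 ^ L div 4 ^ n}" using \<open>y \<noteq> 0\<close> by force
  qed
  then have "card {t. t < 4 ^ L - 1 \<and> 4 ^ n dvd Suc t} \<le> card ((\<lambda>y. 4 ^ n * y - 1) ` {1..(4::nat) ^ L div 4 ^ n})"
    by (intro card_mono) auto
  also have "\<dots> \<le> card {1..(4::nat) ^ L div 4 ^ n}" by (rule card_image_le) simp
  finally show ?thesis by simp
qed

context matmul_prog
begin

text \<open>Exchanging the sums turns costs per position into costs per scale. The overhead
  \<open>11 + 6 * L\<close> of a position consists of \<open>5 * L\<close> for decoding,
  \<open>L\<close> for the tests of \<open>levels\<close> and constants.\<close>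

lemma loop_time_le:
  "loop_time rs L \<le> 2 + 4 ^ L * (11 + 6 * L) + (\<Sum>n<L. 4 ^ L div 4 ^ n * (step_time rs (2 ^ n) + 4))"
proof -
  let ?g = "\<lambda>n. step_time rs (2 ^ n) + 4"
  have eq: "loop_time rs L = 2 + ((\<Sum>t<(4::nat) ^ L - 1. 11 + 6 * L) +
      (\<Sum>t<(4::nat) ^ L - 1. \<Sum>n<L. if 4 ^ n dvd Suc t then ?g n else 0))"
    unfolding loop_time_def levels_time_def sum.distrib by (simp add: sum.distrib)
  have "(\<Sum>t<(4::nat) ^ L - 1. \<Sum>n<L. if 4 ^ n dvd Suc t then ?g n else 0) =
      (\<Sum>n<L. \<Sum>t<(4::nat) ^ L - 1. if 4 ^ n dvd Suc t then ?g n else 0)"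
    by (rule sum.swap)
  also have "\<dots> \<le> (\<Sum>n<L. 4 ^ L div 4 ^ n * ?g n)"
  proof (rule sum_mono)
    fix n
    have "(\<Sum>t<(4::nat) ^ L - 1. if 4 ^ n dvd Suc t then ?g n else 0) =
      (\<Sum>t\<in>{t \<in> {..<4 ^ L - 1}. 4 ^ n dvd Suc t}. ?g n)"
      by (rule sum.inter_filter[symmetric]) simp
    also have "\<dots> = card {t \<in> {..<4 ^ L - 1}. 4 ^ n dvd Suc t} * ?g n" by (simp only: sum_constant of_nat_id)
    also have "\<dots> = card {t. t < (4::nat) ^ L - 1 \<and> 4 ^ n dvd Suc t} * ?g n"
      by (simp only: lessThan_iff)
    also have "\<dots> \<le> 4 ^ L div 4 ^ n * ?g n" by (intro mult_le_mono1 card_multiples_le)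
    finally show "(\<Sum>t<(4::nat) ^ L - 1. if 4 ^ n dvd Suc t then ?g n else 0) \<le> 4 ^ L div 4 ^ n * ?g n" .
  qed
  finally have le: "(\<Sum>t<(4::nat) ^ L - 1. \<Sum>n<L. if 4 ^ n dvd Suc t then ?g n else 0) \<le>
      (\<Sum>n<L. 4 ^ L div 4 ^ n * ?g n)" .
  have "(\<Sum>t<(4::nat) ^ L - 1. 11 + 6 * L) \<le> 4 ^ L * (11 + 6 * L)"
    by (simp only: sum_constant card_lessThan of_nat_id) (intro mult_le_mono1 diff_le_self)
  with le show ?thesis unfolding eq by linarith
qed

text \<open>With \<open>x = 2 powr (c - 2)\<close>, one product at scale \<open>n\<close> costs
  about \<open>4 ^ n * x ^ n\<close>, and there are \<open>4 ^ (L - n)\<close> blocks. The total is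
  \<open>4 ^ L\<close> times a geometric series of ratio \<open>x > 1\<close>, dominated by its last
  terms.\<close>

lemma loop_time_bound:
  assumes c: "2 < c" and \<tau>: "0 \<le> C" "\<And>d. 1 \<le> d \<Longrightarrow> real (\<tau> d) \<le> C * real d powr c"
  obtains D where "0 \<le> D" "\<And>L. real (loop_time rs L) \<le> D * real (2 ^ L) powr c"
proof -
  define x where "x = 2 powr (c - 2)"
  have x: "1 < x" using c by (simp add: x_def)
  define C1 where "C1 = 2 * real (length rs) * (real mq + 19 + C) + 9"
  have C1: "0 \<le> C1" using \<tau>(1) by (simp add: C1_def)
  have step: "real (step_time rs d + 4) \<le> C1 * real d powr c" if d: "1 \<le> d" for d
  proof -
    have p1: "1 \<le> real d powr c" using d c by (intro ge_one_powr_ge_zero) auto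
    have "real d powr 2 \<le> real d powr c" using d c by (intro powr_mono) auto
    then have p2: "real (d * d) \<le> real d powr c" using d by (simp add: powr_numeral power2_eq_square)
    have "real (call_time d) = real mq + 9 * real (d * d) + real (\<tau> d) + 10"
      by (simp add: call_time_def)
    also have "\<dots> \<le> real mq * real d powr c + 9 * real d powr c + C * real d powr c + 10 * real d powr c"
      using p1 p2 \<tau>(2)[OF d] mult_left_mono[OF p1, of "real mq"] by linarith
    also have "\<dots> = (real mq + 19 + C) * real d powr c" by (simp add: algebra_simps)
    finally have ct: "real (call_time d) \<le> (real mq + 19 + C) * real d powr c" .
    have "real (step_time rs d + 4) = 2 * real (length rs) * real (call_time d) + 9"
      by (simp add: step_time_def)
    also have "\<dots> \<le> 2 * real (length rs) * ((real mq + 19 + C) * real d powr c) + 9 * real d powr c"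
      using p1 ct by (intro add_mono mult_left_mono) auto
    also have "\<dots> = C1 * real d powr c" by (simp add: C1_def algebra_simps)
    finally show ?thesis .
  qed
  have pw: "real (2 ^ n) powr c = 4 ^ n * x ^ n" for n :: nat
  proof -
    have "real (2 ^ n) powr c = 2 powr (real n * c)"
      by (simp add: powr_realpow[symmetric] powr_powr)
    also have "\<dots> = 2 powr (real n * 2 + real n * (c - 2))" by (simp add: algebra_simps)
    also have "\<dots> = 2 powr (real n * 2) * 2 powr (real n * (c - 2))" by (rule powr_add)
    also have "2 powr (real n * 2) = (4::real) ^ n"
    proof -
      have "2 powr (real n * 2) = (2 powr 2) powr real n" by (simp only: powr_powr mult.commute)
      also have "\<dots> = (4::real) ^ n" by (simp add: powr_realpow)
      finally show ?thesis .
    qed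
    also have "2 powr (real n * (c - 2)) = x ^ n"
      unfolding x_def by (simp add: powr_realpow[symmetric] powr_powr mult.commute)
    finally show ?thesis .
  qed
  define D where "D = 13 + 6 / (x - 1) + C1 / (x - 1)"
  have D: "0 \<le> D" using x C1 by (simp add: D_def)
  have "real (loop_time rs L) \<le> D * real (2 ^ L) powr c" for L
  proof -
    have xL: "1 \<le> x ^ L" using x by (intro one_le_power) simp
    \<comment> \<open>Bernoulli's inequality lets \<open>x ^ L\<close> absorb the factor
      \<open>L\<close> in the cost of decoding.\<close>
    have "1 + real L * (x - 1) \<le> (1 + (x - 1)) ^ L" using x by (intro Bernoulli_inequality) simp
    then have "real L * (x - 1) \<le> x ^ L" by simp
    then have L: "real L \<le> x ^ L / (x - 1)" using x by (simp add: field_simps)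
    have four: "1 \<le> (4::real) ^ L" by simp
    have "real (loop_time rs L) \<le>
      real (2 + 4 ^ L * (11 + 6 * L) + (\<Sum>n<L. 4 ^ L div 4 ^ n * (step_time rs (2 ^ n) + 4)))"
      using loop_time_le[of rs L] by (simp only: of_nat_le_iff)
    also have "\<dots> = 2 + 4 ^ L * (11 + 6 * real L) +
        (\<Sum>n<L. real (4 ^ L div 4 ^ n) * real (step_time rs (2 ^ n) + 4))"
      by (simp only: of_nat_add of_nat_mult of_nat_sum of_nat_power of_nat_numeral)
    finally have t1: "real (loop_time rs L) \<le> 2 + 4 ^ L * (11 + 6 * real L) +
        (\<Sum>n<L. real (4 ^ L div 4 ^ n) * real (step_time rs (2 ^ n) + 4))" .
    have "(\<Sum>n<L. real (4 ^ L div 4 ^ n) * real (step_time rs (2 ^ n) + 4)) \<le>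
        (\<Sum>n<L. 4 ^ L * (C1 * x ^ n))"
    proof (rule sum_mono)
      fix n
      have "real (4 ^ L div 4 ^ n) \<le> 4 ^ L / 4 ^ n"
        using of_nat_div_le_of_nat[of "4 ^ L" "4 ^ n", where 'a = real] by simp
      moreover have "real (step_time rs (2 ^ n) + 4) \<le> C1 * (4 ^ n * x ^ n)"
        using step[of "2 ^ n"] by (simp only: pw) simp
      ultimately have "real (4 ^ L div 4 ^ n) * real (step_time rs (2 ^ n) + 4) \<le>
        (4 ^ L / 4 ^ n) * (C1 * (4 ^ n * x ^ n))"
        by (intro mult_mono) auto
      then show "real (4 ^ L div 4 ^ n) * real (step_time rs (2 ^ n) + 4) \<le> 4 ^ L * (C1 * x ^ n)"
        by simp
    qed
    also have "\<dots> = 4 ^ L * (C1 * ((x ^ L - 1) / (x - 1)))"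
    proof -
      have "(\<Sum>n<L. x ^ n) = (x ^ L - 1) / (x - 1)" using x by (intro geometric_sum) simp
      then show ?thesis by (simp only: sum_distrib_left[symmetric])
    qed
    also have "\<dots> \<le> 4 ^ L * (C1 * (x ^ L / (x - 1)))"
      using C1 x by (intro mult_left_mono divide_right_mono) auto
    finally have t2: "(\<Sum>n<L. real (4 ^ L div 4 ^ n) * real (step_time rs (2 ^ n) + 4)) \<le>
        4 ^ L * (C1 * (x ^ L / (x - 1)))" .
    have "2 \<le> 4 ^ L * (2 * x ^ L)" using mult_mono[OF four, of 2 "2 * x ^ L"] xL by simp
    moreover have "4 ^ L * (11 + 6 * real L) \<le> 4 ^ L * (11 * x ^ L + 6 * (x ^ L / (x - 1)))"
      using L xL by (intro mult_left_mono add_mono) auto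
    moreover have "4 ^ L * (11 * x ^ L + 6 * (x ^ L / (x - 1))) + 4 ^ L * (2 * x ^ L) =
        4 ^ L * (13 * x ^ L + 6 * (x ^ L / (x - 1)))"
      by (simp only: distrib_left[symmetric]) simp
    ultimately have "real (loop_time rs L) \<le>
      4 ^ L * (13 * x ^ L + 6 * (x ^ L / (x - 1))) + 4 ^ L * (C1 * (x ^ L / (x - 1)))"
      using t1 t2 by linarith
    also have "\<dots> = D * (4 ^ L * x ^ L)" by (simp add: D_def algebra_simps)
    finally show ?thesis by (simp only: pw)
  qed
  then show ?thesis using that D by blast
qed

end

context cfl_program
begin

text \<open>Padding at most triples a positive \<open>n\<close>, which accounts for
  \<open>3 powr c\<close>; everything outside the main loop is quadratic.\<close>

lemma solver_time_bigo:
  assumes c: "2 < c" and \<tau>: "0 \<le> C" "\<And>d. 1 \<le> d \<Longrightarrow> real (\<tau> d) \<le> C * real d powr c"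
  shows "(\<lambda>n. real (solver_time n)) \<in> O(\<lambda>n. real n powr c)"
proof -
  obtain D where D: "0 \<le> D" "\<And>L. real (loop_time rs L) \<le> D * real (2 ^ L) powr c"
    using loop_time_bound[OF assms, of rs] by blast
  define F where "F = 48 + 5 * real cI + D * 3 powr c"
  show ?thesis
  proof (rule bigoI[of _ F], rule eventually_mono[OF eventually_ge_at_top[of 1]])
    fix n :: nat assume n: "1 \<le> n"
    have "2 ^ log_ceil n \<le> 3 * n" using power_log_ceil_le[of n] n by linarith
    then have N: "real (2 ^ log_ceil n) \<le> 3 * real n" by (metis of_nat_le_iff of_nat_mult of_nat_numeral)
    have "log_ceil n < 2 ^ log_ceil n" by (rule less_exp)
    then have l: "log_ceil n \<le> 3 * n" using \<open>2 ^ log_ceil n \<le> 3 * n\<close> by linarith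
    have nn: "n * 1 \<le> n * n" "1 * 1 \<le> n * n" using n by (intro mult_le_mono; simp)+
    have "solver_time n = loop_time rs (log_ceil n) + (2 * log_ceil n + (12 + cI * (2 + 3 * (n * n)) +
        (17 * n + 13 * (n * n))))"
      by (simp add: solver_time_def algebra_simps)
    also have "\<dots> \<le> loop_time rs (log_ceil n) + (40 + 5 * cI) * (n * n) + 8 * (n * n)"
    proof -
      have "cI * (2 + 3 * (n * n)) \<le> cI * (5 * (n * n))" using nn by (intro mult_le_mono2) linarith
      moreover have "(40 + 5 * cI) * (n * n) = 40 * (n * n) + cI * (5 * (n * n))" by (simp add: algebra_simps)
      moreover have "n \<le> n * n" "1 \<le> n * n" using nn by simp_all
      ultimately show ?thesis using l by linarith
    qed
    finally have "real (solver_time n) \<le> real (loop_time rs (log_ceil n) + (40 + 5 * cI) * (n * n) + 8 * (n * n))"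
      by (simp only: of_nat_le_iff)
    also have "\<dots> = real (loop_time rs (log_ceil n)) + (48 + 5 * real cI) * (real n * real n)"
      by (simp add: algebra_simps)
    also have "\<dots> \<le> D * 3 powr c * real n powr c + (48 + 5 * real cI) * real n powr c"
    proof (rule add_mono)
      have "real (loop_time rs (log_ceil n)) \<le> D * real (2 ^ log_ceil n) powr c" by (rule D(2))
      also have "\<dots> \<le> D * (3 * real n) powr c" using D(1) N c by (intro mult_left_mono powr_mono2) auto
      also have "\<dots> = D * 3 powr c * real n powr c" by (simp add: powr_mult)
      finally show "real (loop_time rs (log_ceil n)) \<le> D * 3 powr c * real n powr c" .
      have "real n powr 2 \<le> real n powr c" using n c by (intro powr_mono) auto
      then have "real n * real n \<le> real n powr c" using n by (simp add: powr_numeral power2_eq_square)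
      then show "(48 + 5 * real cI) * (real n * real n) \<le> (48 + 5 * real cI) * real n powr c"
        by (intro mult_left_mono) auto
    qed
    also have "\<dots> = F * real n powr c" by (simp add: F_def algebra_simps)
    finally show "norm (real (solver_time n)) \<le> F * norm (real n powr c)" by simp
  qed
qed

lemma solver_exec:
  obtains k' where "\<And>n e s R. fst s = size_scalar n \<Longrightarrow> labels ml n e s \<Longrightarrow>
      (\<And>a z. a = 0 \<or> ml < a \<Longrightarrow> snd s a z = 0) \<Longrightarrow> (\<And>a z. \<bar>snd s a z\<bar> \<le> 1) \<Longrightarrow>
      path_system n e R \<Longrightarrow>
      \<exists>t s'. exec (int ((n + 2) ^ k')) solver s t s' \<and> t \<le> solver_time n \<and>
        (\<forall>u<n. \<forall>v<n. output_table n s' u v = (if u = v then nul else of_bool (R st u v)))"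
proof -
  obtain k0 where k0: "cfits_power k0 solver" using cfits_power_ex by blast
  let ?E = "2 * length rs"
  \<comment> \<open>Chosen so that all four requirements on \<open>B\<close> hold for
    \<open>(n + 2) ^ K\<close>; the address space needs \<open>?E + 2 * kq + 12\<close>, the degrees
    need \<open>ml + 2\<close>.\<close>
  define K where "K = ml + ?E + 2 * kq + 12"
  show ?thesis
  proof (rule that[of "Suc K * k0"])
    fix n e s R
    assume s: "fst s = size_scalar n" "labels ml n e s" "\<And>a z. a = 0 \<or> ml < a \<Longrightarrow> snd s a z = 0"
        "\<And>a z. \<bar>snd s a z\<bar> \<le> 1"
      and system: "path_system n e R"
    define P where "P = n + 2"
    have P: "2 \<le> P" by (simp add: P_def)
    have up: "P ^ a \<le> P ^ b" if "a \<le> b" for a b using that P by (intro power_increasing) auto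
    \<comment> \<open>Constants are turned into powers of \<open>P\<close>, so that all estimates
      become sums of exponents.\<close>
    have small: "a \<le> P ^ a" for a
      using less_exp[of a] power_mono[OF P, of a] by linarith
    let ?N = "2 ^ log_ceil n :: nat" and ?w = "(2 ^ log_ceil n + 3) ^ (kq + 2) :: nat"
    have sq: "2 * P \<le> P ^ 2" using P by (simp add: power2_eq_square)
    have N: "?N \<le> P ^ 2" "?N + 3 \<le> P ^ 2"
      using power_log_ceil_le[of n] sq by (simp_all add: P_def)
    have NN: "?N * ?N \<le> P ^ 4"
      using mult_le_mono[OF N(1) N(1)] by (simp add: power_add[symmetric])
    have w: "?w \<le> P ^ (2 * kq + 4)"
    proof -
      have "?w \<le> (P ^ 2) ^ (kq + 2)" using N(2) by (intro power_mono) auto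
      also have "\<dots> = P ^ (2 * kq + 4)" by (simp only: power_mult[symmetric] distrib_left) simp
      finally show ?thesis .
    qed
    have word: "word n = int ?w" by (simp add: word_def)
    have b1: "n * ml + 1 \<le> P ^ K"
    proof -
      have "n * ml + 1 \<le> P * (ml + 1)" by (simp add: P_def)
      also have "\<dots> \<le> P * P ^ (ml + 1)" using small[of "ml + 1"] by (rule mult_le_mono2)
      also have "\<dots> = P ^ (ml + 2)" by simp
      also have "\<dots> \<le> P ^ K" by (rule up) (simp add: K_def)
      finally show ?thesis .
    qed
    have b2: "4 * (?N * ?N) \<le> P ^ K"
    proof -
      have "4 * (?N * ?N) \<le> P ^ 4 * P ^ 4" using NN small[of 4] by (intro mult_le_mono)
      also have "\<dots> = P ^ 8" by (simp add: power_add[symmetric])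
      also have "\<dots> \<le> P ^ K" by (rule up) (simp add: K_def)
      finally show ?thesis .
    qed
    have b3: "?w \<le> P ^ K"
      by (rule order_trans[OF w up]) (simp add: K_def)
    have b4: "?N * ?N * log_ceil n * ?E * (2 * ?w + 1) \<le> P ^ K"
    proof -
      have "log_ceil n \<le> P ^ 2" using less_exp[of "log_ceil n"] N(1) by linarith
      moreover have "2 * ?w + 1 \<le> P ^ (2 * kq + 6)"
      proof -
        have "1 \<le> ?w" by simp
        then have "2 * ?w + 1 \<le> 4 * ?w" by linarith
        also have "\<dots> \<le> P ^ 2 * P ^ (2 * kq + 4)"
          using w power_mono[OF P, of 2] by (intro mult_le_mono) auto
        also have "\<dots> = P ^ (2 * kq + 6)" by (simp add: power_add[symmetric] add.commute)
        finally show ?thesis .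
      qed
      ultimately have "?N * ?N * log_ceil n * ?E * (2 * ?w + 1) \<le> P ^ 4 * P ^ 2 * P ^ ?E * P ^ (2 * kq + 6)"
        using NN small[of ?E] by (intro mult_le_mono)
      also have "\<dots> = P ^ (4 + 2 + ?E + (2 * kq + 6))" by (simp only: power_add)
      also have "\<dots> \<le> P ^ K" by (rule up) (simp add: K_def)
      finally show ?thesis .
    qed
    have b5: "n \<le> P ^ K"
    proof -
      have "n \<le> P ^ 1" by (simp add: P_def)
      also have "\<dots> \<le> P ^ K" by (rule up) (simp add: K_def)
      finally show ?thesis .
    qed
    have one: "1 \<le> P ^ K" using P by simp
    have "\<bar>fst s x\<bar> \<le> int (P ^ K)" for x
      unfolding s(1) size_scalar_def using of_nat_mono[OF b5, where 'a = int]
      by (simp del: of_nat_power)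
    moreover have "\<bar>snd s a z\<bar> \<le> int (P ^ K)" for a z
      using s(4)[of a z] of_nat_mono[OF one, where 'a = int] by linarith
    ultimately have bounded: "bounded (int (P ^ K)) s" unfolding bounded_def by blast
    have "runs (int (P ^ K)) solver s (solver_time n)
      (\<lambda>s'. \<forall>u<n. \<forall>v<n. output_table n s' u v = (if u = v then nul else of_bool (R st u v)))"
    proof (rule runs_solver[where R = R and e = e and n = n])
      show "int (n * ml) + 1 \<le> int (P ^ K)"
        using of_nat_mono[OF b1, where 'a = int] by (simp only: of_nat_add of_nat_1)
      show "4 * int (2 ^ log_ceil n * 2 ^ log_ceil n) \<le> int (P ^ K)"
        using of_nat_mono[OF b2, where 'a = int] by (simp only: of_nat_mult of_nat_numeral)
      show "word n \<le> int (P ^ K)" unfolding word by (rule of_nat_mono[OF b3])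
      show "int (2 ^ log_ceil n * 2 ^ log_ceil n * log_ceil n * (2 * length rs)) * (2 * word n + 1) \<le> int (P ^ K)"
        unfolding word using of_nat_mono[OF b4, where 'a = int]
        by (simp only: of_nat_mult of_nat_add of_nat_1 of_nat_numeral)
      show "bounded (int (P ^ K)) s" by (rule bounded)
      show "fst s = size_scalar n" by (rule s(1))
      show "labels ml n e s" by (rule s(2))
      show "snd s a z = 0" if "a = 0 \<or> ml < a" for a z using that by (rule s(3))
      show "path_system n e R" by (rule system)
    qed
    then obtain t s' where r: "run (int (P ^ K)) solver s t s'" "t \<le> solver_time n"
      "\<forall>u<n. \<forall>v<n. output_table n s' u v = (if u = v then nul else of_bool (R st u v))"
      unfolding runs_def by blast
    have "2 \<le> P ^ K"
    proof -
      have "2 \<le> P ^ 1" using P by simp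
      also have "\<dots> \<le> P ^ K" by (rule up) (simp add: K_def)
      finally show ?thesis .
    qed
    then have "P ^ K + 2 \<le> 2 * P ^ K" by linarith
    also have "\<dots> \<le> P * P ^ K" using P by (rule mult_le_mono1)
    finally have "(P ^ K + 2) ^ k0 \<le> (P * P ^ K) ^ k0" by (rule power_mono) simp
    also have "\<dots> = P ^ (Suc K * k0)" by (simp only: power_mult power_Suc[symmetric])
    finally have "int ((P ^ K + 2) ^ k0) \<le> int (P ^ (Suc K * k0))" by (rule of_nat_mono)
    moreover have "int ((P ^ K + 2) ^ k0) = (int (P ^ K) + 2) ^ k0"
      by (simp only: of_nat_power of_nat_add of_nat_numeral)
    ultimately have le: "(int (P ^ K) + 2) ^ k0 \<le> int (P ^ (Suc K * k0))" by (simp only:)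
    have "exec ((int (P ^ K) + 2) ^ k0) solver s t s'" by (rule run_exec[OF r(1) _ k0]) simp
    from exec_mono[OF this le] have "exec (int ((n + 2) ^ (Suc K * k0))) solver s t s'"
      unfolding P_def .
    then show "\<exists>t s'. exec (int ((n + 2) ^ (Suc K * k0))) solver s t s' \<and> t \<le> solver_time n \<and>
        (\<forall>u<n. \<forall>v<n. output_table n s' u v = (if u = v then nul else of_bool (R st u v)))"
      using r(2,3) by (intro exI[of _ t] exI[of _ s'] conjI)
  qed
qed

end

section \<open>Binary form of a grammar\<close>

text \<open>Derivation in big steps along the sentential form. It shows which factor of the word
  stems from which symbol, on which the binary splitting depends.\<close>

inductive gen :: "('n, 't) cfg \<Rightarrow> ('n, 't) sym list \<Rightarrow> 't list \<Rightarrow> bool" for G where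
  gen_Nil: "gen G [] []"
| gen_Tm: "gen G \<beta> w \<Longrightarrow> gen G (Tm a # \<beta>) (a # w)"
| gen_Nt: "(A, \<alpha>) \<in> productions G \<Longrightarrow> gen G \<alpha> v \<Longrightarrow> gen G \<beta> w \<Longrightarrow> gen G (Nt A # \<beta>) (v @ w)"

section \<open>Equivalence of both forms of derivation\<close>

lemma gen_append: "gen G \<beta> v \<Longrightarrow> gen G \<gamma> w \<Longrightarrow> gen G (\<beta> @ \<gamma>) (v @ w)"
proof (induction rule: gen.induct)
  case (gen_Tm \<beta> v a)
  from gen.gen_Tm[OF gen_Tm.IH[OF gen_Tm.prems]] show ?case by simp
next
  case (gen_Nt A \<alpha> u \<beta> v)
  from gen.gen_Nt[OF gen_Nt.hyps(1,2) gen_Nt.IH(2)[OF gen_Nt.prems]] show ?case by simp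
qed simp

lemma gen_appendD: "gen G (\<beta> @ \<gamma>) u \<Longrightarrow> \<exists>v w. u = v @ w \<and> gen G \<beta> v \<and> gen G \<gamma> w"
proof (induction \<beta> arbitrary: u)
  case Nil
  then show ?case using gen_Nil by fastforce
next
  case (Cons X \<beta>)
  from Cons.prems have "gen G (X # \<beta> @ \<gamma>) u" by simp
  then show ?case
  proof cases
    case (gen_Tm w a)
    from Cons.IH[OF \<open>gen G (\<beta> @ \<gamma>) w\<close>]
    obtain v x where *: "w = v @ x" "gen G \<beta> v" "gen G \<gamma> x" by (elim exE conjE)
    have "u = (a # v) @ x \<and> gen G (X # \<beta>) (a # v) \<and> gen G \<gamma> x"
      using gen_Tm(1,2) * gen.gen_Tm[OF *(2)] by simp
    then show ?thesis by blast
  next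
    case (gen_Nt A \<alpha> y w)
    from Cons.IH[OF \<open>gen G (\<beta> @ \<gamma>) w\<close>]
    obtain v x where *: "w = v @ x" "gen G \<beta> v" "gen G \<gamma> x" by (elim exE conjE)
    have "u = (y @ v) @ x \<and> gen G (X # \<beta>) (y @ v) \<and> gen G \<gamma> x"
      using gen_Nt(1,2) * gen.gen_Nt[OF \<open>(A, \<alpha>) \<in> productions G\<close> \<open>gen G \<alpha> y\<close> *(2)] by simp
    then show ?thesis by blast
  qed
qed

lemma derive_step_context: "derive_step G \<beta> \<gamma> \<Longrightarrow> derive_step G (x @ \<beta> @ y) (x @ \<gamma> @ y)"
proof (induction rule: derive_step.induct)
  case (1 A \<alpha> \<beta> \<gamma>)
  from derive_step.intros[OF this, of "x @ \<beta>" "\<gamma> @ y"] show ?case by simp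
qed

lemma derive_context: "(derive_step G)\<^sup>*\<^sup>* \<beta> \<gamma> \<Longrightarrow> (derive_step G)\<^sup>*\<^sup>* (x @ \<beta> @ y) (x @ \<gamma> @ y)"
proof (induction rule: rtranclp_induct)
  case (step \<gamma> \<delta>)
  show ?case by (rule rtranclp.rtrancl_into_rtrancl[OF step.IH derive_step_context[OF step.hyps(2)]])
qed simp

lemma gen_imp_derive: "gen G \<beta> w \<Longrightarrow> (derive_step G)\<^sup>*\<^sup>* \<beta> (map Tm w)"
proof (induction rule: gen.induct)
  case (gen_Tm \<beta> w a)
  then show ?case using derive_context[of G \<beta> "map Tm w" "[Tm a]" "[]"] by simp
next
  case (gen_Nt A \<alpha> v \<beta> w)
  have "derive_step G (Nt A # \<beta>) (\<alpha> @ \<beta>)"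
    using derive_step.intros[OF gen_Nt.hyps(1), of "[]" \<beta>] by simp
  also have "(derive_step G)\<^sup>*\<^sup>* (\<alpha> @ \<beta>) (map Tm v @ \<beta>)"
    using derive_context[OF gen_Nt.IH(1), of "[]" \<beta>] by simp
  also have "(derive_step G)\<^sup>*\<^sup>* (map Tm v @ \<beta>) (map Tm v @ map Tm w)"
    using derive_context[OF gen_Nt.IH(2), of "map Tm v" "[]"] by simp
  finally show ?case by simp
qed simp

lemma gen_map_Tm: "gen G (map Tm w) w"
  by (induction w) (auto intro: gen_Nil gen_Tm)

lemma derive_step_gen: "derive_step G \<beta> \<gamma> \<Longrightarrow> gen G \<gamma> w \<Longrightarrow> gen G \<beta> w"
proof (induction rule: derive_step.induct)
  case (1 A \<alpha> \<beta> \<gamma>)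
  then have 2: "gen G (\<beta> @ \<alpha> @ \<gamma>) w" by simp
  from gen_appendD[OF 2] obtain x u where x: "w = x @ u" "gen G \<beta> x" and u: "gen G (\<alpha> @ \<gamma>) u"
    by blast
  from gen_appendD[OF u] obtain y z where y: "u = y @ z" "gen G \<alpha> y" "gen G \<gamma> z" by blast
  from gen_append[OF x(2) gen_Nt[OF 1(1) y(2,3)]] show ?case using x(1) y(1) by simp
qed

lemma derive_imp_gen: "(derive_step G)\<^sup>*\<^sup>* \<beta> (map Tm w) \<Longrightarrow> gen G \<beta> w"
proof (induction rule: converse_rtranclp_induct)
  case base
  show ?case by (rule gen_map_Tm)
next
  case (step \<beta> \<gamma>)
  show ?case by (rule derive_step_gen[OF step.hyps(1) step.IH])
qed

lemma lang_iff_gen: "w \<in> lang G \<longleftrightarrow> gen G [Nt (start G)] w"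
  using gen_imp_derive derive_imp_gen by (auto simp: lang_def)

text \<open>Suffixes of right-hand sides make rules binary without new nonterminals:
  \<open>X # \<delta>\<close> splits into \<open>[X]\<close> and \<open>\<delta>\<close>. The
  singletons are included to serve as heads.\<close>

definition items :: "('n, 't) cfg \<Rightarrow> ('n, 't) sym list set" where
  "items G = insert [] ((\<Union>(A, \<alpha>) \<in> productions G. (\<lambda>i. drop i \<alpha>) ` {..length \<alpha>}) \<union>
     (\<lambda>X. [X]) ` (Nt ` nonterminals G \<union> Tm ` terminals G))"

lemma item_iff: "\<beta> \<in> items G \<longleftrightarrow> \<beta> = [] \<or>
    (\<exists>A \<alpha> i. (A, \<alpha>) \<in> productions G \<and> i \<le> length \<alpha> \<and> \<beta> = drop i \<alpha>) \<or>
    (\<exists>X \<in> Nt ` nonterminals G \<union> Tm ` terminals G. \<beta> = [X])"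
  unfolding items_def by blast

lemma finite_items: "wf_cfg G \<Longrightarrow> finite (items G)"
  unfolding items_def wf_cfg_def by auto

lemma start_item: "wf_cfg G \<Longrightarrow> [Nt (start G)] \<in> items G"
  unfolding item_iff wf_cfg_def by blast

lemma production_item: "(A, \<alpha>) \<in> productions G \<Longrightarrow> \<alpha> \<in> items G"
  unfolding item_iff by (metis drop_0 le0)

lemma item_Cons:
  assumes "wf_cfg G" "X # \<delta> \<in> items G"
  shows "\<delta> \<in> items G" "[X] \<in> items G"
proof -
  consider (prod) A \<alpha> i where "(A, \<alpha>) \<in> productions G" "i \<le> length \<alpha>" "X # \<delta> = drop i \<alpha>"
    | (sym) "\<delta> = []" "X \<in> Nt ` nonterminals G \<union> Tm ` terminals G"
    using assms(2) unfolding item_iff by blast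
  then have "\<delta> \<in> items G \<and> [X] \<in> items G"
  proof cases
    case prod
    have "tl (X # \<delta>) = drop (Suc i) \<alpha>" unfolding prod(3) by (simp add: drop_Suc tl_drop)
    then have "\<delta> = drop (Suc i) \<alpha>" by simp
    moreover have "Suc i \<le> length \<alpha>"
    proof (rule ccontr)
      assume "\<not> Suc i \<le> length \<alpha>"
      then show False using prod(3) by simp
    qed
    ultimately have "\<delta> \<in> items G"
      unfolding item_iff using prod(1) by blast
    have "X \<in> set (drop i \<alpha>)" by (simp flip: prod(3))
    then have "X \<in> set \<alpha>" by (rule in_set_dropD)
    then have "X \<in> Nt ` nonterminals G \<union> Tm ` terminals G"
      using assms(1) prod(1) unfolding wf_cfg_def by blast
    then have "[X] \<in> items G" unfolding item_iff by blast
    with \<open>\<delta> \<in> items G\<close> show ?thesis ..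
  next
    case sym
    then have "[X] \<in> items G" "[] \<in> items G" unfolding item_iff by blast+
    then show ?thesis using sym(1) by simp
  qed
  then show "\<delta> \<in> items G" "[X] \<in> items G" by auto
qed

text \<open>\<open>unit G \<gamma> \<beta>\<close>: \<open>\<beta>\<close> rewrites to \<open>\<gamma>\<close> if the remaining symbols derive the empty word.\<close>

inductive unit :: "('n, 't) cfg \<Rightarrow> ('n, 't) sym list \<Rightarrow> ('n, 't) sym list \<Rightarrow> bool" for G \<gamma> where
  unit_refl: "unit G \<gamma> \<gamma>"
| unit_head: "unit G \<gamma> [X] \<Longrightarrow> gen G \<delta> [] \<Longrightarrow> unit G \<gamma> (X # \<delta>)"
| unit_tail: "unit G \<gamma> \<delta> \<Longrightarrow> gen G [X] [] \<Longrightarrow> unit G \<gamma> (X # \<delta>)"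
| unit_prod: "unit G \<gamma> \<alpha> \<Longrightarrow> (A, \<alpha>) \<in> productions G \<Longrightarrow> unit G \<gamma> [Nt A]"

lemma unit_gen: "unit G \<gamma> \<beta> \<Longrightarrow> gen G \<gamma> w \<Longrightarrow> gen G \<beta> w"
proof (induction rule: unit.induct)
  case (unit_head X \<delta>)
  from gen_append[OF unit_head.IH[OF unit_head.prems] unit_head.hyps(2)] show ?case by simp
next
  case (unit_tail \<delta> X)
  from gen_append[OF unit_tail.hyps(2) unit_tail.IH[OF unit_tail.prems]] show ?case by simp
next
  case (unit_prod \<alpha> A)
  from gen_Nt[OF unit_prod.hyps(2) unit_prod.IH[OF unit_prod.prems] gen_Nil] show ?case by simp
qed

text \<open>In the derivation, symbols that produce the empty word and chains of productions are
  skipped by \<open>unit\<close>, until either a single letter is left or both head and tail of an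
  item produce something. That both parts are nonempty makes the split point differ from both ends
  of an acyclic path.\<close>

lemma gen_split:
  assumes "wf_cfg G" "gen G \<beta> w" "w \<noteq> []" "\<beta> \<in> items G"
  shows "(\<exists>a. unit G [Tm a] \<beta> \<and> w = [a]) \<or>
    (\<exists>X \<delta> v v'. X # \<delta> \<in> items G \<and> unit G (X # \<delta>) \<beta> \<and> gen G [X] v \<and> gen G \<delta> v' \<and>
       w = v @ v' \<and> v \<noteq> [] \<and> v' \<noteq> [])"
  using assms(2-)
proof (induction rule: gen.induct)
  case gen_Nil
  then show ?case by simp
next
  case (gen_Tm \<beta> w a)
  have a: "gen G [Tm a] [a]" by (intro gen.gen_Tm gen.gen_Nil)
  show ?case
  proof (cases "w = []")
    case True
    then have "unit G [Tm a] (Tm a # \<beta>) \<and> a # w = [a]"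
      using unit_head[OF unit_refl, of G \<beta>] gen_Tm.hyps by simp
    then show ?thesis by (intro disjI1 exI)
  next
    case False
    have "Tm a # \<beta> \<in> items G \<and> unit G (Tm a # \<beta>) (Tm a # \<beta>) \<and> gen G [Tm a] [a] \<and> gen G \<beta> w \<and>
       a # w = [a] @ w \<and> [a] \<noteq> [] \<and> w \<noteq> []"
      using a False gen_Tm.hyps gen_Tm.prems(2) by (simp add: unit_refl)
    then show ?thesis by (intro disjI2 exI)
  qed
next
  case (gen_Nt A \<alpha> v \<beta> w)
  have A: "gen G [Nt A] v" using gen.gen_Nt[OF gen_Nt.hyps(1,2) gen.gen_Nil] by simp
  \<comment> \<open>Two nonempty parts already form the split. Otherwise the induction hypothesis
    for the nonempty part applies, and \<open>unit\<close> absorbs the empty one.\<close>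
  consider "v \<noteq> []" "w \<noteq> []" | "v = []" "w \<noteq> []" | "v \<noteq> []" "w = []" using gen_Nt.prems by auto
  then show ?case
  proof cases
    case 1
    have "Nt A # \<beta> \<in> items G \<and> unit G (Nt A # \<beta>) (Nt A # \<beta>) \<and> gen G [Nt A] v \<and> gen G \<beta> w \<and>
       v @ w = v @ w \<and> v \<noteq> [] \<and> w \<noteq> []"
      using A 1 gen_Nt.hyps(3) gen_Nt.prems(2) by (simp add: unit_refl)
    then show ?thesis by (intro disjI2 exI)
  next
    case 2
    have lift: "unit G \<gamma> (Nt A # \<beta>)" if "unit G \<gamma> \<beta>" for \<gamma>
      by (rule unit_tail[OF that A[unfolded 2(1)]])
    have "\<beta> \<in> items G" using item_Cons[OF assms(1) gen_Nt.prems(2)] by blast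
    from gen_Nt.IH(2)[OF 2(2) this] show ?thesis
    proof (elim disjE exE conjE)
      fix a assume "unit G [Tm a] \<beta>" "w = [a]"
      then have "unit G [Tm a] (Nt A # \<beta>) \<and> v @ w = [a]" using lift 2(1) by simp
      then show ?thesis by (intro disjI1 exI)
    next
      fix X \<delta> x y
      assume "X # \<delta> \<in> items G" "unit G (X # \<delta>) \<beta>" "gen G [X] x" "gen G \<delta> y"
        "w = x @ y" "x \<noteq> []" "y \<noteq> []"
      then have "X # \<delta> \<in> items G \<and> unit G (X # \<delta>) (Nt A # \<beta>) \<and> gen G [X] x \<and> gen G \<delta> y \<and>
        v @ w = x @ y \<and> x \<noteq> [] \<and> y \<noteq> []"
        using lift 2(1) by simp
      then show ?thesis by (intro disjI2 exI)
    qed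
  next
    case 3
    have lift: "unit G \<gamma> (Nt A # \<beta>)" if "unit G \<gamma> \<alpha>" for \<gamma>
      by (rule unit_head[OF unit_prod[OF that gen_Nt.hyps(1)] gen_Nt.hyps(3)[unfolded 3(2)]])
    have "\<alpha> \<in> items G" using gen_Nt.hyps(1) by (rule production_item)
    from gen_Nt.IH(1)[OF 3(1) this] show ?thesis
    proof (elim disjE exE conjE)
      fix a assume "unit G [Tm a] \<alpha>" "v = [a]"
      then have "unit G [Tm a] (Nt A # \<beta>) \<and> v @ w = [a]" using lift 3(2) by simp
      then show ?thesis by (intro disjI1 exI)
    next
      fix X \<delta> x y
      assume "X # \<delta> \<in> items G" "unit G (X # \<delta>) \<alpha>" "gen G [X] x" "gen G \<delta> y"
        "v = x @ y" "x \<noteq> []" "y \<noteq> []"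
      then have "X # \<delta> \<in> items G \<and> unit G (X # \<delta>) (Nt A # \<beta>) \<and> gen G [X] x \<and> gen G \<delta> y \<and>
        v @ w = x @ y \<and> x \<noteq> [] \<and> y \<noteq> []"
        using lift 3(2) by simp
      then show ?thesis by (intro disjI2 exI)
    qed
  qed
qed

section \<open>Paths typed by items\<close>

lemma labeled_path_Nil [simp]: "labeled_path E u [] v \<longleftrightarrow> u = v"
  by (subst labeled_path.simps) auto

lemma labeled_path_Cons [simp]:
  "labeled_path E u (a # w) v \<longleftrightarrow> (\<exists>x. (u, a, x) \<in> E \<and> labeled_path E x w v)"
  by (subst labeled_path.simps) auto

lemma labeled_path_append:
  "labeled_path E u (v @ w) x \<longleftrightarrow> (\<exists>y. labeled_path E u v y \<and> labeled_path E y w x)"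
  by (induction v arbitrary: u) auto

lemma labeled_path_trancl:
  "labeled_path E u w v \<Longrightarrow> w \<noteq> [] \<Longrightarrow> (u, v) \<in> {(u, v). \<exists>a. (u, a, v) \<in> E}\<^sup>+"
proof (induction rule: labeled_path.induct)
  case (2 u a v w x)
  then have e: "(u, v) \<in> {(u, v). \<exists>a. (u, a, v) \<in> E}" by auto
  show ?case
  proof (cases "w = []")
    case True
    then have "x = v" using 2(2) by simp
    then show ?thesis using e by blast
  next
    case False
    then show ?thesis using trancl_into_trancl2[OF e] 2 by blast
  qed
qed simp

text \<open>Only nonempty words count, so that related vertices are joined by at least one edge and
  hence strictly ordered topologically. Empty paths are left to the diagonal.\<close>

definition item_rel :: "('n, 't) cfg \<Rightarrow> (nat \<times> 't \<times> nat) set \<Rightarrow> nat \<Rightarrow> nat \<Rightarrow> nat \<Rightarrow> bool" where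
  "item_rel G E i u v \<longleftrightarrow> (\<exists>\<beta> \<in> items G. to_nat_on (items G) \<beta> = i \<and>
     (\<exists>w. w \<noteq> [] \<and> gen G \<beta> w \<and> labeled_path E u w v))"

text \<open>The closure under \<open>unit\<close> is built into the rules, hence precomputed for the
  fixed grammar; the same holds for \<open>item_labels\<close>.\<close>

definition item_rules :: "('n, 't) cfg \<Rightarrow> (nat \<times> nat \<times> nat) set" where
  "item_rules G = {(to_nat_on (items G) \<beta>, to_nat_on (items G) [X], to_nat_on (items G) \<delta>) | \<beta> X \<delta>.
     \<beta> \<in> items G \<and> X # \<delta> \<in> items G \<and> unit G (X # \<delta>) \<beta>}"

definition item_labels :: "('n, 't) cfg \<Rightarrow> nat \<Rightarrow> nat set" where
  "item_labels G i = {to_nat_on (terminals G) a | a \<beta>. a \<in> terminals G \<and> \<beta> \<in> items G \<and>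
     to_nat_on (items G) \<beta> = i \<and> unit G [Tm a] \<beta>}"

definition label_rel :: "'t set \<Rightarrow> (nat \<times> 't \<times> nat) set \<Rightarrow> nat \<Rightarrow> nat \<Rightarrow> nat \<Rightarrow> bool" where
  "label_rel \<Sigma> E l u v \<longleftrightarrow> (\<exists>a \<in> \<Sigma>. to_nat_on \<Sigma> a = l \<and> (u, a, v) \<in> E)"

lemma to_nat_on_less:
  assumes "finite A" "a \<in> A"
  shows "to_nat_on A a < card A"
  using bij_betwE[OF to_nat_on_finite[OF assms(1)]] assms(2) by blast

lemma to_nat_on_eq:
  assumes "finite A" "a \<in> A" "b \<in> A"
  shows "to_nat_on A a = to_nat_on A b \<longleftrightarrow> a = b"
  by (rule inj_on_eq_iff[OF bij_betw_imp_inj_on[OF to_nat_on_finite[OF assms(1)]] assms(2,3)])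

lemma item_rel_trancl:
  assumes "item_rel G E i u v"
  shows "(u, v) \<in> {(u, v). \<exists>a. (u, a, v) \<in> E}\<^sup>+"
proof -
  obtain w where "w \<noteq> []" "labeled_path E u w v" using assms unfolding item_rel_def by blast
  then show ?thesis by (intro labeled_path_trancl)
qed

context
  fixes G :: "('n, 't) cfg"
  assumes G: "wf_cfg G"
begin

lemma item_rel_item:
  assumes "\<beta> \<in> items G"
  shows "item_rel G E (to_nat_on (items G) \<beta>) u v \<longleftrightarrow> (\<exists>w. w \<noteq> [] \<and> gen G \<beta> w \<and> labeled_path E u w v)"
proof
  assume "item_rel G E (to_nat_on (items G) \<beta>) u v"
  then obtain \<gamma> where c: "\<gamma> \<in> items G" "to_nat_on (items G) \<gamma> = to_nat_on (items G) \<beta>"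
    "\<exists>w. w \<noteq> [] \<and> gen G \<gamma> w \<and> labeled_path E u w v"
    unfolding item_rel_def by (elim bexE conjE)
  have "\<gamma> = \<beta>" using to_nat_on_eq[OF finite_items[OF G] c(1) assms] c(2) by (rule iffD1)
  from c(3)[unfolded this] show "\<exists>w. w \<noteq> [] \<and> gen G \<beta> w \<and> labeled_path E u w v" .
next
  assume "\<exists>w. w \<noteq> [] \<and> gen G \<beta> w \<and> labeled_path E u w v"
  then show "item_rel G E (to_nat_on (items G) \<beta>) u v"
    unfolding item_rel_def using assms by (intro bexI[of _ \<beta>] conjI refl)
qed

lemma item_rules_less:
  assumes "(i, j, k) \<in> item_rules G"
  shows "i < card (items G) \<and> j < card (items G) \<and> k < card (items G)"
proof -
  obtain \<beta> X \<delta> where r: "\<beta> \<in> items G" "X # \<delta> \<in> items G" "i = to_nat_on (items G) \<beta>"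
    "j = to_nat_on (items G) [X]" "k = to_nat_on (items G) \<delta>"
    using assms unfolding item_rules_def by blast
  show ?thesis unfolding r(3-5)
    using to_nat_on_less[OF finite_items[OF G]] r(1) item_Cons[OF G r(2)] by blast
qed

lemma finite_item_rules: "finite (item_rules G)"
  by (rule finite_subset[of _ "{..<card (items G)} \<times> {..<card (items G)} \<times> {..<card (items G)}"])
    (use item_rules_less in fast, simp)

lemma item_labels_less: "item_labels G i \<subseteq> {..<card (terminals G)}"
proof -
  have fin: "finite (terminals G)" using G by (simp add: wf_cfg_def)
  show ?thesis unfolding item_labels_def using to_nat_on_less[OF fin] by blast
qed

lemma item_rel_base:
  assumes "l \<in> item_labels G i" "label_rel (terminals G) E l u v"
  shows "item_rel G E i u v"
proof -
  have fin: "finite (terminals G)" using G by (simp add: wf_cfg_def)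
  obtain a \<beta> where a: "a \<in> terminals G" "\<beta> \<in> items G" "to_nat_on (items G) \<beta> = i" "unit G [Tm a] \<beta>"
    "l = to_nat_on (terminals G) a"
    using assms(1) unfolding item_labels_def by blast
  obtain b where "b \<in> terminals G" "to_nat_on (terminals G) b = l" "(u, b, v) \<in> E"
    using assms(2) unfolding label_rel_def by blast
  then have "(u, a, v) \<in> E" using to_nat_on_eq[OF fin _ a(1)] a(5) by blast
  then have "labeled_path E u [a] v" by simp
  moreover have "gen G \<beta> [a]" using a(4) by (rule unit_gen) (intro gen.intros)
  ultimately show ?thesis
    unfolding a(3)[symmetric] item_rel_item[OF a(2)] by blast
qed

lemma item_rel_closed:
  assumes "(i, j, k) \<in> item_rules G" "item_rel G E j u w" "item_rel G E k w v"
  shows "item_rel G E i u v"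
proof -
  obtain \<beta> X \<delta> where r: "\<beta> \<in> items G" "X # \<delta> \<in> items G" "unit G (X # \<delta>) \<beta>"
    "i = to_nat_on (items G) \<beta>" "j = to_nat_on (items G) [X]" "k = to_nat_on (items G) \<delta>"
    using assms(1) unfolding item_rules_def by blast
  have it: "[X] \<in> items G" "\<delta> \<in> items G" using item_Cons[OF G r(2)] by auto
  obtain x where x: "x \<noteq> []" "gen G [X] x" "labeled_path E u x w"
    using assms(2) unfolding r(5) item_rel_item[OF it(1)] by blast
  obtain y where y: "y \<noteq> []" "gen G \<delta> y" "labeled_path E w y v"
    using assms(3) unfolding r(6) item_rel_item[OF it(2)] by blast
  have "gen G (X # \<delta>) (x @ y)" using gen_append[OF x(2) y(2)] by simp
  then have "gen G \<beta> (x @ y)" by (rule unit_gen[OF r(3)])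
  moreover have "labeled_path E u (x @ y) v" unfolding labeled_path_append using x(3) y(3) by blast
  moreover have "x @ y \<noteq> []" using x(1) by simp
  ultimately show ?thesis unfolding r(4) item_rel_item[OF r(1)] by blast
qed

lemma item_rel_unfold:
  assumes "item_rel G E i u v" "labeled_graph (terminals G) n E"
  shows "(\<exists>l \<in> item_labels G i. label_rel (terminals G) E l u v) \<or>
    (\<exists>j k w. (i, j, k) \<in> item_rules G \<and> item_rel G E j u w \<and> item_rel G E k w v)"
proof -
  obtain \<beta> w where b: "\<beta> \<in> items G" "to_nat_on (items G) \<beta> = i" "w \<noteq> []" "gen G \<beta> w" "labeled_path E u w v"
    using assms(1) by (auto simp: item_rel_def)
  from gen_split[OF G b(4,3,1)] show ?thesis
  proof (elim disjE exE conjE)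
    fix a assume a: "unit G [Tm a] \<beta>" "w = [a]"
    then have "(u, a, v) \<in> E" using b by simp
    moreover from this have "a \<in> terminals G" using assms(2) by (auto simp: labeled_graph_def)
    ultimately have "label_rel (terminals G) E (to_nat_on (terminals G) a) u v"
      "to_nat_on (terminals G) a \<in> item_labels G i"
      using a(1) b(1,2) \<open>(u, a, v) \<in> E\<close> unfolding item_labels_def label_rel_def by blast+
    then show ?thesis by (intro disjI1 bexI)
  next
    fix X \<delta> x y assume s: "X # \<delta> \<in> items G" "unit G (X # \<delta>) \<beta>" "gen G [X] x" "gen G \<delta> y" "w = x @ y" "x \<noteq> []" "y \<noteq> []"
    obtain z where z: "labeled_path E u x z" "labeled_path E z y v"
      using b(5) unfolding s(5) labeled_path_append by blast
    have it: "[X] \<in> items G" "\<delta> \<in> items G" using item_Cons[OF G s(1)] by auto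
    have "(i, to_nat_on (items G) [X], to_nat_on (items G) \<delta>) \<in> item_rules G"
      using b(1,2) s(1,2) unfolding item_rules_def by blast
    moreover have "item_rel G E (to_nat_on (items G) [X]) u z"
      unfolding item_rel_def using it(1) s(3,6) z(1) by blast
    moreover have "item_rel G E (to_nat_on (items G) \<delta>) z v"
      unfolding item_rel_def using it(2) s(4,7) z(2) by blast
    ultimately show ?thesis by (intro disjI2 exI conjI)
  qed
qed

text \<open>By acyclicity a path from \<open>u\<close> to \<open>u\<close> is empty, whereas
  distinct vertices are joined by nonempty paths only.\<close>

lemma S_path_iff:
  assumes "labeled_dag \<Sigma> n E"
  shows "S_path G E u v \<longleftrightarrow>
    (if u = v then gen G [Nt (start G)] [] else item_rel G E (to_nat_on (items G) [Nt (start G)]) u v)"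
proof -
  have ac: "acyclic {(u, v). \<exists>a. (u, a, v) \<in> E}" using assms by (simp add: labeled_dag_def)
  show ?thesis
  proof (cases "u = v")
    case True
    have nil: "w = []" if "labeled_path E u w v" for w
    proof (rule ccontr)
      assume "w \<noteq> []"
      from labeled_path_trancl[OF that this] have "(u, u) \<in> {(u, v). \<exists>a. (u, a, v) \<in> E}\<^sup>+"
        unfolding True .
      moreover have "(u, u) \<notin> {(u, v). \<exists>a. (u, a, v) \<in> E}\<^sup>+"
        using ac unfolding acyclic_def by (rule spec)
      ultimately show False by contradiction
    qed
    have "S_path G E u v \<longleftrightarrow> gen G [Nt (start G)] []"
    proof
      assume "S_path G E u v"
      then obtain w where "gen G [Nt (start G)] w" "labeled_path E u w v"
        unfolding S_path_def Bex_def lang_iff_gen by blast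
      then show "gen G [Nt (start G)] []" using nil by blast
    next
      assume "gen G [Nt (start G)] []"
      then show "S_path G E u v" unfolding S_path_def Bex_def lang_iff_gen
        by (intro exI[of _ "[]"]) (simp add: True)
    qed
    then show ?thesis using True by simp
  next
    case False
    have wne: "w \<noteq> []" if "labeled_path E u w v" for w
    proof
      assume "w = []"
      then show False using that False by simp
    qed
    have "S_path G E u v \<longleftrightarrow> (\<exists>w. w \<noteq> [] \<and> gen G [Nt (start G)] w \<and> labeled_path E u w v)"
      unfolding S_path_def Bex_def lang_iff_gen
      by (intro arg_cong[where f = Ex] ext) (use wne in blast)
    also have "\<dots> \<longleftrightarrow> item_rel G E (to_nat_on (items G) [Nt (start G)]) u v"
      by (rule item_rel_item[OF start_item[OF G], symmetric])
    finally show ?thesis by (simp only: False if_False)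
  qed
qed

end

section \<open>Reachability in the time of matrix multiplication\<close>

text \<open>Boolean products are read off integer products of 0/1 matrices: an entry is the number
  of common intermediate indices. Step counts are natural, so \<open>T n\<close> may be rounded
  down.\<close>

lemma matmul_prog_of_multiplies:
  assumes "multiplies_matrices_within q T"
  obtains mq kq where "matmul_prog q mq kq (\<lambda>n. nat \<lfloor>T n\<rfloor>)"
proof -
  obtain kq where kq: "\<forall>n M. \<forall>A \<in> carrier_mat n n. \<forall>B \<in> carrier_mat n n.
        (\<forall>i<n. \<forall>j<n. \<bar>A $$ (i, j)\<bar> \<le> int M \<and> \<bar>B $$ (i, j)\<bar> \<le> int M) \<longrightarrow>
        (\<exists>t s. exec (int ((n + M + 2) ^ kq)) q (matmul_input n A B) t s \<and>
           real t \<le> T n \<and>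
           (\<forall>i<n. \<forall>j<n. output_table n s i j = (A * B) $$ (i, j)))"
    using assms unfolding multiplies_matrices_within_def ..
  obtain mq where mq: "cvs q \<subseteq> {..<mq}"
    using finite_nat_iff_bounded[of "cvs q"] by auto
  have "matmul_prog q mq kq (\<lambda>n. nat \<lfloor>T n\<rfloor>)"
  proof
    show "cvs q \<subseteq> {..<mq}" by (rule mq)
  next
    fix n and P Q :: "nat \<Rightarrow> nat \<Rightarrow> bool"
    define A :: "int mat" where "A = mat n n (\<lambda>(i, j). of_bool (P i j))"
    define B :: "int mat" where "B = mat n n (\<lambda>(i, j). of_bool (Q i j))"
    have A: "A \<in> carrier_mat n n" and B: "B \<in> carrier_mat n n" by (simp_all add: A_def B_def)
    have "\<forall>i<n. \<forall>j<n. \<bar>A $$ (i, j)\<bar> \<le> int 1 \<and> \<bar>B $$ (i, j)\<bar> \<le> int 1"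
      by (simp add: A_def B_def)
    from kq[THEN spec, THEN spec, THEN bspec, OF A, THEN bspec, OF B, THEN mp, OF this]
    obtain t s where ts: "exec (int ((n + 1 + 2) ^ kq)) q (matmul_input n A B) t s" "real t \<le> T n"
      and out: "\<forall>i<n. \<forall>j<n. output_table n s i j = (A * B) $$ (i, j)"
      by (elim exE conjE)
    have tabs: "table_array n (\<lambda>i j. A $$ (i, j)) = table_array n (\<lambda>i j. of_bool (P i j))"
      "table_array n (\<lambda>i j. B $$ (i, j)) = table_array n (\<lambda>i j. of_bool (Q i j))"
    proof -
      have d: "nat z div n < n \<and> nat z mod n < n" if "0 \<le> z \<and> z < int (n * n)" for z
      proof -
        have "nat z < n * n" using that by linarith
        from div_mod_less[OF this] show ?thesis by blast
      qed
      show "table_array n (\<lambda>i j. A $$ (i, j)) = table_array n (\<lambda>i j. of_bool (P i j))"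
        "table_array n (\<lambda>i j. B $$ (i, j)) = table_array n (\<lambda>i j. of_bool (Q i j))"
        unfolding table_array_def by (intro ext if_cong refl; use d in \<open>simp add: A_def B_def\<close>)+
    qed
    have AB: "(A * B) $$ (i, j) = (\<Sum>w<n. of_bool (P i w \<and> Q w j))" if "i < n" "j < n" for i j
      using that by (simp add: A_def B_def scalar_prod_def atLeast0LessThan of_bool_conj)
    have "output_table n s i j \<ge> 0 \<and> (output_table n s i j \<noteq> 0 \<longleftrightarrow> (\<exists>w<n. P i w \<and> Q w j))"
      if "i < n" "j < n" for i j
    proof -
      have o: "output_table n s i j = (\<Sum>w<n. of_bool (P i w \<and> Q w j))" using out that AB by simp
      have "(\<Sum>w<n. of_bool (P i w \<and> Q w j) :: int) = 0 \<longleftrightarrow> (\<forall>w\<in>{..<n}. of_bool (P i w \<and> Q w j) = (0::int))"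
        by (rule sum_nonneg_eq_0_iff) simp_all
      then show ?thesis unfolding o by (auto intro: sum_nonneg)
    qed
    moreover have "t \<le> nat \<lfloor>T n\<rfloor>" using ts(2) by (simp add: le_nat_floor)
    moreover have "int ((n + 1 + 2) ^ kq) = (int n + 3) ^ kq"
    proof -
      have "n + 1 + 2 = n + 3" by simp
      then show ?thesis by (simp only: of_nat_power of_nat_add of_nat_numeral)
    qed
    ultimately show "\<exists>t s. exec ((int n + 3) ^ kq) q
        (size_scalar n, (\<lambda>_ _. 0)(1 := table_array n (\<lambda>i j. of_bool (P i j)),
          2 := table_array n (\<lambda>i j. of_bool (Q i j)))) t s \<and> t \<le> nat \<lfloor>T n\<rfloor> \<and>
        (\<forall>i<n. \<forall>j<n. output_table n s i j \<ge> 0 \<and>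
           (output_table n s i j \<noteq> 0 \<longleftrightarrow> (\<exists>w<n. P i w \<and> Q w j)))"
      using ts(1) unfolding matmul_input_def tabs by (intro exI[of _ t] exI[of _ s]) simp
  qed
  then show ?thesis by (rule that)
qed

lemma dag_cfl_reachability_of_matmul:
  fixes G :: "('n, 't) cfg"
  assumes G: "wf_cfg G" and q: "multiplies_matrices_within q T"
    and T: "T \<in> O(\<lambda>n. real n powr c)" and c: "2 < c"
  shows "dag_cfl_reachability_in_time_O G (\<lambda>n. real n powr c)"
proof -
  define \<tau> where "\<tau> n = nat \<lfloor>T n\<rfloor>" for n
  obtain mq kq where mp: "matmul_prog q mq kq \<tau>"
    using matmul_prog_of_multiplies[OF q] unfolding \<tau>_def by blast
  have fin: "finite (terminals G)" "finite (items G)"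
    using G finite_items by (auto simp: wf_cfg_def)
  let ?\<Sigma> = "terminals G"
  define ml cI where "ml = card ?\<Sigma>" and "cI = card (items G)"
  obtain rs where rs: "set rs = item_rules G" using finite_list[OF finite_item_rules[OF G]] by blast
  have "finite (item_labels G i)" for i
    by (rule finite_subset[OF item_labels_less[OF G]]) simp
  then have "\<exists>ls. set ls = item_labels G i" for i by (rule finite_list)
  then obtain bl where bl: "\<And>i. set (bl i) = item_labels G i" by metis
  define st where "st = to_nat_on (items G) [Nt (start G)]"
  define nul :: int where "nul = of_bool (gen G [Nt (start G)] [])"
  interpret cfl_program q mq kq \<tau> ml cI st rs bl nul
  proof (intro cfl_program.intro cfl_program_axioms.intro)
    show "matmul_prog q mq kq \<tau>" by (rule mp)
    show "i < cI \<and> j < cI \<and> k < cI" if "(i, j, k) \<in> set rs" for i j k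
      using item_rules_less[OF G] that unfolding rs cI_def by blast
    show "set (bl i) \<subseteq> {..<ml}" for i unfolding bl ml_def by (rule item_labels_less[OF G])
    show "st < cI" unfolding st_def cI_def by (rule to_nat_on_less[OF fin(2) start_item[OF G]])
    show "\<bar>nul\<bar> \<le> 1" by (simp add: nul_def)
  qed
  obtain C where C: "0 \<le> C" "\<And>n. 1 \<le> n \<Longrightarrow> T n \<le> C * real n powr c"
    using bigo_powr_bound[OF T] c by auto
  have "real (\<tau> d) \<le> C * real d powr c" if "1 \<le> d" for d
  proof -
    \<comment> \<open>The quadratic lower bound excludes negative \<open>T d\<close>, for which
      \<open>nat\<close> would round up to 0.\<close>
    have "0 \<le> T d" using multiplies_matrices_time_ge[OF q, of d] by (rule order_trans[rotated]) simp
    then have "real (\<tau> d) \<le> T d" unfolding \<tau>_def by simp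
    then show ?thesis using C(2)[OF that] by linarith
  qed
  from solver_time_bigo[OF c C(1) this]
  have time: "(\<lambda>n. real (solver_time n)) \<in> O(\<lambda>n. real n powr c)" .
  obtain k' where k': "\<And>n e s R. fst s = size_scalar n \<Longrightarrow> labels ml n e s \<Longrightarrow>
      (\<And>a z. a = 0 \<or> ml < a \<Longrightarrow> snd s a z = 0) \<Longrightarrow> (\<And>a z. \<bar>snd s a z\<bar> \<le> 1) \<Longrightarrow>
      path_system n e R \<Longrightarrow>
      \<exists>t s'. exec (int ((n + 2) ^ k')) solver s t s' \<and> t \<le> solver_time n \<and>
        (\<forall>u<n. \<forall>v<n. output_table n s' u v = (if u = v then nul else of_bool (R st u v)))"
    by (rule solver_exec) blast
  have "solves_dag_cfl_reachability_within G solver (\<lambda>n. real (solver_time n))"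
    unfolding solves_dag_cfl_reachability_within_def
  proof (rule exI[of _ k'], intro allI impI)
    fix n E assume dag: "labeled_dag ?\<Sigma> n E"
    then have graph: "labeled_graph ?\<Sigma> n E" by (simp add: labeled_dag_def)
    let ?e = "label_rel ?\<Sigma> E" and ?s = "graph_input ?\<Sigma> n E"
    have edges: "label_edges n ?e = {(u, v). \<exists>a. (u, a, v) \<in> E}"
    proof -
      have "u < n \<and> v < n \<and> (\<exists>l<ml. ?e l u v) \<longleftrightarrow> (\<exists>a. (u, a, v) \<in> E)" for u v
      proof
        assume "u < n \<and> v < n \<and> (\<exists>l<ml. ?e l u v)"
        then show "\<exists>a. (u, a, v) \<in> E" unfolding label_rel_def by blast
      next
        assume "\<exists>a. (u, a, v) \<in> E"
        then obtain a where e: "(u, a, v) \<in> E" by (elim exE)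
        then have a: "u < n" "v < n" "a \<in> ?\<Sigma>" using graph by (auto simp: labeled_graph_def)
        then have "to_nat_on ?\<Sigma> a < ml" unfolding ml_def by (intro to_nat_on_less[OF fin(1)])
        moreover have "?e (to_nat_on ?\<Sigma> a) u v" unfolding label_rel_def using a e by blast
        ultimately show "u < n \<and> v < n \<and> (\<exists>l<ml. ?e l u v)" using a by blast
      qed
      then show ?thesis by (simp only: label_edges_def)
    qed
    have "\<exists>t s'. exec (int ((n + 2) ^ k')) solver ?s t s' \<and> t \<le> solver_time n \<and>
        (\<forall>u<n. \<forall>v<n. output_table n s' u v = (if u = v then nul else of_bool (item_rel G E st u v)))"
    proof (rule k'[where R = "item_rel G E" and e = ?e])
      show "fst ?s = size_scalar n" by (simp add: graph_input_def)
      show "labels ml n ?e ?s" unfolding labels_def tab_def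
      proof (intro allI impI)
        fix l u v assume uv: "l < ml" "u < n" "v < n"
        have lt: "u * n + v < n * n"
        proof -
          have "u * n + v < Suc u * n" using uv by simp
          also have "\<dots> \<le> n * n" using uv by (intro mult_le_mono1) simp
          finally show ?thesis .
        qed
        have "snd ?s (Suc l) (int (u * n + v)) =
          of_bool (\<exists>a\<in>?\<Sigma>. to_nat_on ?\<Sigma> a + 1 = Suc l \<and>
            ((u * n + v) div n, a, (u * n + v) mod n) \<in> E)"
          using lt by (simp add: graph_input_def table_array_def del: of_nat_add of_nat_mult)
        moreover have "(u * n + v) div n = u" "(u * n + v) mod n = v" using uv by simp_all
        ultimately show "snd ?s (Suc l) (int (u * n + v)) = of_bool (?e l u v)"
          by (simp add: label_rel_def del: of_nat_add of_nat_mult)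
      qed
      show "snd ?s a z = 0" if "a = 0 \<or> ml < a" for a z
      proof -
        have "to_nat_on ?\<Sigma> x + 1 \<noteq> a" if "a \<noteq> 0" "x \<in> ?\<Sigma>" for x
          using to_nat_on_less[OF fin(1) that(2)] \<open>a = 0 \<or> ml < a\<close> that(1) by (simp add: ml_def)
        then show ?thesis by (auto simp: graph_input_def table_array_def)
      qed
      show "\<bar>snd ?s a z\<bar> \<le> 1" for a z by (simp add: graph_input_def table_array_def)
      have "item_rel G E i u v" if "l \<in> set (bl i)" "?e l u v" for i l u v
        using item_rel_base[OF G] that unfolding bl by blast
      moreover have "item_rel G E i u v"
        if "(i, j, k) \<in> set rs" "item_rel G E j u w" "item_rel G E k w v" for i j k u w v
        using item_rel_closed[OF G] that unfolding rs by blast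
      moreover have "(\<exists>l\<in>set (bl i). ?e l u v) \<or>
          (\<exists>j k w. (i, j, k) \<in> set rs \<and> item_rel G E j u w \<and> item_rel G E k w v)"
        if "item_rel G E i u v" for i u v
        using item_rel_unfold[OF G that graph] unfolding bl rs .
      moreover have "(u, v) \<in> (label_edges n ?e)\<^sup>+" if "item_rel G E i u v" for i u v
        unfolding edges by (rule item_rel_trancl[OF that])
      moreover have "acyclic (label_edges n ?e)"
        unfolding edges using dag by (simp add: labeled_dag_def)
      ultimately show "path_system n ?e (item_rel G E)"
        unfolding path_system_def by (intro conjI allI impI)
    qed
    then obtain t s' where r: "exec (int ((n + 2) ^ k')) solver ?s t s'" "t \<le> solver_time n"
      "\<forall>u<n. \<forall>v<n. output_table n s' u v = (if u = v then nul else of_bool (item_rel G E st u v))"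
      by (elim exE conjE)
    have "\<forall>u<n. \<forall>v<n. output_table n s' u v = of_bool (S_path G E u v)"
      using r(3) unfolding S_path_iff[OF G dag] nul_def st_def by simp
    then show "\<exists>t s. exec (int ((n + 2) ^ k')) solver ?s t s \<and> real t \<le> real (solver_time n) \<and>
        (\<forall>u<n. \<forall>v<n. output_table n s u v = of_bool (S_path G E u v))"
      using r(1,2) by (intro exI[of _ t] exI[of _ s'] conjI) simp_all
  qed
  then show ?thesis unfolding dag_cfl_reachability_in_time_O_def using time by blast
qed

text \<open>As an infimum, \<open>\<omega>\<close> is approached by exponents of actual programs,
  whence the version with \<open>\<epsilon>\<close>. If \<open>\<omega>\<close> is attained and
  exceeds 2, the geometric series converges to the exact bound; at 2 its terms would all be equal
  and this argument would lose a logarithmic factor.\<close>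

theorem theorem10:
  fixes G :: "('n, 't) cfg"
  assumes "wf_cfg G"
  shows "(\<forall>\<epsilon>>0. dag_cfl_reachability_in_time_O G (\<lambda>n. real n powr (\<omega> + \<epsilon>))) \<and>
         (\<omega> \<in> matmul_exponents \<and> \<omega> > 2 \<longrightarrow>
            dag_cfl_reachability_in_time_O G (\<lambda>n. real n powr \<omega>))"
proof (intro conjI allI impI)
  fix \<epsilon> :: real assume \<epsilon>: "0 < \<epsilon>"
  have ne: "matmul_exponents \<noteq> {}" using matmul_exponents_nonempty by blast
  have "2 \<le> \<omega>" unfolding matmul_exponent_def
    using matmul_exponents_ge_2 by (intro cInf_greatest ne)
  have "Inf matmul_exponents < \<omega> + \<epsilon>" using \<epsilon> by (simp add: matmul_exponent_def)
  from cInf_lessD[OF ne this] obtain c where c: "c \<in> matmul_exponents" "c < \<omega> + \<epsilon>" by blast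
  then obtain q T where q: "multiplies_matrices_within q T" "T \<in> O(\<lambda>n. real n powr c)"
    by (auto simp: matmul_exponents_def)
  have "(\<lambda>n. real n powr c) \<in> O(\<lambda>n. real n powr (\<omega> + \<epsilon>))"
    using powr_bigo_iff[OF filterlim_real_sequentially, of c "\<omega> + \<epsilon>"] c(2) by simp
  then have "T \<in> O(\<lambda>n. real n powr (\<omega> + \<epsilon>))" by (rule landau_o.big_trans[OF q(2)])
  with q(1) show "dag_cfl_reachability_in_time_O G (\<lambda>n. real n powr (\<omega> + \<epsilon>))"
    by (rule dag_cfl_reachability_of_matmul[OF assms]) (use \<epsilon> \<open>2 \<le> \<omega>\<close> in simp)
next
  assume "\<omega> \<in> matmul_exponents \<and> \<omega> > 2"
  then obtain q T where "multiplies_matrices_within q T" "T \<in> O(\<lambda>n. real n powr \<omega>)" "2 < \<omega>"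
    by (auto simp: matmul_exponents_def)
  then show "dag_cfl_reachability_in_time_O G (\<lambda>n. real n powr \<omega>)"
    by (rule dag_cfl_reachability_of_matmul[OF assms])
qed

end
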